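(* Let $\Omega$ be a bounded strictly convex domain in $\mathbb{R}^n$ with smooth boundary and diameter $D$, let $q(x)\in C^\infty(\overline \Omega)$, and let $u(x)$ be a nonnegative first eigenfunction of the operator $\Delta-q$ on $\Omega$ with Dirichlet boundary data. Let $\psi(s)\in C^\infty([0,D/2])$ with $\psi(0)=0$, $\psi_{ss}(0)=0$ and $\psi_s>0$. Suppose that $$E_q(x,y)\geq \varphi(r(x,y)/2)$$ for all $x,y\in\Omega$, where $\varphi$ is a nonnegative function on $[0,D/2]$. Then $$E_f(x,y)\geq m\psi(r(x,y)/2)$$ for any $x,y\in \Omega$, where $f=-\log u$ and $$m=\min_{s\in [0,D/2]}\frac{\psi_{ss}+\sqrt{\psi_{ss}^2+4\varphi\psi\psi_s}}{2\psi_s\psi}.$$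
   Context: For $x,y\in\mathbb{R}^n$ let $r(x,y)=\|x-y\|$, and for $x\neq y$ let $N(x,y)=\frac{y-x}{\|y-x\|}$ and $\theta(s,x,y)=x+sN(x,y)$. For a function $g$ on $\Omega$, $E_g(x,y)=\int_0^{r(x,y)}\nabla^2 g(\theta(s,x,y))(N(x,y),N(x,y))\,ds$ (equal to $0$ when $x=y$). Subscripts $s$ denote derivatives in $s$. *)

theory Defs
  imports "HOL-Analysis.Analysis"
begin

fun dd :: "('a::real_normed_vector \<Rightarrow> real) \<Rightarrow> 'a list \<Rightarrow> 'a \<Rightarrow> real" where
  "dd g [] = g"
| "dd g (v # vs) = (\<lambda>x. frechet_derivative (dd g vs) (at x) v)"

definition smooth_on :: "'a::real_normed_vector set \<Rightarrow> ('a \<Rightarrow> real) \<Rightarrow> bool" where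
  "smooth_on S g \<longleftrightarrow> (\<forall>vs. \<forall>x\<in>S. dd g vs differentiable (at x))"

definition smooth_upto :: "'a::real_normed_vector set \<Rightarrow> ('a \<Rightarrow> real) \<Rightarrow> bool" where
  "smooth_upto S g \<longleftrightarrow> (\<exists>U G. open U \<and> S \<subseteq> U \<and> smooth_on U G \<and> (\<forall>x\<in>S. G x = g x))"

definition C2_on :: "'a::real_normed_vector set \<Rightarrow> ('a \<Rightarrow> real) \<Rightarrow> bool" where
  "C2_on S g \<longleftrightarrow> (\<forall>x\<in>S. g differentiable (at x) \<and> (\<forall>v. dd g [v] differentiable (at x)))
                 \<and> (\<forall>v w. continuous_on S (dd g [v, w]))"

definition hess :: "('a::real_normed_vector \<Rightarrow> real) \<Rightarrow> 'a \<Rightarrow> 'a \<Rightarrow> 'a \<Rightarrow> real" where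
  "hess g x v w = dd g [v, w] x"

definition laplacian :: "('a::euclidean_space \<Rightarrow> real) \<Rightarrow> 'a \<Rightarrow> real" where
  "laplacian g x = (\<Sum>b\<in>Basis. hess g x b b)"

definition r :: "'a::euclidean_space \<Rightarrow> 'a \<Rightarrow> real" where
  "r x y = norm (x - y)"

definition N :: "'a::euclidean_space \<Rightarrow> 'a \<Rightarrow> 'a" where
  "N x y = (y - x) /\<^sub>R norm (y - x)"

definition \<theta> :: "real \<Rightarrow> 'a::euclidean_space \<Rightarrow> 'a \<Rightarrow> 'a" where
  "\<theta> s x y = x + s *\<^sub>R N x y"

definition E :: "('a::euclidean_space \<Rightarrow> real) \<Rightarrow> 'a \<Rightarrow> 'a \<Rightarrow> real" where
  "E g x y = (if x = y then 0
              else integral {0..r x y} (\<lambda>s. hess g (\<theta> s x y) (N x y) (N x y)))"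

definition smooth_bounded_domain :: "'a::euclidean_space set \<Rightarrow> bool" where
  "smooth_bounded_domain \<Omega> \<longleftrightarrow> bounded \<Omega> \<and> connected \<Omega> \<and> \<Omega> \<noteq> {} \<and>
     (\<exists>\<rho>. smooth_on UNIV \<rho> \<and> \<Omega> = {x. \<rho> x < 0} \<and>
          (\<forall>x. \<rho> x = 0 \<longrightarrow> frechet_derivative \<rho> (at x) \<noteq> (\<lambda>_. 0)))"

definition strictly_convex :: "'a::euclidean_space set \<Rightarrow> bool" where
  "strictly_convex \<Omega> \<longleftrightarrow>
     (\<forall>x\<in>closure \<Omega>. \<forall>y\<in>closure \<Omega>. x \<noteq> y \<longrightarrow> open_segment x y \<subseteq> \<Omega>)"

definition dirichlet_eigenpair ::
  "'a::euclidean_space set \<Rightarrow> ('a \<Rightarrow> real) \<Rightarrow> real \<Rightarrow> ('a \<Rightarrow> real) \<Rightarrow> bool" where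
  "dirichlet_eigenpair \<Omega> q \<mu> w \<longleftrightarrow>
     C2_on \<Omega> w \<and> continuous_on (closure \<Omega>) w \<and>
     (\<forall>x\<in>frontier \<Omega>. w x = 0) \<and> (\<exists>x\<in>\<Omega>. w x \<noteq> 0) \<and>
     (\<forall>x\<in>\<Omega>. laplacian w x - q x * w x = - \<mu> * w x)"

definition first_dirichlet_eigenfunction ::
  "'a::euclidean_space set \<Rightarrow> ('a \<Rightarrow> real) \<Rightarrow> ('a \<Rightarrow> real) \<Rightarrow> bool" where
  "first_dirichlet_eigenfunction \<Omega> q u \<longleftrightarrow>
     (\<exists>lam. dirichlet_eigenpair \<Omega> q lam u \<and>
          (\<forall>\<mu> w. dirichlet_eigenpair \<Omega> q \<mu> w \<longrightarrow> lam \<le> \<mu>))"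

end

theory Submission
  imports Defs
begin

text \<open>Write \<open>f = - ln u\<close>; then \<open>E f x y\<close> is the derivative in \<open>s\<close> of \<open>f (c + s n) + f (c - s n)\<close>, where \<open>c\<close> is
  the midpoint of \<open>x\<close> and \<open>y\<close>, \<open>n = N x y\<close> and \<open>s = r x y / 2\<close>. Working with differences of this
  quantity instead of its derivative, only the given \<open>C\<^sup>2\<close> regularity of \<open>u\<close> is needed.

  First, \<open>u\<close> is log-concave: \<open>v z = sup\<^sub>h sqrt (u (z + h) * u (z - h))\<close> is a subsolution of the linear
  equation of \<open>u\<close> because \<open>q\<close> is convex, and the maximum principle in a thin boundary strip together with
  the strong maximum principle forces \<open>v\<close> to be a multiple of \<open>u\<close>, hence equal to \<open>u\<close>. In particular \<open>f\<close> is
  convex and blows up at the boundary.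

  Then let \<open>X' = \<xi>\<close>, where \<open>\<xi>\<close> is a small perturbation of \<open>m \<psi>\<close> satisfying \<open>\<xi> \<xi>' - \<xi>'' < \<phi>\<close> and \<open>\<xi> 0 < 0\<close>.
  By convexity and the blow-up, a positive supremum of
  \<open>X s - X t - f (c + s n) - f (c - s n) + f (c + t n) + f (c - t n)\<close> over all \<open>c\<close>, \<open>n\<close> and
  \<open>0 \<le> t \<le> s\<close> would be attained with \<open>0 < t < s\<close>. The first-order conditions, and the second-order condition
  for moving two of the points by \<open>b\<close> and the other two by the reflection of \<open>b\<close> in \<open>n\<close>, summed over an
  orthonormal basis, contradict \<open>\<Delta> f = lam - q + \<bar>\<nabla> f\<bar>\<^sup>2\<close> and the bound on \<open>E q\<close>.\<close>

section \<open>Second differences and directional derivatives\<close>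

text \<open>The comparison function \<open>m * \<psi>\<close> has to satisfy
  \<open>\<xi> * \<xi>' - \<xi>'' \<le> \<phi>\<close>. For constant \<open>m\<close> this is a
  quadratic inequality in \<open>m\<close>, and the quotient whose infimum defines \<open>m\<close>
  is the larger root of that quadratic; the other root is nonpositive. The obstacle is regularity.
  \<open>E f\<close> already contains first derivatives, so a second-order condition at a minimum of
  \<open>E f - m * \<psi>\<close> would involve third derivatives of \<open>u\<close>. Comparing two
  levels \<open>t\<close> and \<open>s\<close> lowers the order by one, at the price of four points
  instead of two and of two degenerate configurations. The case \<open>t = 0\<close> is excluded by
  \<open>\<xi> 0 < 0\<close>. The case \<open>t = s\<close> is excluded by the bound
  \<open>\<Lambda> * (s - t)\<close> on the four-point function, which rests on convexity of
  \<open>f\<close>; this is why log-concavity has to be available beforehand. The function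
  \<open>v\<close> in the log-concavity argument is a supremum with no derivatives at hand, and this
  is why the maximum principles are formulated with second differences.\<close>

lemma second_difference_tendsto:
  fixes g g' :: "real \<Rightarrow> real"
  assumes g: "eventually (\<lambda>t. (g has_real_derivative g' t) (at t)) (nhds 0)"
    and g': "(g' has_real_derivative L) (at 0)"
  shows "((\<lambda>t. (g t + g (- t) - 2 * g 0) / t\<^sup>2) \<longlongrightarrow> L) (at_right 0)"
proof -
  obtain e where e: "e > 0" "\<And>t. \<bar>t\<bar> < e \<Longrightarrow> (g has_real_derivative g' t) (at t)"
    using g unfolding eventually_nhds_metric by (auto simp: dist_real_def)
  have ev: "eventually (\<lambda>t. 0 < t \<and> t < e) (at_right 0)"
    using e(1) by (auto simp: eventually_at_right_field)
  have side: "((\<lambda>t. h t) \<longlongrightarrow> l) (at_right 0) \<and> ((\<lambda>t. h (- t)) \<longlongrightarrow> l) (at_right 0)"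
    if "(h \<longlongrightarrow> l) (at 0)" for h :: "real \<Rightarrow> real" and l
    using that filterlim_at_left_to_right[of h "nhds l" 0]
    by (simp add: filterlim_at_split)
  have "isCont g 0" using e(1) e(2)[of 0] by (auto intro: DERIV_isCont)
  then have "((\<lambda>t. g t + g (- t) - 2 * g 0) \<longlongrightarrow> g 0 + g 0 - 2 * g 0) (at_right 0)"
    unfolding isCont_def using side[of g "g 0"] by (intro tendsto_intros) auto
  then have num0: "((\<lambda>t. g t + g (- t) - 2 * g 0) \<longlongrightarrow> 0) (at_right 0)" by simp
  have den0: "((\<lambda>t::real. t\<^sup>2) \<longlongrightarrow> 0) (at_right 0)"
    using side[of "\<lambda>t. t\<^sup>2" 0] by (simp add: tendsto_null_power)
  have quot: "((\<lambda>t. (g' t - g' 0) / t) \<longlongrightarrow> L) (at 0)"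
    using g' by (simp add: DERIV_def)
  have "((\<lambda>t. ((g' t - g' 0) / t + (g' (- t) - g' 0) / (- t)) / 2) \<longlongrightarrow> (L + L) / 2) (at_right 0)"
    using side[OF quot] by (intro tendsto_intros) auto
  moreover have "(\<lambda>t. ((g' t - g' 0) / t + (g' (- t) - g' 0) / (- t)) / 2) = (\<lambda>t. (g' t - g' (- t)) / (2 * t))"
  proof
    show "((g' t - g' 0) / t + (g' (- t) - g' 0) / (- t)) / 2 = (g' t - g' (- t)) / (2 * t)" for t
      by (cases "t = 0") (auto simp: field_simps)
  qed
  ultimately have lim: "((\<lambda>t. (g' t - g' (- t)) / (2 * t)) \<longlongrightarrow> L) (at_right 0)"
    by (simp only: mult_2[symmetric]) simp
  show ?thesis
  \<comment> \<open>One application of l'Hopital's rule suffices: the limit of the new quotient is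
    read off from the derivative of \<open>g'\<close> at \<open>0\<close>, so a second derivative at
    that single point is enough.\<close>
  proof (rule lhopital_right_0[OF num0 den0 _ _ _ _ lim])
    show "\<forall>\<^sub>F t in at_right 0. (t::real)\<^sup>2 \<noteq> 0" "\<forall>\<^sub>F t in at_right 0. 2 * (t::real) \<noteq> 0"
      by (rule eventually_mono[OF ev], simp)+
    show "\<forall>\<^sub>F t in at_right 0. ((\<lambda>t. g t + g (- t) - 2 * g 0) has_real_derivative g' t - g' (- t)) (at t)"
    proof (rule eventually_mono[OF ev])
      fix t assume t: "0 < t \<and> t < e"
      have "(g has_real_derivative g' t) (at t)" "(g has_real_derivative g' (- t)) (at (- t))"
        using e(2) t by auto
      then show "((\<lambda>t. g t + g (- t) - 2 * g 0) has_real_derivative g' t - g' (- t)) (at t)"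
        by (auto intro!: derivative_eq_intros DERIV_chain2[where f = g and g = uminus])
    qed
    show "\<forall>\<^sub>F t in at_right 0. ((\<lambda>t::real. t\<^sup>2) has_real_derivative 2 * t) (at t)"
      by (intro always_eventually) (auto intro!: derivative_eq_intros)
  qed
qed

lemma second_derivative_nonpos_at_max:
  fixes g g' :: "real \<Rightarrow> real"
  assumes g: "eventually (\<lambda>t. (g has_real_derivative g' t) (at t)) (nhds 0)"
    and g': "(g' has_real_derivative L) (at 0)"
    and max: "eventually (\<lambda>t. g t \<le> g 0) (nhds 0)"
  shows "L \<le> 0"
proof (rule tendsto_upperbound[OF second_difference_tendsto[OF g g']])
  obtain e where e: "e > 0" "\<And>t. \<bar>t\<bar> < e \<Longrightarrow> g t \<le> g 0"
    using max unfolding eventually_nhds_metric by (auto simp: dist_real_def)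
  have "eventually (\<lambda>t. 0 < t \<and> t < e) (at_right 0)"
    using e(1) by (auto simp: eventually_at_right_field)
  then show "\<forall>\<^sub>F t in at_right 0. (g t + g (- t) - 2 * g 0) / t\<^sup>2 \<le> 0"
  proof (rule eventually_mono)
    fix t assume "0 < t \<and> t < e"
    then have "g t \<le> g 0" "g (- t) \<le> g 0" using e(2) by auto
    then show "(g t + g (- t) - 2 * g 0) / t\<^sup>2 \<le> 0" by (auto intro!: divide_nonpos_nonneg)
  qed
qed simp

text \<open>The common ground of \<open>C2_on\<close> and \<open>smooth_on\<close>, so that
  \<open>u\<close>, \<open>q\<close>, \<open>f\<close> and the defining function of the domain share
  one set of lemmas. Symmetry of the Hessian is not part of this notion.\<close>

definition twice_differentiable_on :: "'a::real_normed_vector set \<Rightarrow> ('a \<Rightarrow> real) \<Rightarrow> bool" where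
  "twice_differentiable_on S g \<longleftrightarrow>
     (\<forall>x\<in>S. g differentiable (at x) \<and> (\<forall>v. dd g [v] differentiable (at x)))"

lemma C2_on_imp_twice_differentiable_on: "C2_on S g \<Longrightarrow> twice_differentiable_on S g"
  unfolding C2_on_def twice_differentiable_on_def by auto

lemma smooth_on_imp_twice_differentiable_on: "smooth_on S g \<Longrightarrow> twice_differentiable_on S g"
  unfolding smooth_on_def twice_differentiable_on_def by (metis dd.simps(1))

lemma has_derivative_along_line:
  fixes h :: "'a::real_normed_vector \<Rightarrow> real"
  assumes "h differentiable (at (z + t *\<^sub>R v))"
  shows "((\<lambda>t. h (z + t *\<^sub>R v)) has_real_derivative dd h [v] (z + t *\<^sub>R v)) (at t)"
proof -
  have h: "(h has_derivative frechet_derivative h (at (z + t *\<^sub>R v))) (at (z + t *\<^sub>R v))"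
    using assms by (simp add: frechet_derivative_works)
  have line: "((\<lambda>t. z + t *\<^sub>R v) has_derivative (\<lambda>s. s *\<^sub>R v)) (at t)"
    by (auto intro!: derivative_eq_intros)
  have "((\<lambda>t. h (z + t *\<^sub>R v)) has_derivative (\<lambda>s. frechet_derivative h (at (z + t *\<^sub>R v)) (s *\<^sub>R v))) (at t)"
    using has_derivative_compose[OF line h] .
  moreover have "frechet_derivative h (at (z + t *\<^sub>R v)) (s *\<^sub>R v) = frechet_derivative h (at (z + t *\<^sub>R v)) v * s" for s
    using linear_frechet_derivative[OF assms] by (simp add: linear_cmul)
  ultimately show ?thesis
    by (simp add: has_field_derivative_def)
qed

lemma eventually_line_in_open:
  fixes z v :: "'a::real_normed_vector"
  assumes "open S" "z \<in> S"
  shows "eventually (\<lambda>t. z + t *\<^sub>R v \<in> S) (nhds 0)"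
proof -
  have "((\<lambda>t. z + t *\<^sub>R v) \<longlongrightarrow> z + 0 *\<^sub>R v) (nhds 0)"
    by (intro tendsto_intros filterlim_ident)
  then show ?thesis
    using assms by (auto simp: tendsto_def)
qed

lemma eventually_at_right_if_nhds: "eventually P (nhds x) \<Longrightarrow> eventually P (at_right (x::real))"
  by (simp add: eventually_at_filter eventually_mono)

lemma twice_differentiable_along_line:
  assumes "open S" "twice_differentiable_on S g" "z \<in> S"
  shows "eventually (\<lambda>t. ((\<lambda>t. g (z + t *\<^sub>R v)) has_real_derivative dd g [v] (z + t *\<^sub>R v)) (at t)) (nhds 0)"
    and "((\<lambda>t. dd g [v] (z + t *\<^sub>R v)) has_real_derivative hess g z v v) (at 0)"
proof -
  show "eventually (\<lambda>t. ((\<lambda>t. g (z + t *\<^sub>R v)) has_real_derivative dd g [v] (z + t *\<^sub>R v)) (at t)) (nhds 0)"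
    by (rule eventually_mono[OF eventually_line_in_open[OF assms(1,3)]])
       (use assms(2) in \<open>auto simp: twice_differentiable_on_def intro!: has_derivative_along_line simp del: dd.simps\<close>)
  show "((\<lambda>t. dd g [v] (z + t *\<^sub>R v)) has_real_derivative hess g z v v) (at 0)"
    using has_derivative_along_line[of "dd g [v]" z 0 v] assms(2,3)
    by (auto simp: twice_differentiable_on_def hess_def)
qed

lemma second_difference_hess:
  assumes "open S" "twice_differentiable_on S g" "z \<in> S"
  shows "((\<lambda>t. (g (z + t *\<^sub>R v) + g (z - t *\<^sub>R v) - 2 * g z) / t\<^sup>2) \<longlongrightarrow> hess g z v v) (at_right 0)"
  using second_difference_tendsto[OF twice_differentiable_along_line[OF assms, of v]] by simp

text \<open>A second-difference substitute for the Laplacian, not yet divided by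
  \<open>t\<^sup>2\<close>. It makes sense for functions without derivatives and is additive, so
  lower bounds of the form \<open>k * t\<^sup>2\<close> can be added.\<close>

definition disc_lap :: "('a::euclidean_space \<Rightarrow> real) \<Rightarrow> 'a \<Rightarrow> real \<Rightarrow> real" where
  "disc_lap W z t = (\<Sum>b\<in>Basis. W (z + t *\<^sub>R b) + W (z - t *\<^sub>R b) - 2 * W z)"

lemma disc_lap_tendsto:
  assumes "\<And>b. b \<in> Basis \<Longrightarrow>
    ((\<lambda>t. (g (z + t *\<^sub>R b) + g (z - t *\<^sub>R b) - 2 * g z) / t\<^sup>2) \<longlongrightarrow> L b) (at_right 0)"
  shows "((\<lambda>t. disc_lap g z t / t\<^sup>2) \<longlongrightarrow> (\<Sum>b\<in>Basis. L b)) (at_right 0)"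
  unfolding disc_lap_def sum_divide_distrib using assms by (intro tendsto_sum)

lemma disc_lap_laplacian:
  assumes "open S" "twice_differentiable_on S g" "z \<in> S"
  shows "((\<lambda>t. disc_lap g z t / t\<^sup>2) \<longlongrightarrow> laplacian g z) (at_right 0)"
  unfolding laplacian_def by (intro disc_lap_tendsto second_difference_hess[OF assms])

lemma eventually_ge_if_quotient_tendsto:
  fixes L e :: real
  assumes "((\<lambda>t. d t / t\<^sup>2) \<longlongrightarrow> L) (at_right 0)" "e > 0"
  shows "\<forall>\<^sub>F t in at_right 0. d t \<ge> (L - e) * t\<^sup>2" "\<forall>\<^sub>F t in at_right 0. d t \<le> (L + e) * t\<^sup>2"
proof -
  have pos: "\<forall>\<^sub>F t in at_right 0. (t::real) > 0" by (simp add: eventually_at_right_less)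
  have "\<forall>\<^sub>F t in at_right 0. L - e < d t / t\<^sup>2"
    using order_tendstoD(1)[OF assms(1)] assms(2) by simp
  then show "\<forall>\<^sub>F t in at_right 0. d t \<ge> (L - e) * t\<^sup>2"
    by (rule eventually_elim2[OF _ pos]) (simp add: pos_less_divide_eq less_imp_le)
  have "\<forall>\<^sub>F t in at_right 0. d t / t\<^sup>2 < L + e"
    using order_tendstoD(2)[OF assms(1)] assms(2) by simp
  then show "\<forall>\<^sub>F t in at_right 0. d t \<le> (L + e) * t\<^sup>2"
    by (rule eventually_elim2[OF _ pos]) (simp add: pos_divide_less_eq less_imp_le)
qed

text \<open>\<open>smooth_upto\<close> speaks of an extension \<open>G\<close> that agrees with the
  given function on a set. On an open part of that set all iterated derivatives agree too, which
  transfers smoothness from \<open>G\<close> to \<open>q\<close> on the domain and to \<psi> on the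
  open interval.\<close>

lemma dd_cong_open:
  assumes "open S" "smooth_on S G" "\<And>x. x \<in> S \<Longrightarrow> G x = g x" "x \<in> S"
  shows "dd g vs x = dd G vs x"
  using assms(4)
proof (induction vs arbitrary: x)
  case Nil
  then show ?case using assms(3) by simp
next
  case (Cons v vs)
  have "dd G vs differentiable (at x)" using assms(2) Cons.prems by (auto simp: smooth_on_def)
  from frechet_derivative_transform_within_open[OF this assms(1) Cons.prems, of "dd g vs"] Cons.IH
  show ?case by simp
qed

lemma smooth_on_cong_open:
  assumes "open S" "smooth_on S G" "\<And>x. x \<in> S \<Longrightarrow> G x = g x"
  shows "smooth_on S g"
  unfolding smooth_on_def
proof (intro allI ballI)
  fix vs x assume x: "x \<in> S"
  have "dd G vs differentiable (at x)" using assms(2) x by (auto simp: smooth_on_def)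
  moreover have "\<And>y. y \<in> S \<Longrightarrow> dd G vs y = dd g vs y" using dd_cong_open[OF assms] by simp
  ultimately show "dd g vs differentiable (at x)"
    using assms(1) x unfolding differentiable_def by (meson has_derivative_transform_within_open)
qed

lemma smooth_on_subset: "smooth_on T g \<Longrightarrow> S \<subseteq> T \<Longrightarrow> smooth_on S g"
  by (auto simp: smooth_on_def)

text \<open>The fundamental theorem of calculus along the segment. Since \<open>integral\<close> is
  the gauge integral, it applies to every derivative, continuous or not.\<close>

lemma E_eq_diff_directional:
  fixes g :: "'a::euclidean_space \<Rightarrow> real"
  assumes "twice_differentiable_on S g" "convex S" "x \<in> S" "y \<in> S" "x \<noteq> y"
  shows "E g x y = dd g [N x y] y - dd g [N x y] x"
proof -
  let ?n = "N x y"
  have rpos: "r x y > 0" using assms(5) by (simp add: r_def)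
  have ry: "x + r x y *\<^sub>R ?n = y"
    using assms(5) by (simp add: r_def N_def norm_minus_commute)
  have inS: "x + s *\<^sub>R ?n \<in> S" if "s \<in> {0..r x y}" for s
  proof -
    have "x + s *\<^sub>R ?n = (1 - s / r x y) *\<^sub>R x + (s / r x y) *\<^sub>R (x + r x y *\<^sub>R ?n)"
      using rpos by (simp add: algebra_simps)
    also have "\<dots> \<in> S"
      unfolding ry using assms(2-4) that rpos by (intro convexD_alt) auto
    finally show ?thesis .
  qed
  have "((\<lambda>s. hess g (\<theta> s x y) ?n ?n) has_integral
      dd g [?n] (x + r x y *\<^sub>R ?n) - dd g [?n] (x + 0 *\<^sub>R ?n)) {0..r x y}"
  proof (rule fundamental_theorem_of_calculus)
    fix s assume "s \<in> {0..r x y}"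
    then have "dd g [?n] differentiable (at (x + s *\<^sub>R ?n))"
      using inS assms(1) by (auto simp: twice_differentiable_on_def)
    from has_derivative_along_line[OF this]
    have "((\<lambda>s. dd g [?n] (x + s *\<^sub>R ?n)) has_real_derivative hess g (\<theta> s x y) ?n ?n) (at s)"
      by (simp add: hess_def \<theta>_def)
    then show "((\<lambda>s. dd g [?n] (x + s *\<^sub>R ?n)) has_vector_derivative hess g (\<theta> s x y) ?n ?n)
        (at s within {0..r x y})"
      by (simp add: has_field_derivative_at_within has_real_derivative_iff_has_vector_derivative[symmetric])
  qed (use rpos in simp)
  then show ?thesis
    using assms(5) ry by (simp add: E_def integral_unique)
qed

section \<open>Strong maximum principle\<close>

lemma disc_lap_add_scaled: "disc_lap (\<lambda>z. f z + c * g z) z t = disc_lap f z t + c * disc_lap g z t"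
  unfolding disc_lap_def sum_distrib_left sum.distrib[symmetric]
  by (intro sum.cong) (auto simp: algebra_simps)

lemma eventually_disc_lap_nonpos:
  assumes "open S" "z \<in> S" "\<And>y. y \<in> S \<Longrightarrow> V y \<le> V z"
  shows "\<forall>\<^sub>F t in at_right 0. disc_lap V z t \<le> 0"
proof -
  have "\<forall>\<^sub>F t in at_right 0. \<forall>b\<in>Basis. V (z + t *\<^sub>R b) + V (z - t *\<^sub>R b) - 2 * V z \<le> 0"
  proof (intro eventually_ball_finite ballI finite_Basis)
    fix b :: 'a assume "b \<in> Basis"
    have "\<forall>\<^sub>F t in at_right 0. z + t *\<^sub>R b \<in> S" "\<forall>\<^sub>F t in at_right 0. z + t *\<^sub>R (- b) \<in> S"
      by (intro eventually_at_right_if_nhds eventually_line_in_open assms(1,2))+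
    then show "\<forall>\<^sub>F t in at_right 0. V (z + t *\<^sub>R b) + V (z - t *\<^sub>R b) - 2 * V z \<le> 0"
    proof (rule eventually_elim2)
      fix t assume "z + t *\<^sub>R b \<in> S" "z + t *\<^sub>R - b \<in> S"
      from this[THEN assms(3)] show "V (z + t *\<^sub>R b) + V (z - t *\<^sub>R b) - 2 * V z \<le> 0" by simp
    qed
  qed
  then show ?thesis
    by (rule eventually_mono) (auto simp: disc_lap_def intro: sum_nonpos)
qed

text \<open>The barrier of Hopf's lemma. Away from \<open>a\<close> the quadratic term in \<alpha>
  dominates for large \<alpha>, which makes the limit exceed any prescribed multiple of the Gaussian
  itself. The constant \<open>c\<close> serves to let the barrier vanish on a sphere.\<close>

lemma disc_lap_gaussian:
  fixes a z :: "'a::euclidean_space"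
  shows "((\<lambda>t. disc_lap (\<lambda>z. exp (- \<alpha> * (norm (z - a))\<^sup>2) - c) z t / t\<^sup>2) \<longlongrightarrow>
      exp (- \<alpha> * (norm (z - a))\<^sup>2) * (4 * \<alpha>\<^sup>2 * (norm (z - a))\<^sup>2 - 2 * \<alpha> * DIM('a))) (at_right 0)"
proof -
  let ?h = "\<lambda>z. exp (- \<alpha> * (norm (z - a))\<^sup>2) - c"
  let ?e = "exp (- \<alpha> * (norm (z - a))\<^sup>2)"
  have "((\<lambda>t. disc_lap ?h z t / t\<^sup>2) \<longlongrightarrow>
      (\<Sum>b\<in>Basis. ?e * (4 * \<alpha>\<^sup>2 * ((z - a) \<bullet> b)\<^sup>2 - 2 * \<alpha>))) (at_right 0)"
  proof (rule disc_lap_tendsto)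
    fix b :: 'a assume b: "b \<in> Basis"
    let ?q = "\<lambda>t. - \<alpha> * ((norm (z - a))\<^sup>2 + 2 * t * ((z - a) \<bullet> b) + t\<^sup>2)"
    have sq: "(norm (z + t *\<^sub>R b - a))\<^sup>2 = (norm (z - a))\<^sup>2 + 2 * t * ((z - a) \<bullet> b) + t\<^sup>2" for t
    proof -
      have "z + t *\<^sub>R b - a = (z - a) + t *\<^sub>R b" by simp
      then have "(norm (z + t *\<^sub>R b - a))\<^sup>2 = ((z - a) + t *\<^sub>R b) \<bullet> ((z - a) + t *\<^sub>R b)"
        by (simp only: power2_norm_eq_inner)
      also have "\<dots> = (z - a) \<bullet> (z - a) + 2 * t * ((z - a) \<bullet> b) + t\<^sup>2"
        unfolding inner_add_left inner_add_right using b
        by (simp add: inner_commute[of b "z - a"] power2_eq_square)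
      finally show ?thesis by (simp only: power2_norm_eq_inner)
    qed
    have 1: "((\<lambda>t. exp (?q t) - c) has_real_derivative exp (?q t) * (- \<alpha> * (2 * ((z - a) \<bullet> b) + 2 * t))) (at t)" for t
      by (auto intro!: derivative_eq_intros)
    have 2: "((\<lambda>t. exp (?q t) * (- \<alpha> * (2 * ((z - a) \<bullet> b) + 2 * t))) has_real_derivative
        ?e * (4 * \<alpha>\<^sup>2 * ((z - a) \<bullet> b)\<^sup>2 - 2 * \<alpha>)) (at 0)"
    proof -
      have "((\<lambda>t. exp (?q t)) has_real_derivative exp (?q 0) * (- \<alpha> * (2 * ((z - a) \<bullet> b) + 2 * 0))) (at 0)"
        by (auto intro!: derivative_eq_intros)
      moreover have "((\<lambda>t. - \<alpha> * (2 * ((z - a) \<bullet> b) + 2 * t)) has_real_derivative - (2 * \<alpha>)) (at 0)"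
        by (auto intro!: derivative_eq_intros)
      ultimately show ?thesis
        by (rule DERIV_mult[THEN DERIV_cong]) (simp add: algebra_simps power2_eq_square)
    qed
    have "((\<lambda>t. ((exp (?q t) - c) + (exp (?q (- t)) - c) - 2 * (exp (?q 0) - c)) / t\<^sup>2) \<longlongrightarrow>
        ?e * (4 * \<alpha>\<^sup>2 * ((z - a) \<bullet> b)\<^sup>2 - 2 * \<alpha>)) (at_right 0)"
      by (rule second_difference_tendsto[OF _ 2]) (use 1 in simp)
    then show "((\<lambda>t. (?h (z + t *\<^sub>R b) + ?h (z - t *\<^sub>R b) - 2 * ?h z) / t\<^sup>2) \<longlongrightarrow>
        ?e * (4 * \<alpha>\<^sup>2 * ((z - a) \<bullet> b)\<^sup>2 - 2 * \<alpha>)) (at_right 0)"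
      using sq[of "- t" for t] by (simp add: sq)
  qed
  moreover have "(\<Sum>b\<in>Basis. ?e * (4 * \<alpha>\<^sup>2 * ((z - a) \<bullet> b)\<^sup>2 - 2 * \<alpha>)) =
      ?e * (4 * \<alpha>\<^sup>2 * (norm (z - a))\<^sup>2 - 2 * \<alpha> * DIM('a))"
  proof -
    have "(norm (z - a))\<^sup>2 = (\<Sum>b\<in>Basis. ((z - a) \<bullet> b)\<^sup>2)"
      unfolding power2_norm_eq_inner by (subst euclidean_inner) (simp add: power2_eq_square)
    then show ?thesis
      by (simp only: sum_distrib_left[symmetric] sum_subtractf sum_constant) simp
  qed
  ultimately show ?thesis by simp
qed

text \<open>The differential inequality \<open>\<Delta> W \<ge> - C \<bar>W\<bar>\<close> enters only through lower bounds on second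
  differences, so it makes sense for suprema of \<open>C\<^sup>2\<close> functions.\<close>

definition subsolution_on :: "real \<Rightarrow> 'a::euclidean_space set \<Rightarrow> ('a \<Rightarrow> real) \<Rightarrow> bool" where
  "subsolution_on C S W \<longleftrightarrow>
     (\<forall>z\<in>S. \<forall>e>0. \<forall>\<^sub>F t in at_right 0. disc_lap W z t \<ge> (- C * \<bar>W z\<bar> - e) * t\<^sup>2)"

text \<open>At a local maximum of \<open>W + \<kappa> * h\<close> the discrete Laplacian is
  nonpositive, while the lower bounds for both summands add up to a positive multiple of
  \<open>t\<^sup>2\<close>: each of the two errors takes a quarter of the gap \<open>g\<close>. The
  sign of \<kappa> is free, so \<open>h\<close> may be a barrier added to \<open>W\<close> or a
  supersolution subtracted from it.\<close>

lemma subsolution_strict_comparison: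
  assumes "subsolution_on C S W" "z \<in> S"
    and h: "((\<lambda>t. disc_lap h z t / t\<^sup>2) \<longlongrightarrow> L) (at_right 0)"
    and L: "\<kappa> * L > C * \<bar>W z\<bar>"
    and T: "open T" "z \<in> T" "\<And>y. y \<in> T \<Longrightarrow> W y + \<kappa> * h y \<le> W z + \<kappa> * h z"
  shows False
proof -
  define g where "g = \<kappa> * L - C * \<bar>W z\<bar>"
  have g: "g > 0" using L by (simp add: g_def)
  have W: "\<forall>\<^sub>F t in at_right 0. disc_lap W z t \<ge> (- C * \<bar>W z\<bar> - g / 4) * t\<^sup>2"
    using assms(1,2) g unfolding subsolution_on_def by (meson divide_pos_pos zero_less_numeral)
  have "((\<lambda>t. (\<kappa> * disc_lap h z t) / t\<^sup>2) \<longlongrightarrow> \<kappa> * L) (at_right 0)"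
    using tendsto_mult_left[OF h, of \<kappa>] by simp
  from eventually_ge_if_quotient_tendsto(1)[OF this, of "g / 4"] g
  have h': "\<forall>\<^sub>F t in at_right 0. \<kappa> * disc_lap h z t \<ge> (\<kappa> * L - g / 4) * t\<^sup>2" by simp
  have "\<forall>\<^sub>F t in at_right 0. disc_lap (\<lambda>z. W z + \<kappa> * h z) z t \<le> 0"
    by (rule eventually_disc_lap_nonpos[OF T(1,2)]) (rule T(3))
  moreover have "\<forall>\<^sub>F t in at_right 0. (t::real) > 0" by (simp add: eventually_at_right_less)
  ultimately have "\<forall>\<^sub>F t in at_right (0::real). False"
    using W h'
  proof eventually_elim
    case (elim t)
    have "(- C * \<bar>W z\<bar> - g / 4) * t\<^sup>2 + (\<kappa> * L - g / 4) * t\<^sup>2 \<le> 0"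
      using elim by (simp add: disc_lap_add_scaled)
    moreover have "(- C * \<bar>W z\<bar> - g / 4) * t\<^sup>2 + (\<kappa> * L - g / 4) * t\<^sup>2 = (g / 2) * t\<^sup>2"
      by (simp add: g_def algebra_simps)
    moreover have "(g / 2) * t\<^sup>2 > 0" using g elim by simp
    ultimately show False by linarith
  qed
  then show False by (simp add: trivial_limit_at_right_real)
qed

text \<open>Hopf's lemma normally contradicts the vanishing gradient at an interior maximum. Here
  \<open>W\<close> may lack a gradient, and \<open>semi\<close> replaces it: with
  \<open>W z0 = 0\<close> and \<open>W \<le> 0\<close> on the outer side it bounds \<open>W\<close>
  from below by \<open>- K * t\<^sup>2\<close> on the inner side, whereas the Gaussian barrier
  forces \<open>W\<close> below a negative multiple of \<open>t\<close> there.\<close>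

lemma hopf_touching:
  fixes W :: "'a::euclidean_space \<Rightarrow> real"
  assumes "open \<Omega>" "cball a R \<subseteq> \<Omega>" "R > 0" "C \<ge> 0"
    and cont: "continuous_on \<Omega> W"
    and nonpos: "\<And>z. z \<in> \<Omega> \<Longrightarrow> W z \<le> 0"
    and neg: "\<And>z. z \<in> ball a R \<Longrightarrow> W z < 0"
    and sub: "subsolution_on C \<Omega> W"
    and semi: "\<And>n. \<exists>K. \<forall>\<^sub>F t in at_right 0. W (z0 + t *\<^sub>R n) + W (z0 - t *\<^sub>R n) - 2 * W z0 \<ge> - K * t\<^sup>2"
    and z0: "dist a z0 = R" "W z0 = 0"
  shows False
proof -
  define d where "d = real DIM('a)"
  \<comment> \<open>Outside the ball of radius \<open>R / 2\<close> one has
    \<open>4 * (norm (z - a))\<^sup>2 \<ge> R\<^sup>2\<close>; this \<alpha> then makes the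
    Laplacian of the Gaussian larger than \<open>C\<close> times the Gaussian.\<close>
  define \<alpha> where "\<alpha> = max 1 ((2 * d + C + 1) / R\<^sup>2)"
  have \<alpha>1: "\<alpha> \<ge> 1" and \<alpha>2: "\<alpha> * R\<^sup>2 \<ge> 2 * d + C + 1"
  proof -
    show "\<alpha> \<ge> 1" by (simp add: \<alpha>_def)
    have "\<alpha> \<ge> (2 * d + C + 1) / R\<^sup>2" by (simp add: \<alpha>_def)
    then show "\<alpha> * R\<^sup>2 \<ge> 2 * d + C + 1" using assms(3) by (simp add: pos_divide_le_eq)
  qed
  define h where "h z = exp (- \<alpha> * (norm (z - a))\<^sup>2) - exp (- \<alpha> * R\<^sup>2)" for z
  have h_le: "h z \<le> 1" for z
  proof -
    have "exp (- \<alpha> * (norm (z - a))\<^sup>2) \<le> 1" using \<alpha>1 by simp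
    moreover have "exp (- \<alpha> * R\<^sup>2) > 0" by simp
    ultimately show ?thesis unfolding h_def by linarith
  qed
  have inner_sub: "cball a (R / 2) \<subseteq> \<Omega>" using assms(2,3) by force
  obtain zi where zi: "zi \<in> cball a (R / 2)" "\<And>y. y \<in> cball a (R / 2) \<Longrightarrow> W y \<le> W zi"
    using continuous_attains_sup[of "cball a (R / 2)" W] continuous_on_subset[OF cont inner_sub] assms(3)
    by (auto simp del: mem_cball)
  \<comment> \<open>Since \<open>h \<le> 1\<close>, this \<epsilon> settles the barrier inequality
    on the inner ball. On the outer sphere \<open>h\<close> vanishes, so a positive maximum of
    \<open>W + \<epsilon> * h\<close> could lie only in the open annulus, where the comparison lemma
    applies.\<close>
  define \<epsilon> where "\<epsilon> = - W zi"
  have \<epsilon>: "\<epsilon> > 0" using neg[of zi] zi(1) assms(3) by (simp add: \<epsilon>_def)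
  have inner: "W z + \<epsilon> * h z \<le> 0" if "z \<in> cball a (R / 2)" for z
  proof -
    have "\<epsilon> * h z \<le> \<epsilon> * 1" using h_le \<epsilon> by (intro mult_left_mono) auto
    then show ?thesis using zi(2)[OF that] by (simp add: \<epsilon>_def)
  qed
  have hcont: "continuous_on A h" for A unfolding h_def by (intro continuous_intros)
  have barrier: "W z + \<epsilon> * h z \<le> 0" if "z \<in> cball a R" for z
  proof (rule ccontr)
    assume neg_z: "\<not> ?thesis"
    have "continuous_on (cball a R) (\<lambda>z. W z + \<epsilon> * h z)"
      by (intro continuous_intros continuous_on_subset[OF cont assms(2)] hcont)
    then obtain z1 where z1: "z1 \<in> cball a R" "\<And>y. y \<in> cball a R \<Longrightarrow> W y + \<epsilon> * h y \<le> W z1 + \<epsilon> * h z1"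
      using continuous_attains_sup[of "cball a R" "\<lambda>z. W z + \<epsilon> * h z"] assms(3) by (auto simp del: mem_cball)
    have pos: "W z1 + \<epsilon> * h z1 > 0" using z1(2)[OF that] neg_z by linarith
    have out: "z1 \<notin> cball a (R / 2)" using inner pos by force
    have W1: "W z1 \<le> 0" using nonpos z1(1) assms(2) by blast
    have "dist a z1 \<noteq> R"
      using pos W1 by (auto simp: h_def dist_norm norm_minus_commute)
    then have ball: "z1 \<in> ball a R" using z1(1) by auto
    let ?e = "exp (- \<alpha> * (norm (z1 - a))\<^sup>2)"
    let ?L = "?e * (4 * \<alpha>\<^sup>2 * (norm (z1 - a))\<^sup>2 - 2 * \<alpha> * DIM('a))"
    have lim: "((\<lambda>t. disc_lap h z1 t / t\<^sup>2) \<longlongrightarrow> ?L) (at_right 0)"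
      unfolding h_def by (rule disc_lap_gaussian)
    have "R / 2 < norm (z1 - a)" using out by (simp add: dist_norm norm_minus_commute)
    then have "(R / 2)\<^sup>2 \<le> (norm (z1 - a))\<^sup>2" using assms(3) by (intro power_mono) auto
    then have "\<alpha> * R\<^sup>2 \<le> \<alpha> * (4 * (norm (z1 - a))\<^sup>2)"
      using \<alpha>1 by (intro mult_left_mono) (auto simp: power2_eq_square)
    then have "C + 1 \<le> \<alpha> * (4 * (norm (z1 - a))\<^sup>2) - 2 * d" using \<alpha>2 by linarith
    then have "1 * (C + 1) \<le> \<alpha> * (\<alpha> * (4 * (norm (z1 - a))\<^sup>2) - 2 * d)"
      using \<alpha>1 assms(4) by (intro mult_mono) auto
    then have "C < 4 * \<alpha>\<^sup>2 * (norm (z1 - a))\<^sup>2 - 2 * \<alpha> * DIM('a)"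
      by (simp add: d_def algebra_simps power2_eq_square)
    then have "C * ?e < ?L" by simp
    moreover have "C * h z1 \<le> C * ?e" using assms(4) by (intro mult_left_mono) (auto simp: h_def)
    ultimately have "C * h z1 < ?L" by (rule order.strict_trans1[rotated])
    then have "\<epsilon> * (C * h z1) < \<epsilon> * ?L" using \<epsilon> by (rule mult_strict_left_mono)
    moreover have "C * \<bar>W z1\<bar> \<le> C * (\<epsilon> * h z1)"
      using assms(4) W1 pos by (intro mult_left_mono) auto
    ultimately have "\<epsilon> * ?L > C * \<bar>W z1\<bar>" unfolding mult.left_commute[of C \<epsilon>] by (rule order.strict_trans1[rotated])
    from subsolution_strict_comparison[OF sub _ lim this open_ball ball] z1 assms(2)
    show False by (metis ball_subset_cball subsetD)
  qed
  \<comment> \<open>Left with length \<open>R\<close>, so that \<open>z0 + t *\<^sub>R n\<close> has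
    distance \<open>(1 - t) * R\<close> from the centre. The constant \<open>c\<close> below is
    \<epsilon> times a lower bound for the slope of \<open>h\<close> along this ray.\<close>
  define n where "n = a - z0"
  have nR: "norm n = R" using z0(1) by (simp add: n_def dist_norm)
  obtain K where K: "\<forall>\<^sub>F t in at_right 0. W (z0 + t *\<^sub>R n) + W (z0 - t *\<^sub>R n) - 2 * W z0 \<ge> - K * t\<^sup>2"
    using semi by blast
  define c where "c = \<epsilon> * (exp (- \<alpha> * R\<^sup>2) * (\<alpha> * R\<^sup>2))"
  have c: "c > 0" using \<epsilon> \<alpha>1 assms(3) by (simp add: c_def)
  have "z0 \<in> \<Omega>" using z0(1) assms(2) by auto
  then have "\<forall>\<^sub>F t in at_right 0. z0 + t *\<^sub>R (- n) \<in> \<Omega>"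
    by (intro eventually_at_right_if_nhds eventually_line_in_open assms(1))
  moreover have "\<forall>\<^sub>F t in at_right 0. 0 < t \<and> t < 1 \<and> t < c / (\<bar>K\<bar> + 1)"
  proof -
    have "\<forall>\<^sub>F t in at_right 0. t \<in> {0<..<min 1 (c / (\<bar>K\<bar> + 1))}"
      using c by (intro eventually_at_right_real) auto
    then show ?thesis by eventually_elim auto
  qed
  ultimately have "\<forall>\<^sub>F t in at_right (0::real). False"
    using K
  proof eventually_elim
    case (elim t)
    have "W (z0 - t *\<^sub>R n) \<le> 0" using elim nonpos by simp
    then have 1: "W (z0 + t *\<^sub>R n) \<ge> - K * t\<^sup>2" using elim z0(2) by simp
    have "z0 + t *\<^sub>R n - a = (t - 1) *\<^sub>R n" by (simp add: n_def algebra_simps)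
    then have nrm: "norm (z0 + t *\<^sub>R n - a) = (1 - t) * R" using elim nR by simp
    have "(1 - t) * R \<le> 1 * R" using elim assms(3) by (intro mult_right_mono) auto
    then have "z0 + t *\<^sub>R n \<in> cball a R" using nrm by (simp add: dist_norm norm_minus_commute)
    from barrier[OF this] have 2: "W (z0 + t *\<^sub>R n) \<le> - \<epsilon> * h (z0 + t *\<^sub>R n)" by simp
    have "h (z0 + t *\<^sub>R n) = exp (- \<alpha> * R\<^sup>2) * (exp (\<alpha> * R\<^sup>2 * (2 * t - t\<^sup>2)) - 1)"
      unfolding h_def nrm by (simp add: right_diff_distrib exp_add[symmetric] algebra_simps power2_eq_square)
    moreover have "exp (\<alpha> * R\<^sup>2 * (2 * t - t\<^sup>2)) - 1 \<ge> \<alpha> * R\<^sup>2 * t"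
    proof -
      have "t\<^sup>2 \<le> t * 1" unfolding power2_eq_square using elim by (intro mult_left_mono) auto
      then have "\<alpha> * R\<^sup>2 * t \<le> \<alpha> * R\<^sup>2 * (2 * t - t\<^sup>2)"
        using \<alpha>1 by (intro mult_left_mono) auto
      then show ?thesis using exp_ge_add_one_self[of "\<alpha> * R\<^sup>2 * (2 * t - t\<^sup>2)"] by linarith
    qed
    ultimately have "h (z0 + t *\<^sub>R n) \<ge> exp (- \<alpha> * R\<^sup>2) * (\<alpha> * R\<^sup>2 * t)"
      by (simp add: mult_left_mono)
    then have "\<epsilon> * h (z0 + t *\<^sub>R n) \<ge> \<epsilon> * (exp (- \<alpha> * R\<^sup>2) * (\<alpha> * R\<^sup>2 * t))"
      using \<epsilon> by (intro mult_left_mono) auto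
    also have "\<epsilon> * (exp (- \<alpha> * R\<^sup>2) * (\<alpha> * R\<^sup>2 * t)) = c * t" by (simp add: c_def)
    finally have "c * t \<le> K * t\<^sup>2" using 1 2 by simp
    then have "c \<le> K * t" using elim by (simp add: power2_eq_square)
    also have "\<dots> \<le> (\<bar>K\<bar> + 1) * t" using elim by (intro mult_right_mono) auto
    also have "\<dots> < c"
      using elim by (simp add: pos_less_divide_eq mult.commute)
    finally show False by simp
  qed
  then show False by (simp add: trivial_limit_at_right_real)
qed

text \<open>The zero set is shown to be open: from a point \<open>w\<close> with
  \<open>W w < 0\<close> near a zero, the ball up to the nearest zero touches the zero set from
  outside, which \<open>hopf_touching\<close> forbids. As \<open>{W < 0}\<close> is open as well,
  connectedness leaves only one of the two sets.\<close>

lemma strong_maximum_principle: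
  fixes W :: "'a::euclidean_space \<Rightarrow> real"
  assumes "open \<Omega>" "connected \<Omega>" "C \<ge> 0"
    and cont: "continuous_on \<Omega> W"
    and nonpos: "\<And>z. z \<in> \<Omega> \<Longrightarrow> W z \<le> 0"
    and sub: "subsolution_on C \<Omega> W"
    and semi: "\<And>z n. z \<in> \<Omega> \<Longrightarrow>
      \<exists>K. \<forall>\<^sub>F t in at_right 0. W (z + t *\<^sub>R n) + W (z - t *\<^sub>R n) - 2 * W z \<ge> - K * t\<^sup>2"
    and z0: "z0 \<in> \<Omega>" "W z0 = 0" and z: "z \<in> \<Omega>"
  shows "W z = 0"
proof -
  define K where "K = {z \<in> \<Omega>. W z = 0}"
  have "open K"
    unfolding open_contains_ball
  proof
    fix y assume y: "y \<in> K"
    then obtain e where e: "e > 0" "cball y e \<subseteq> \<Omega>"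
      using assms(1) unfolding K_def open_contains_cball by blast
    have "w \<in> K" if w: "w \<in> ball y (e / 2)" for w
    proof (rule ccontr)
      assume "w \<notin> K"
      \<comment> \<open>Intersecting with a closed ball inside the domain makes the zero set closed,
        so a nearest zero exists. Starting from \<open>w\<close> within \<open>e / 2\<close> of
        \<open>y\<close>, the touching ball stays inside \<open>cball y e\<close>.\<close>
      define K' where "K' = {x \<in> cball y e. W x = 0}"
      have "closed K'"
        unfolding K'_def using continuous_closed_preimage_constant[OF continuous_on_subset[OF cont e(2)] closed_cball]
        by simp
      moreover have "y \<in> K'" using y e by (simp add: K_def K'_def)
      ultimately obtain x where x: "x \<in> K'" "\<And>v. v \<in> K' \<Longrightarrow> dist w x \<le> dist w v"
        using distance_attains_inf[of K' w] by blast
      define R where "R = dist w x"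
      have Rle: "R \<le> dist w y" using x(2) \<open>y \<in> K'\<close> by (simp add: R_def)
      have wy: "dist w y < e / 2" using w by (simp add: dist_commute)
      have xO: "x \<in> \<Omega>" "W x = 0" using x(1) e(2) by (auto simp: K'_def)
      have "w \<noteq> x" using \<open>w \<notin> K\<close> xO by (auto simp: K_def)
      then have Rpos: "R > 0" by (simp add: R_def)
      have sub1: "cball w R \<subseteq> cball y e"
      proof
        fix v assume "v \<in> cball w R"
        then have "dist y v \<le> dist y w + R" using dist_triangle[of y v w] by simp
        then show "v \<in> cball y e" using Rle wy by (simp add: dist_commute)
      qed
      have neg: "W v < 0" if "v \<in> ball w R" for v
      proof -
        have v: "v \<in> cball y e" using that sub1 ball_subset_cball by blast
        then have "W v \<le> 0" using nonpos e(2) by blast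
        moreover have "W v \<noteq> 0"
          using x(2)[of v] v that by (auto simp: K'_def R_def)
        ultimately show ?thesis by simp
      qed
      have dx: "dist w x = R" by (simp add: R_def)
      have semi_x: "\<exists>K. \<forall>\<^sub>F t in at_right 0. W (x + t *\<^sub>R n) + W (x - t *\<^sub>R n) - 2 * W x \<ge> - K * t\<^sup>2" for n
        by (rule semi[OF xO(1)])
      show False
        using hopf_touching[where W = W and a = w and ?z0.0 = x and \<Omega> = \<Omega> and R = R and C = C]
          assms(1,3) sub1 e(2) Rpos cont nonpos neg sub semi_x dx xO(2) by blast
    qed
    then show "\<exists>e>0. ball y e \<subseteq> K" using e(1) by (intro exI[of _ "e / 2"]) auto
  qed
  moreover have "open {z \<in> \<Omega>. W z < 0}"
  proof -
    have "{z \<in> \<Omega>. W z < 0} = \<Omega> \<inter> W -` {..<0}" by auto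
    then show ?thesis using continuous_open_preimage[OF cont assms(1), of "{..<0}"] by simp
  qed
  ultimately have "K \<inter> \<Omega> = {} \<or> {z \<in> \<Omega>. W z < 0} \<inter> \<Omega> = {}"
    by (intro connectedD[OF assms(2)]) (use nonpos in \<open>auto simp: K_def order_less_le\<close>)
  then have "\<not> W z < 0" using z0 z by (auto simp: K_def)
  then show ?thesis using nonpos[OF z] by simp
qed

section \<open>Maximum principle near the boundary\<close>

lemma compact_max_obtains:
  fixes f :: "'a::topological_space \<Rightarrow> real"
  assumes "compact S" "S \<noteq> {}" "continuous_on S f"
  obtains x where "x \<in> S" "\<And>y. y \<in> S \<Longrightarrow> f y \<le> f x"
  using continuous_attains_sup[OF assms] by blast

lemma frechet_derivative_zero_if_zero_on_Basis:
  fixes g :: "'a::euclidean_space \<Rightarrow> real"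
  assumes "g differentiable (at x)" "\<And>b. b \<in> Basis \<Longrightarrow> dd g [b] x = 0"
  shows "frechet_derivative g (at x) = (\<lambda>_. 0)"
proof
  fix v
  interpret linear "frechet_derivative g (at x)" by (rule linear_frechet_derivative[OF assms(1)])
  have "frechet_derivative g (at x) v = frechet_derivative g (at x) (\<Sum>b\<in>Basis. (v \<bullet> b) *\<^sub>R b)"
    by (simp add: euclidean_representation)
  also have "\<dots> = 0" using assms(2) by (simp add: sum scale)
  finally show "frechet_derivative g (at x) v = 0" .
qed

lemma smooth_bounded_domainE:
  assumes "smooth_bounded_domain \<Omega>"
  obtains \<rho> where "smooth_on UNIV \<rho>" "\<Omega> = {x. \<rho> x < 0}"
    "\<And>x. \<rho> x = 0 \<Longrightarrow> frechet_derivative \<rho> (at x) \<noteq> (\<lambda>_. 0)"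
    "bounded \<Omega>" "connected \<Omega>" "\<Omega> \<noteq> {}" "open \<Omega>" "continuous_on UNIV \<rho>"
proof -
  obtain \<rho> where \<rho>: "smooth_on UNIV \<rho>" "\<Omega> = {x. \<rho> x < 0}"
    "\<And>x. \<rho> x = 0 \<Longrightarrow> frechet_derivative \<rho> (at x) \<noteq> (\<lambda>_. 0)"
    and *: "bounded \<Omega>" "connected \<Omega>" "\<Omega> \<noteq> {}"
    using assms unfolding smooth_bounded_domain_def by blast
  have "\<rho> differentiable (at x)" for x using \<rho>(1) unfolding smooth_on_def by (metis UNIV_I dd.simps(1))
  then have cont: "continuous_on UNIV \<rho>"
    by (simp add: continuous_at_imp_continuous_on differentiable_imp_continuous_within)
  then have "open \<Omega>" unfolding \<rho>(2) by (intro open_Collect_less continuous_intros)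
  then show thesis using that \<rho> * cont by blast
qed

text \<open>The function is \<open>2 - exp (K * \<rho>)\<close>, whose Laplacian is
  \<open>- exp (K * \<rho>)\<close> times \<open>K\<^sup>2 * G + K * laplacian \<rho>\<close>, with
  \<open>G\<close> the squared length of the gradient of \<rho>. This gradient does not vanish near
  the boundary, so a large \<open>K\<close> beats both \<open>laplacian \<rho>\<close> and
  \<open>C\<close>.\<close>

lemma boundary_supersolution:
  fixes \<Omega> :: "'a::euclidean_space set"
  assumes dom: "smooth_bounded_domain \<Omega>" and C: "C \<ge> 0"
  obtains s core where "compact core" "core \<subseteq> \<Omega>" "continuous_on UNIV s"
    "\<forall>z\<in>closure \<Omega>. 1 \<le> s z"
    "\<forall>z\<in>\<Omega> - core. \<exists>L. L < - C * s z \<and> ((\<lambda>t. disc_lap s z t / t\<^sup>2) \<longlongrightarrow> L) (at_right 0)"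
proof -
  obtain \<rho> where \<rho>: "smooth_on UNIV \<rho>" "\<Omega> = {x. \<rho> x < 0}"
    "\<And>x. \<rho> x = 0 \<Longrightarrow> frechet_derivative \<rho> (at x) \<noteq> (\<lambda>_. 0)"
    and \<Omega>: "bounded \<Omega>" "\<Omega> \<noteq> {}" and cont: "continuous_on UNIV \<rho>"
    using smooth_bounded_domainE[OF dom] by metis
  have dcont: "continuous_on A (dd \<rho> vs)" for A vs
    using \<rho>(1) unfolding smooth_on_def
    by (simp add: continuous_at_imp_continuous_on differentiable_imp_continuous_within)
  have comp: "compact (closure \<Omega>)" using \<Omega>(1) by simp
  have ne: "closure \<Omega> \<noteq> {}" using \<Omega>(2) by simp
  have \<rho>_closure: "\<rho> z \<le> 0" if "z \<in> closure \<Omega>" for z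
  proof -
    have "closed {x. \<rho> x \<le> 0}" by (intro closed_Collect_le cont continuous_intros)
    then have "closure \<Omega> \<subseteq> {x. \<rho> x \<le> 0}" by (intro closure_minimal) (auto simp: \<rho>(2))
    then show ?thesis using that by auto
  qed
  define G where "G z = (\<Sum>b\<in>Basis. (dd \<rho> [b] z)\<^sup>2)" for z
  have G_cont: "continuous_on A G" for A unfolding G_def by (intro continuous_intros dcont)
  have lap_cont: "continuous_on A (laplacian \<rho>)" for A
    unfolding laplacian_def hess_def by (intro continuous_intros dcont)
  have pos: "G z + \<bar>\<rho> z\<bar> > 0" for z
  proof (cases "\<rho> z = 0")
    case True
    have "\<exists>b\<in>Basis. dd \<rho> [b] z \<noteq> 0"
      using frechet_derivative_zero_if_zero_on_Basis[of \<rho> z] \<rho>(1,3) True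
      unfolding smooth_on_def by (metis UNIV_I dd.simps(1))
    then have "G z > 0" unfolding G_def by (auto intro!: sum_pos2)
    then show ?thesis by simp
  next
    case False
    moreover have "G z \<ge> 0" unfolding G_def by (intro sum_nonneg) simp
    ultimately show ?thesis by simp
  qed
  have "continuous_on (closure \<Omega>) (\<lambda>z. G z + \<bar>\<rho> z\<bar>)"
    by (intro continuous_intros G_cont continuous_on_subset[OF cont]) auto
  from compact_max_obtains[OF comp ne continuous_on_minus[OF this]]
  obtain z1 where "z1 \<in> closure \<Omega>" "\<And>z. z \<in> closure \<Omega> \<Longrightarrow> - (G z + \<bar>\<rho> z\<bar>) \<le> - (G z1 + \<bar>\<rho> z1\<bar>)" by blast
  then have z1: "\<And>z. z \<in> closure \<Omega> \<Longrightarrow> G z1 + \<bar>\<rho> z1\<bar> \<le> G z + \<bar>\<rho> z\<bar>"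
    unfolding neg_le_iff_le by blast
  \<comment> \<open>Half the minimum of \<open>G + \<bar>\<rho>\<bar>\<close> on the closure:
    wherever \<open>\<bar>\<rho>\<bar> \<le> c\<close>, the other half is left for
    \<open>G\<close>.\<close>
  define c where "c = (G z1 + \<bar>\<rho> z1\<bar>) / 2"
  have c: "c > 0" using pos[of z1] by (simp add: c_def)
  have G_ge: "G z \<ge> c" if "z \<in> closure \<Omega>" "\<bar>\<rho> z\<bar> \<le> c" for z
    using z1[OF that(1)] that(2) by (simp add: c_def)
  obtain zB where "zB \<in> closure \<Omega>" and zB: "\<And>z. z \<in> closure \<Omega> \<Longrightarrow> - laplacian \<rho> z \<le> - laplacian \<rho> zB"
    by (rule compact_max_obtains[OF comp ne continuous_on_minus[OF lap_cont]]) blast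
  define B where "B = max 0 (- laplacian \<rho> zB)"
  have B: "laplacian \<rho> z \<ge> - B" if "z \<in> closure \<Omega>" for z
    using zB[OF that] by (simp add: B_def)
  \<comment> \<open>\<open>1 / K \<le> c\<close> places the strip
    \<open>- 1 / K < \<rho> < 0\<close> where \<open>G \<ge> c\<close>. In the strip
    \<open>exp (K * \<rho>) \<ge> 1 / 3\<close>, and \<open>s \<le> 2\<close> everywhere; the factor
    \<open>6\<close> pays for both.\<close>
  define K where "K = max (max 1 (1 / c)) ((B + 6 * C + 1) / c)"
  have K: "K \<ge> 1" "1 / K \<le> c" "K * c \<ge> B + 6 * C + 1"
  proof -
    show K1: "K \<ge> 1" by (simp add: K_def)
    have "K \<ge> 1 / c" "K \<ge> (B + 6 * C + 1) / c" by (simp_all add: K_def)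
    then show "1 / K \<le> c" "K * c \<ge> B + 6 * C + 1"
      using c K1 by (simp_all add: pos_divide_le_eq mult.commute)
  qed
  define s where "s z = 2 - exp (K * \<rho> z)" for z
  define core where "core = closure \<Omega> \<inter> {z. \<rho> z \<le> - 1 / K}"
  show thesis
  proof
    show "compact core" unfolding core_def
      by (intro compact_Int_closed comp closed_Collect_le cont continuous_intros)
    show "core \<subseteq> \<Omega>"
    proof
      fix z assume "z \<in> core"
      then have "\<rho> z \<le> - 1 / K" by (simp add: core_def)
      also have "- 1 / K < 0" using K(1) by simp
      finally show "z \<in> \<Omega>" by (simp add: \<rho>(2))
    qed
    show "continuous_on UNIV s" unfolding s_def by (intro continuous_intros cont)
    show "\<forall>z\<in>closure \<Omega>. 1 \<le> s z"
    proof
      fix z assume "z \<in> closure \<Omega>"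
      then have "K * \<rho> z \<le> 0" using K(1) \<rho>_closure[of z] by (simp add: mult_nonneg_nonpos)
      then show "1 \<le> s z" by (simp add: s_def)
    qed
    show "\<forall>z\<in>\<Omega> - core. \<exists>L. L < - C * s z \<and> ((\<lambda>t. disc_lap s z t / t\<^sup>2) \<longlongrightarrow> L) (at_right 0)"
    proof
      fix z assume z: "z \<in> \<Omega> - core"
      then have zc: "z \<in> closure \<Omega>" using closure_subset by blast
      have z\<rho>: "- 1 / K < \<rho> z" "\<rho> z < 0" using z zc by (auto simp: core_def \<rho>(2))
      let ?L = "- exp (K * \<rho> z) * (K\<^sup>2 * G z + K * laplacian \<rho> z)"
      have "\<bar>\<rho> z\<bar> \<le> c" using z\<rho> K(2) by simp
      then have "K * c \<le> K * G z" using G_ge[OF zc] K(1) by (intro mult_left_mono) auto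
      then have "6 * C + 1 \<le> K * G z + laplacian \<rho> z" using K(3) B[OF zc] by linarith
      then have "1 * (6 * C + 1) \<le> K * (K * G z + laplacian \<rho> z)"
        using K(1) C by (intro mult_mono) auto
      moreover have "1 / 3 \<le> exp (K * \<rho> z)"
      proof -
        have "K * (- 1 / K) \<le> K * \<rho> z" using z\<rho>(1) K(1) by (intro mult_left_mono) auto
        then have "- 1 \<le> K * \<rho> z" using K(1) by simp
        then have "exp (- 1) \<le> exp (K * \<rho> z)" by simp
        moreover have "1 / 3 \<le> exp (- 1 :: real)"
          using exp_le by (simp add: exp_minus field_simps)
        ultimately show ?thesis by linarith
      qed
      ultimately have "1 / 3 * (6 * C + 1) \<le> exp (K * \<rho> z) * (K * (K * G z + laplacian \<rho> z))"
        using C by (intro mult_mono) auto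
      then have "?L \<le> - (1 / 3 * (6 * C + 1))" by (simp add: power2_eq_square algebra_simps)
      moreover have "C * s z \<le> C * 2" using C by (intro mult_left_mono) (auto simp: s_def)
      ultimately have "?L < - C * s z" by simp
      moreover have "((\<lambda>t. disc_lap s z t / t\<^sup>2) \<longlongrightarrow>
          (\<Sum>b\<in>Basis. - exp (K * \<rho> z) * (K\<^sup>2 * (dd \<rho> [b] z)\<^sup>2 + K * hess \<rho> z b b))) (at_right 0)"
      proof (rule disc_lap_tendsto)
        fix b :: 'a
        note line = twice_differentiable_along_line[OF open_UNIV smooth_on_imp_twice_differentiable_on[OF \<rho>(1)] UNIV_I, where z = z and v = b]
        have 1: "eventually (\<lambda>t. ((\<lambda>t. s (z + t *\<^sub>R b)) has_real_derivative
            (- exp (K * \<rho> (z + t *\<^sub>R b))) * (K * dd \<rho> [b] (z + t *\<^sub>R b))) (at t)) (nhds 0)"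
          by (rule eventually_mono[OF line(1)]) (auto simp: s_def simp del: dd.simps intro!: derivative_eq_intros)
        have d0: "((\<lambda>t. \<rho> (z + t *\<^sub>R b)) has_real_derivative dd \<rho> [b] z) (at 0)"
          using eventually_nhds_x_imp_x[OF line(1)] by simp
        have e0: "((\<lambda>t. - exp (K * \<rho> (z + t *\<^sub>R b))) has_real_derivative - exp (K * \<rho> z) * (K * dd \<rho> [b] z)) (at 0)"
          by (rule derivative_eq_intros d0 refl | simp del: dd.simps)+
        have f0: "((\<lambda>t. K * dd \<rho> [b] (z + t *\<^sub>R b)) has_real_derivative K * hess \<rho> z b b) (at 0)"
          by (rule DERIV_cmult[OF line(2)])
        have 2: "((\<lambda>t. (- exp (K * \<rho> (z + t *\<^sub>R b))) * (K * dd \<rho> [b] (z + t *\<^sub>R b))) has_real_derivative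
            - exp (K * \<rho> z) * (K\<^sup>2 * (dd \<rho> [b] z)\<^sup>2 + K * hess \<rho> z b b)) (at 0)"
          by (rule DERIV_mult[OF e0 f0, THEN DERIV_cong]) (simp add: algebra_simps power2_eq_square del: dd.simps)
        show "((\<lambda>t. (s (z + t *\<^sub>R b) + s (z - t *\<^sub>R b) - 2 * s z) / t\<^sup>2) \<longlongrightarrow>
            - exp (K * \<rho> z) * (K\<^sup>2 * (dd \<rho> [b] z)\<^sup>2 + K * hess \<rho> z b b)) (at_right 0)"
          using second_difference_tendsto[OF 1 2] by (simp del: dd.simps)
      qed
      moreover have "(\<Sum>b\<in>Basis. - exp (K * \<rho> z) * (K\<^sup>2 * (dd \<rho> [b] z)\<^sup>2 + K * hess \<rho> z b b)) = ?L"
        unfolding G_def laplacian_def by (simp only: sum_distrib_left[symmetric] sum.distrib)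
      ultimately show "\<exists>L. L < - C * s z \<and> ((\<lambda>t. disc_lap s z t / t\<^sup>2) \<longlongrightarrow> L) (at_right 0)"
        by metis
    qed
  qed
qed

text \<open>The zero-order coefficient has no sign, so the maximum principle is applied to the
  quotient by a positive strict supersolution. A positive maximum \<kappa> of \<open>W / s\<close>
  can lie neither on the frontier nor in the core, and in the strip \<open>W - \<kappa> * s\<close>
  attains its maximum \<open>0\<close>, against the strict inequality for \<open>s\<close>.\<close>

lemma subsolution_nonpos_if_nonpos_on_core:
  fixes \<Omega> :: "'a::euclidean_space set"
  assumes \<Omega>: "open \<Omega>" "bounded \<Omega>"
    and core: "core \<subseteq> \<Omega>" "\<And>z. z \<in> core \<Longrightarrow> W z \<le> 0"
    and s: "continuous_on UNIV s" "\<And>z. z \<in> closure \<Omega> \<Longrightarrow> 1 \<le> s z"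
      "\<And>z. z \<in> \<Omega> - core \<Longrightarrow> \<exists>L. L < - C * s z \<and> ((\<lambda>t. disc_lap s z t / t\<^sup>2) \<longlongrightarrow> L) (at_right 0)"
    and W: "continuous_on (closure \<Omega>) W" "\<And>z. z \<in> frontier \<Omega> \<Longrightarrow> W z = 0" "subsolution_on C \<Omega> W"
    and z: "z \<in> \<Omega>"
  shows "W z \<le> 0"
proof (rule ccontr)
  assume neg: "\<not> ?thesis"
  have zc: "z \<in> closure \<Omega>" using z closure_subset by blast
  have s0: "s y > 0" if "y \<in> closure \<Omega>" for y using s(2)[OF that] by simp
  have "continuous_on (closure \<Omega>) (\<lambda>z. W z / s z)"
    using s0 by (intro continuous_intros W continuous_on_subset[OF s(1)]) force+
  then obtain z1 where z1: "z1 \<in> closure \<Omega>" "\<And>y. y \<in> closure \<Omega> \<Longrightarrow> W y / s y \<le> W z1 / s z1"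
    by (rule compact_max_obtains[rotated 2]) (use \<Omega>(2) zc in auto)
  define \<kappa> where "\<kappa> = W z1 / s z1"
  have "W z / s z > 0" using neg s0[OF zc] by simp
  then have \<kappa>: "\<kappa> > 0" using z1(2)[OF zc] by (simp add: \<kappa>_def)
  have W1: "W z1 = \<kappa> * s z1" using s0[OF z1(1)] by (simp add: \<kappa>_def)
  have W1pos: "W z1 > 0" using W1 \<kappa> s0[OF z1(1)] by simp
  have "z1 \<notin> frontier \<Omega>" using W(2) W1pos by force
  then have z1O: "z1 \<in> \<Omega>" using z1(1) \<Omega>(1) by (simp add: frontier_def interior_open)
  moreover have "z1 \<notin> core" using core(2) W1pos by force
  ultimately obtain L where L: "L < - C * s z1" "((\<lambda>t. disc_lap s z1 t / t\<^sup>2) \<longlongrightarrow> L) (at_right 0)"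
    using s(3) by blast
  have "\<kappa> * L < \<kappa> * (- C * s z1)" using L(1) \<kappa> by (rule mult_strict_left_mono)
  then have "- \<kappa> * L > C * \<bar>W z1\<bar>" using W1 W1pos by (simp add: mult.left_commute)
  from subsolution_strict_comparison[OF W(3) z1O L(2) this \<Omega>(1) z1O] show False
  proof
    fix y assume "y \<in> \<Omega>"
    then have y: "y \<in> closure \<Omega>" using closure_subset by blast
    have "W y \<le> \<kappa> * s y" using z1(2)[OF y] s0[OF y] by (simp add: \<kappa>_def pos_divide_le_eq)
    then show "W y + - \<kappa> * s y \<le> W z1 + - \<kappa> * s z1" using W1 by simp
  qed
qed

text \<open>The supremum over \<open>k\<close> is attained because for large \<open>k\<close> the
  point \<open>z + k\<close> leaves the support of \<open>w\<close>. The maximising offset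
  \<open>h\<close> is a mere choice and may jump with \<open>z\<close>; only the value is
  continuous.\<close>

lemma sup_product_continuous:
  fixes w :: "'a::euclidean_space \<Rightarrow> real"
  assumes cont: "continuous_on UNIV w" and nonneg: "\<And>z. w z \<ge> 0"
    and supp: "\<And>z. norm z > R \<Longrightarrow> w z = 0"
  obtains h where "\<And>z k. w (z + k) * w (z - k) \<le> w (z + h z) * w (z - h z)"
    "continuous_on UNIV (\<lambda>z. w (z + h z) * w (z - h z))"
proof -
  have "\<exists>h. \<forall>k. w (z + k) * w (z - k) \<le> w (z + h) * w (z - h)" for z
  proof -
    let ?B = "cball 0 (\<bar>R\<bar> + norm z) :: 'a set"
    have ne: "?B \<noteq> {}" using norm_ge_zero[of z] abs_ge_zero[of R] by (simp only: cball_eq_empty not_less)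
    have "continuous_on ?B (\<lambda>k. w (z + k) * w (z - k))"
      by (intro continuous_intros continuous_on_compose2[OF cont]) auto
    from compact_max_obtains[OF compact_cball ne this]
    obtain h where "h \<in> ?B" and h: "\<And>k. k \<in> ?B \<Longrightarrow> w (z + k) * w (z - k) \<le> w (z + h) * w (z - h)"
      by blast
    have "w (z + k) * w (z - k) \<le> w (z + h) * w (z - h)" for k
    proof (cases "k \<in> ?B")
      case False
      have "norm k \<le> norm (z + k) + norm z" using norm_triangle_ineq4[of "z + k" z] by simp
      then have "norm (z + k) > R" using False by auto
      then show ?thesis using supp nonneg by simp
    qed (use h in blast)
    then show ?thesis by blast
  qed
  then obtain h where h: "\<And>z k. w (z + k) * w (z - k) \<le> w (z + h z) * w (z - h z)" by metis
  let ?v = "\<lambda>z. w (z + h z) * w (z - h z)"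
  obtain M where M: "M > 0" "\<And>z. w z \<le> M"
  proof -
    obtain z1 where z1: "\<And>y. y \<in> cball 0 \<bar>R\<bar> \<Longrightarrow> w y \<le> w z1"
      by (rule compact_max_obtains[of "cball 0 \<bar>R\<bar>" w]) (auto intro: continuous_on_subset[OF cont])
    have "w y \<le> w z1 + 1" for y
      using z1[of y] supp[of y] nonneg[of z1] by (cases "norm y \<le> \<bar>R\<bar>") auto
    then show thesis using that[of "w z1 + 1"] nonneg[of z1] by simp
  qed
  have unif: "\<exists>d>0. \<forall>x y. dist x y < d \<longrightarrow> \<bar>w x - w y\<bar> < e" if e: "e > 0" for e
  proof -
    let ?B = "cball 0 (\<bar>R\<bar> + 1) :: 'a set"
    have "uniformly_continuous_on ?B w"
      by (intro compact_uniformly_continuous continuous_on_subset[OF cont]) auto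
    then obtain d where d: "d > 0" "\<And>x y. x \<in> ?B \<Longrightarrow> y \<in> ?B \<Longrightarrow> dist y x < d \<Longrightarrow> dist (w y) (w x) < e"
      using e unfolding uniformly_continuous_on_def by metis
    have "\<bar>w x - w y\<bar> < e" if xy: "dist x y < min d 1" for x y
    proof (cases "x \<in> ?B \<and> y \<in> ?B")
      case True
      then show ?thesis using d(2)[of y x] xy by (simp add: dist_real_def)
    next
      case False
      have "norm x \<le> norm y + dist x y" "norm y \<le> norm x + dist x y"
        using norm_triangle_ineq2[of x y] norm_triangle_ineq3[of x y] by (simp_all add: dist_norm)
      then have "norm x > R" "norm y > R" using False xy by auto
      then show ?thesis using supp e by simp
    qed
    then show ?thesis using d(1) by (intro exI[of _ "min d 1"]) auto
  qed
  \<comment> \<open>The offset chosen at \<open>x\<close> is a competitor at \<open>y\<close>, so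
    uniform continuity of \<open>w\<close> gives a one-sided estimate that never compares
    \<open>h x\<close> with \<open>h y\<close>. Exchanging \<open>x\<close> and \<open>y\<close>
    gives the other side.\<close>
  have vle: "?v x \<le> ?v y + e" if d: "\<And>x y. dist x y < d \<Longrightarrow> \<bar>w x - w y\<bar> < e / (2 * M)" and xy: "dist x y < d" for x y d e
  proof -
    have d1: "\<bar>w (x + h x) - w (y + h x)\<bar> < e / (2 * M)" "\<bar>w (x - h x) - w (y - h x)\<bar> < e / (2 * M)"
      using xy by (intro d; simp add: dist_norm)+
    have bound: "w p * c \<le> M * (e / (2 * M))" if "\<bar>c\<bar> < e / (2 * M)" for p c
    proof -
      have "w p * c \<le> w p * (e / (2 * M))" using that nonneg by (intro mult_left_mono) auto
      also have "\<dots> \<le> M * (e / (2 * M))" using that M(2) by (intro mult_right_mono) auto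
      finally show ?thesis .
    qed
    have "?v x - w (y + h x) * w (y - h x) =
        w (x + h x) * (w (x - h x) - w (y - h x)) + w (y - h x) * (w (x + h x) - w (y + h x))"
      by (simp add: algebra_simps)
    also have "\<dots> \<le> M * (e / (2 * M)) + M * (e / (2 * M))"
      using bound[OF d1(2)] bound[OF d1(1)] by (rule add_mono)
    also have "\<dots> = e" using M(1) by simp
    finally show ?thesis using h[of y "h x"] by linarith
  qed
  have "continuous_on UNIV ?v"
    unfolding continuous_on_iff
  proof (intro ballI allI impI)
    fix x :: 'a and e :: real assume e: "e > 0"
    obtain d where d: "d > 0" "\<And>x y. dist x y < d \<Longrightarrow> \<bar>w x - w y\<bar> < (e / 2) / (2 * M)"
      using unif[of "(e / 2) / (2 * M)"] e M(1) by auto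
    have "dist (?v y) (?v x) < e" if "dist y x < d" for y
      using vle[of d "e / 2" y x, OF d(2) that] vle[of d "e / 2" x y, OF d(2)] that e
      by (simp add: dist_real_def dist_commute abs_less_iff)
    then show "\<exists>d>0. \<forall>y\<in>UNIV. dist y x < d \<longrightarrow> dist (?v y) (?v x) < e" using d(1) by auto
  qed
  then show thesis using that h by blast
qed

text \<open>The second derivative of \<open>sqrt (a * b)\<close> contains the cross term
  \<open>2 * a' * b'\<close> and a term with the square of \<open>(a * b)'\<close>. The criticality
  condition \<open>eq\<close> turns this square into \<open>4 * a' * b' * a * b\<close>, and the two
  contributions cancel.\<close>

lemma second_difference_sqrt_product:
  fixes a b a' b' :: "real \<Rightarrow> real"
  assumes a: "eventually (\<lambda>t. (a has_real_derivative a' t) (at t)) (nhds 0)" "(a' has_real_derivative a2) (at 0)"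
    and b: "eventually (\<lambda>t. (b has_real_derivative b' t) (at t)) (nhds 0)" "(b' has_real_derivative b2) (at 0)"
    and pos: "a 0 > 0" "b 0 > 0"
    and eq: "a' 0 * b 0 = a 0 * b' 0"
  shows "((\<lambda>t. (sqrt (a t * b t) + sqrt (a (- t) * b (- t)) - 2 * sqrt (a 0 * b 0)) / t\<^sup>2) \<longlongrightarrow>
    (a2 * b 0 + a 0 * b2) / (2 * sqrt (a 0 * b 0))) (at_right 0)"
proof (rule second_difference_tendsto)
  let ?g' = "\<lambda>t. (a' t * b t + a t * b' t) / (2 * sqrt (a t * b t))"
  have a0: "(a has_real_derivative a' 0) (at 0)" and b0: "(b has_real_derivative b' 0) (at 0)"
    using eventually_nhds_x_imp_x[OF a(1)] eventually_nhds_x_imp_x[OF b(1)] by auto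
  have ev_pos: "eventually (\<lambda>t. c t > 0) (nhds 0)" if "(c has_real_derivative c') (at 0)" "c 0 > 0" for c :: "real \<Rightarrow> real" and c'
  proof -
    have "isCont c 0" using that(1) by (rule DERIV_isCont)
    then have "(c \<longlongrightarrow> c 0) (nhds 0)" by (simp add: isCont_def tendsto_at_iff_tendsto_nhds)
    then show ?thesis using that(2) by (rule order_tendstoD)
  qed
  have sqrt_deriv: "((\<lambda>t. sqrt (a t * b t)) has_real_derivative ?g' t) (at t)"
    if "(a has_real_derivative a' t) (at t)" "(b has_real_derivative b' t) (at t)" "a t > 0" "b t > 0" for t
  proof -
    have "((\<lambda>t. a t * b t) has_real_derivative a' t * b t + b' t * a t) (at t)"
      using DERIV_mult[OF that(1,2)] .
    from DERIV_chain2[OF DERIV_real_sqrt this] that(3,4)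
    show ?thesis by (auto elim!: DERIV_cong simp: field_simps)
  qed
  show "eventually (\<lambda>t. ((\<lambda>t. sqrt (a t * b t)) has_real_derivative ?g' t) (at t)) (nhds 0)"
    using a(1) b(1) ev_pos[OF a0 pos(1)] ev_pos[OF b0 pos(2)]
    by eventually_elim (rule sqrt_deriv)
  let ?P = "sqrt (a 0 * b 0)"
  have P: "?P > 0" "?P * ?P = a 0 * b 0" using pos by (auto simp: mult_nonneg_nonneg)
  have num: "((\<lambda>t. a' t * b t + a t * b' t) has_real_derivative
      (a2 * b 0 + b' 0 * a' 0) + (a' 0 * b' 0 + b2 * a 0)) (at 0)"
    by (intro DERIV_add DERIV_mult a(2) b(2) a0 b0)
  have den: "((\<lambda>t. 2 * sqrt (a t * b t)) has_real_derivative 2 * ?g' 0) (at 0)"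
    by (intro DERIV_cmult sqrt_deriv a0 b0 pos)
  have "(?g' has_real_derivative
      (((a2 * b 0 + b' 0 * a' 0) + (a' 0 * b' 0 + b2 * a 0)) * (2 * ?P) -
        (a' 0 * b 0 + a 0 * b' 0) * (2 * ?g' 0)) / ((2 * ?P) * (2 * ?P))) (at 0)"
    by (rule DERIV_divide[OF num den]) (use pos in simp)
  then show "(?g' has_real_derivative (a2 * b 0 + a 0 * b2) / (2 * ?P)) (at 0)"
  proof (rule DERIV_cong)
    have n2: "(a' 0 * b 0 + a 0 * b' 0) * (a' 0 * b 0 + a 0 * b' 0) = 4 * (a' 0 * b' 0) * (?P * ?P)"
      using eq unfolding P(2) by algebra
    have "(((a2 * b 0 + b' 0 * a' 0) + (a' 0 * b' 0 + b2 * a 0)) * (2 * ?P) -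
        (a' 0 * b 0 + a 0 * b' 0) * (2 * ?g' 0)) =
      ((a2 * b 0 + b' 0 * a' 0) + (a' 0 * b' 0 + b2 * a 0)) * (2 * ?P) -
        ((a' 0 * b 0 + a 0 * b' 0) * (a' 0 * b 0 + a 0 * b' 0)) / ?P"
      by (simp only: times_divide_eq_right mult_divide_mult_cancel_left_if) simp
    also have "\<dots> = (a2 * b 0 + a 0 * b2) * (2 * ?P)"
    proof -
      have "4 * (a' 0 * b' 0) * (?P * ?P) / ?P = 4 * (a' 0 * b' 0) * ?P" using P(1)
        by (metis less_irrefl mult.assoc nonzero_mult_div_cancel_right)
      then show ?thesis unfolding n2 by (simp add: algebra_simps)
    qed
    finally have num_eq: "(((a2 * b 0 + b' 0 * a' 0) + (a' 0 * b' 0 + b2 * a 0)) * (2 * ?P) -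
        (a' 0 * b 0 + a 0 * b' 0) * (2 * ?g' 0)) = (a2 * b 0 + a 0 * b2) * (2 * ?P)" .
    show "(((a2 * b 0 + b' 0 * a' 0) + (a' 0 * b' 0 + b2 * a 0)) * (2 * ?P) -
        (a' 0 * b 0 + a 0 * b' 0) * (2 * ?g' 0)) / ((2 * ?P) * (2 * ?P)) = (a2 * b 0 + a 0 * b2) / (2 * ?P)"
      unfolding num_eq using pos by (intro mult_divide_mult_cancel_right) simp
  qed
qed

section \<open>Log-concavity\<close>

lemma dd_minus_direction: "g differentiable (at x) \<Longrightarrow> dd g [- v] x = - dd g [v] x"
  by (simp add: linear_neg linear_frechet_derivative)

lemma subsolution_on_minus:
  assumes "open \<Omega>" "twice_differentiable_on \<Omega> u"
    and "\<And>z. z \<in> \<Omega> \<Longrightarrow> laplacian u z = (q z - lam) * u z"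
    and "\<And>z. z \<in> \<Omega> \<Longrightarrow> \<bar>q z - lam\<bar> \<le> C"
  shows "subsolution_on C \<Omega> (\<lambda>z. - u z)"
  unfolding subsolution_on_def
proof (intro ballI allI impI)
  fix z and e :: real assume z: "z \<in> \<Omega>" and e: "e > 0"
  have "((\<lambda>t. - disc_lap u z t / t\<^sup>2) \<longlongrightarrow> - ((q z - lam) * u z)) (at_right 0)"
    using tendsto_minus[OF disc_lap_laplacian[OF assms(1,2) z]] assms(3)[OF z] by simp
  from eventually_ge_if_quotient_tendsto(1)[OF this e]
  show "\<forall>\<^sub>F t in at_right 0. disc_lap (\<lambda>z. - u z) z t \<ge> (- C * \<bar>- u z\<bar> - e) * t\<^sup>2"
  proof eventually_elim
    case (elim t)
    have "(q z - lam) * u z \<le> \<bar>q z - lam\<bar> * \<bar>u z\<bar>" by (simp add: abs_mult[symmetric])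
    also have "\<dots> \<le> C * \<bar>u z\<bar>" using assms(4)[OF z] by (intro mult_right_mono) auto
    finally have "(- C * \<bar>- u z\<bar> - e) * t\<^sup>2 \<le> (- ((q z - lam) * u z) - e) * t\<^sup>2"
      by (intro mult_right_mono) auto
    also have "\<dots> \<le> - disc_lap u z t" by (rule elim)
    also have "- disc_lap u z t = disc_lap (\<lambda>z. - u z) z t"
      using disc_lap_add_scaled[of "\<lambda>_. 0" "- 1" u z t] by (simp add: disc_lap_def)
    finally show ?case .
  qed
qed

lemma semiconvex_at_if_quotient_tendsto:
  assumes "((\<lambda>t. d t / t\<^sup>2) \<longlongrightarrow> L) (at_right (0::real))"
  shows "\<exists>K. \<forall>\<^sub>F t in at_right 0. d t \<ge> - K * t\<^sup>2"
  using eventually_ge_if_quotient_tendsto(1)[OF assms, of 1] by (intro exI[of _ "- (L - 1)"]) simp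

text \<open>An interior zero would be a maximum of the nonpositive subsolution \<open>- u\<close>,
  and the strong maximum principle would spread it to \<open>z1\<close>.\<close>

lemma nonneg_eigenfunction_pos:
  fixes \<Omega> :: "'a::euclidean_space set"
  assumes "open \<Omega>" "connected \<Omega>" "C \<ge> 0" "twice_differentiable_on \<Omega> u" "continuous_on \<Omega> u"
    and eq: "\<And>z. z \<in> \<Omega> \<Longrightarrow> laplacian u z = (q z - lam) * u z"
    and C: "\<And>z. z \<in> \<Omega> \<Longrightarrow> \<bar>q z - lam\<bar> \<le> C"
    and nonneg: "\<And>z. z \<in> \<Omega> \<Longrightarrow> u z \<ge> 0"
    and nonzero: "z1 \<in> \<Omega>" "u z1 \<noteq> 0"
    and z: "z \<in> \<Omega>"
  shows "u z > 0"
proof (rule ccontr)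
  assume "\<not> u z > 0"
  then have z0: "- u z = 0" using nonneg[OF z] by simp
  have "- u z1 = 0"
  proof (rule strong_maximum_principle[where \<Omega> = \<Omega> and C = C and ?z0.0 = z and W = "\<lambda>z. - u z"])
    show "\<exists>K. \<forall>\<^sub>F t in at_right 0. - u (y + t *\<^sub>R n) + - u (y - t *\<^sub>R n) - 2 * - u y \<ge> - K * t\<^sup>2"
      if y: "y \<in> \<Omega>" for y n
    proof (rule semiconvex_at_if_quotient_tendsto)
      show "((\<lambda>t. (- u (y + t *\<^sub>R n) + - u (y - t *\<^sub>R n) - 2 * - u y) / t\<^sup>2) \<longlongrightarrow> - hess u y n n) (at_right 0)"
        by (rule Lim_transform_eventually[OF tendsto_minus[OF second_difference_hess[OF assms(1,4) y, of n]]])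
           (simp add: minus_divide_left algebra_simps)
    qed
  qed (use assms z0 subsolution_on_minus[OF assms(1,4) eq C] in \<open>auto intro!: continuous_intros\<close>)
  then show False using nonzero by simp
qed

text \<open>Convexity of \<open>q\<close> is stated through midpoints because the extremal pair
  defining \<open>v z\<close> is symmetric about \<open>z\<close>.\<close>

locale positive_eigenfunction =
  fixes \<Omega> :: "'a::euclidean_space set" and q u :: "'a \<Rightarrow> real" and lam C :: real
  assumes dom: "smooth_bounded_domain \<Omega>"
    and sconv: "strictly_convex \<Omega>"
    and u_twice: "twice_differentiable_on \<Omega> u"
    and u_cont: "continuous_on (closure \<Omega>) u"
    and u_frontier: "\<And>z. z \<in> frontier \<Omega> \<Longrightarrow> u z = 0"
    and u_pos: "\<And>z. z \<in> \<Omega> \<Longrightarrow> u z > 0"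
    and u_eq: "\<And>z. z \<in> \<Omega> \<Longrightarrow> laplacian u z = (q z - lam) * u z"
    and q_bound: "\<And>z. z \<in> \<Omega> \<Longrightarrow> \<bar>q z - lam\<bar> \<le> C"
    and q_midconvex: "\<And>z h. z + h \<in> \<Omega> \<Longrightarrow> z - h \<in> \<Omega> \<Longrightarrow> 2 * q z \<le> q (z + h) + q (z - h)"
begin

lemma open_domain: "open \<Omega>" and bounded_domain: "bounded \<Omega>"
  and connected_domain: "connected \<Omega>" and domain_nonempty: "\<Omega> \<noteq> {}"
  using smooth_bounded_domainE[OF dom] by metis+

lemma C_nonneg: "C \<ge> 0"
  using domain_nonempty q_bound abs_ge_zero order_trans by (metis ex_in_conv)

lemma open_segment_subset:
  assumes "x \<in> closure \<Omega>" "y \<in> closure \<Omega>" "x \<noteq> y"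
  shows "open_segment x y \<subseteq> \<Omega>"
  using sconv assms unfolding strictly_convex_def by blast

lemma convex_domain: "convex \<Omega>"
  unfolding convex_contains_open_segment
  using open_segment_subset closure_subset by (metis ends_in_segment(1) open_segment_idem empty_subsetI subsetD)

lemma midpoint_mem: "z + h \<in> \<Omega> \<Longrightarrow> z - h \<in> \<Omega> \<Longrightarrow> z \<in> \<Omega>"
  using convexD[OF convex_domain, of "z + h" "z - h" "1/2" "1/2"]
  by (simp add: algebra_simps scaleR_add_left[symmetric])

lemma not_frontier: "z \<in> closure \<Omega> \<Longrightarrow> z \<notin> frontier \<Omega> \<Longrightarrow> z \<in> \<Omega>"
  using open_domain by (simp add: frontier_def interior_open)

lemma continuous_on_u: "continuous_on \<Omega> u"
  using u_cont closure_subset by (rule continuous_on_subset)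

lemma u_differentiable: "z \<in> \<Omega> \<Longrightarrow> u differentiable (at z)"
  using u_twice by (simp add: twice_differentiable_on_def)

text \<open>The proportionality of \<open>v\<close> and \<open>u\<close> is refuted at a maximum
  point of \<open>u\<close>: there every competing product is at most \<open>u\<close>, so the
  factor is at most \<open>1\<close>, whereas a failure of the claim at \<open>z0\<close> makes it
  larger than \<open>1\<close>.\<close>

lemma midpoint_log_concave:
  assumes zh: "z0 + h0 \<in> \<Omega>" "z0 - h0 \<in> \<Omega>"
  shows "u (z0 + h0) * u (z0 - h0) \<le> (u z0)\<^sup>2"
proof (rule ccontr)
  assume contra: "\<not> ?thesis"
  \<comment> \<open>Extension by zero is continuous since \<open>u\<close> vanishes on the frontier.
    It removes the constraint that both points stay in the domain: pairs with a point outside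
    contribute \<open>0\<close>.\<close>
  define w where "w z = (if z \<in> \<Omega> then sqrt (u z) else 0)" for z
  have w_closure: "w z = sqrt (u z)" if "z \<in> closure \<Omega>" for z
    using not_frontier[OF that] u_frontier[of z] by (auto simp: w_def)
  have "continuous_on (closure \<Omega>) w"
    using w_closure u_cont by (simp add: continuous_on_real_sqrt cong: continuous_on_cong)
  moreover have "continuous_on (- \<Omega>) w"
    by (rule continuous_on_eq[of _ "\<lambda>_. 0"]) (auto simp: w_def)
  ultimately have "continuous_on (closure \<Omega> \<union> - \<Omega>) w"
    using open_domain by (intro continuous_on_closed_Un) (auto simp: closed_Compl)
  moreover have "closure \<Omega> \<union> - \<Omega> = UNIV" using closure_subset by blast
  ultimately have w_cont: "continuous_on UNIV w" by simp
  have w_nonneg: "w z \<ge> 0" for z using u_pos[of z] by (auto simp: w_def less_imp_le)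
  obtain R where R: "\<And>z. z \<in> \<Omega> \<Longrightarrow> norm z \<le> R"
    using bounded_domain unfolding bounded_iff by blast
  have w_supp: "w z = 0" if "norm z > R" for z using R[of z] that by (auto simp: w_def)
  obtain hm where hm: "\<And>z k. w (z + k) * w (z - k) \<le> w (z + hm z) * w (z - hm z)"
    and v_cont0: "continuous_on UNIV (\<lambda>z. w (z + hm z) * w (z - hm z))"
    using sup_product_continuous[OF w_cont w_nonneg w_supp] by blast
  define v where "v z = w (z + hm z) * w (z - hm z)" for z
  have v_cont: "continuous_on A v" for A
    using v_cont0 unfolding v_def by (rule continuous_on_subset) auto
  have v_ge: "v z \<ge> w (z + k) * w (z - k)" for z k using hm by (simp add: v_def)
  have v_ge_u: "v z \<ge> u z" if "z \<in> \<Omega>" for z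
    using v_ge[where z = z and k = 0] that u_pos[OF that] by (simp add: w_def)
  have v_zero: "v z = 0" if "z \<notin> \<Omega>" for z
    using midpoint_mem[of z "hm z"] that by (auto simp: v_def w_def)
  \<comment> \<open>With the optimal offset at \<open>z\<close> frozen,
    \<open>sqrt (u (x + k) * u (y + k))\<close> lies below \<open>v (z + k)\<close> and equals it at
    \<open>k = 0\<close>. This lower support function supplies the second differences that
    \<open>v\<close> itself may not have.\<close>
  have touch: "\<exists>x y. x \<in> \<Omega> \<and> y \<in> \<Omega> \<and> v z = sqrt (u x * u y) \<and> q x + q y \<ge> 2 * q z \<and>
     (\<forall>n. \<exists>sd. (\<forall>\<^sub>F t in at_right 0. v (z + t *\<^sub>R n) + v (z - t *\<^sub>R n) - 2 * v z \<ge> sd t) \<and>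
       ((\<lambda>t. sd t / t\<^sup>2) \<longlongrightarrow> (hess u x n n * u y + u x * hess u y n n) / (2 * sqrt (u x * u y))) (at_right 0))"
    if z: "z \<in> \<Omega>" for z
  proof -
    define x where "x = z + hm z"
    define y where "y = z - hm z"
    have "v z > 0" using v_ge_u[OF z] u_pos[OF z] by simp
    then have xy: "x \<in> \<Omega>" "y \<in> \<Omega>" by (auto simp: v_def w_def x_def y_def split: if_splits)
    have vz: "v z = sqrt (u x * u y)"
      using xy by (simp add: v_def w_def x_def y_def real_sqrt_mult)
    have shift: "v (z + k) \<ge> sqrt (u (x + k) * u (y + k))" if "x + k \<in> \<Omega>" "y + k \<in> \<Omega>" for k
      using v_ge[where z = "z + k" and k = "hm z"] that
      by (simp add: w_def x_def y_def real_sqrt_mult algebra_simps)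
    \<comment> \<open>Moving \<open>x\<close> and \<open>y\<close> in opposite directions keeps the
      midpoint \<open>z\<close>, so the product is maximal in this motion. The resulting condition
      is what makes the cross terms cancel when both points move in parallel.\<close>
    have crit: "dd u [n] x * u y = u x * dd u [n] y" for n
    proof -
      have dx: "((\<lambda>t. u (x + t *\<^sub>R n)) has_real_derivative dd u [n] x) (at 0)"
        using has_derivative_along_line[of u x 0 n] u_differentiable[OF xy(1)] by simp
      have dy: "((\<lambda>t. u (y + t *\<^sub>R (- n))) has_real_derivative - dd u [n] y) (at 0)"
        using has_derivative_along_line[of u y 0 "- n"] u_differentiable[OF xy(2)] dd_minus_direction[of u y n] by simp
      have ev: "eventually (\<lambda>t. x + t *\<^sub>R n \<in> \<Omega> \<and> y + t *\<^sub>R (- n) \<in> \<Omega>) (nhds 0)"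
        by (intro eventually_conj eventually_line_in_open open_domain xy)
      then obtain d where d: "d > 0" "\<And>t. \<bar>t\<bar> < d \<Longrightarrow> x + t *\<^sub>R n \<in> \<Omega> \<and> y + t *\<^sub>R (- n) \<in> \<Omega>"
        unfolding eventually_nhds_metric by (auto simp: dist_real_def)
      have "dd u [n] x * u (y + 0 *\<^sub>R (- n)) + - dd u [n] y * u (x + 0 *\<^sub>R n) = 0"
      proof (rule DERIV_local_max[OF DERIV_mult[OF dx dy] d(1)], intro allI impI)
        fix t :: real assume "\<bar>0 - t\<bar> < d"
        then have t: "x + t *\<^sub>R n \<in> \<Omega>" "y + t *\<^sub>R (- n) \<in> \<Omega>" using d(2)[of t] by auto
        have "w (x + t *\<^sub>R n) * w (y + t *\<^sub>R (- n)) \<le> w x * w y"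
          using hm[of z "hm z + t *\<^sub>R n"] by (simp add: x_def y_def algebra_simps)
        then have "sqrt (u (x + t *\<^sub>R n) * u (y + t *\<^sub>R (- n))) \<le> sqrt (u x * u y)"
          using t xy by (simp add: w_def real_sqrt_mult)
        then show "u (x + t *\<^sub>R n) * u (y + t *\<^sub>R (- n)) \<le> u (x + 0 *\<^sub>R n) * u (y + 0 *\<^sub>R (- n))" by simp
      qed
      then show ?thesis by (simp add: algebra_simps)
    qed
    have "\<exists>sd. (\<forall>\<^sub>F t in at_right 0. v (z + t *\<^sub>R n) + v (z - t *\<^sub>R n) - 2 * v z \<ge> sd t) \<and>
       ((\<lambda>t. sd t / t\<^sup>2) \<longlongrightarrow> (hess u x n n * u y + u x * hess u y n n) / (2 * sqrt (u x * u y))) (at_right 0)" for n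
    proof (intro exI conjI)
      let ?sd = "\<lambda>t. sqrt (u (x + t *\<^sub>R n) * u (y + t *\<^sub>R n)) + sqrt (u (x + (- t) *\<^sub>R n) * u (y + (- t) *\<^sub>R n))
          - 2 * sqrt (u (x + 0 *\<^sub>R n) * u (y + 0 *\<^sub>R n))"
      have "((\<lambda>t. ?sd t / t\<^sup>2) \<longlongrightarrow> (hess u x n n * u (y + 0 *\<^sub>R n) + u (x + 0 *\<^sub>R n) * hess u y n n) /
          (2 * sqrt (u (x + 0 *\<^sub>R n) * u (y + 0 *\<^sub>R n)))) (at_right 0)"
        by (rule second_difference_sqrt_product[OF
              twice_differentiable_along_line[OF open_domain u_twice xy(1), where v = n]
              twice_differentiable_along_line[OF open_domain u_twice xy(2), where v = n]])
           (use u_pos[OF xy(1)] u_pos[OF xy(2)] crit[of n] in \<open>simp_all del: dd.simps\<close>)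
      then show "((\<lambda>t. ?sd t / t\<^sup>2) \<longlongrightarrow> (hess u x n n * u y + u x * hess u y n n) / (2 * sqrt (u x * u y))) (at_right 0)"
        by simp
      have "eventually (\<lambda>t. x + t *\<^sub>R n \<in> \<Omega> \<and> y + t *\<^sub>R n \<in> \<Omega> \<and> x + t *\<^sub>R (- n) \<in> \<Omega> \<and> y + t *\<^sub>R (- n) \<in> \<Omega>) (at_right 0)"
        by (intro eventually_at_right_if_nhds eventually_conj eventually_line_in_open open_domain xy)
      then show "\<forall>\<^sub>F t in at_right 0. v (z + t *\<^sub>R n) + v (z - t *\<^sub>R n) - 2 * v z \<ge> ?sd t"
      proof eventually_elim
        case (elim t)
        then show ?case using shift[of "t *\<^sub>R n"] shift[of "- (t *\<^sub>R n)"] vz by simp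
      qed
    qed
    moreover have "q x + q y \<ge> 2 * q z" using q_midconvex xy by (simp add: x_def y_def)
    ultimately show ?thesis using xy vz by blast
  qed
  have v_sub: "\<forall>\<^sub>F t in at_right 0. disc_lap v z t \<ge> ((q z - lam) * v z - e) * t\<^sup>2"
    if z: "z \<in> \<Omega>" and e: "e > 0" for z e
  proof -
    obtain x y where xy: "x \<in> \<Omega>" "y \<in> \<Omega>" "v z = sqrt (u x * u y)" "q x + q y \<ge> 2 * q z"
      and ex: "\<forall>n. \<exists>sd. (\<forall>\<^sub>F t in at_right 0. v (z + t *\<^sub>R n) + v (z - t *\<^sub>R n) - 2 * v z \<ge> sd t) \<and>
       ((\<lambda>t. sd t / t\<^sup>2) \<longlongrightarrow> (hess u x n n * u y + u x * hess u y n n) / (2 * sqrt (u x * u y))) (at_right 0)"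
    proof -
      from touch[OF z] show thesis by (elim exE conjE) (rule that)
    qed
    obtain sd where sd0: "\<forall>n. (\<forall>\<^sub>F t in at_right 0. v (z + t *\<^sub>R n) + v (z - t *\<^sub>R n) - 2 * v z \<ge> sd n t) \<and>
       ((\<lambda>t. sd n t / t\<^sup>2) \<longlongrightarrow> (hess u x n n * u y + u x * hess u y n n) / (2 * sqrt (u x * u y))) (at_right 0)"
    proof -
      from choice[OF ex] show thesis by (elim exE) (rule that)
    qed
    have sd: "\<forall>\<^sub>F t in at_right 0. v (z + t *\<^sub>R n) + v (z - t *\<^sub>R n) - 2 * v z \<ge> sd n t"
       "((\<lambda>t. sd n t / t\<^sup>2) \<longlongrightarrow> (hess u x n n * u y + u x * hess u y n n) / (2 * sqrt (u x * u y))) (at_right 0)" for n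
      using spec[OF sd0, of n] by (rule conjunct1, rule conjunct2)
    have "((\<lambda>t. \<Sum>b\<in>Basis. sd b t / t\<^sup>2) \<longlongrightarrow>
        (\<Sum>b\<in>Basis. (hess u x b b * u y + u x * hess u y b b) / (2 * sqrt (u x * u y)))) (at_right 0)"
      by (intro tendsto_sum sd)
    moreover have "(\<Sum>b\<in>Basis. (hess u x b b * u y + u x * hess u y b b) / (2 * sqrt (u x * u y))) =
        (laplacian u x * u y + u x * laplacian u y) / (2 * sqrt (u x * u y))"
      unfolding laplacian_def by (simp add: sum_divide_distrib[symmetric] sum.distrib sum_distrib_left sum_distrib_right)
    moreover have "\<dots> = (q x + q y - 2 * lam) / 2 * v z"
    proof -
      have "sqrt (u x * u y) > 0" "sqrt (u x * u y) * sqrt (u x * u y) = u x * u y"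
        using u_pos[OF xy(1)] u_pos[OF xy(2)] by (simp_all add: less_imp_le)
      moreover have "laplacian u x * u y + u x * laplacian u y = (q x + q y - 2 * lam) * (u x * u y)"
        unfolding u_eq[OF xy(1)] u_eq[OF xy(2)] by (simp add: algebra_simps)
      moreover have "k * (p * p) / (2 * p) = k / 2 * p" if "p > 0" for k p :: real
        using that by simp
      ultimately show ?thesis unfolding xy(3) by metis
    qed
    ultimately have "((\<lambda>t. (\<Sum>b\<in>Basis. sd b t) / t\<^sup>2) \<longlongrightarrow> (q x + q y - 2 * lam) / 2 * v z) (at_right 0)"
      by (simp add: sum_divide_distrib)
    from eventually_ge_if_quotient_tendsto(1)[OF this e]
    have "\<forall>\<^sub>F t in at_right 0. ((q x + q y - 2 * lam) / 2 * v z - e) * t\<^sup>2 \<le> (\<Sum>b\<in>Basis. sd b t)" .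
    moreover have "\<forall>\<^sub>F t in at_right 0. \<forall>b\<in>Basis. v (z + t *\<^sub>R b) + v (z - t *\<^sub>R b) - 2 * v z \<ge> sd b t"
      by (intro eventually_ball_finite ballI finite_Basis sd)
    ultimately show ?thesis
    proof eventually_elim
      case (elim t)
      have "v z \<ge> 0" using v_ge_u[OF z] u_pos[OF z] by simp
      then have "(q z - lam) * v z \<le> (q x + q y - 2 * lam) / 2 * v z"
        using xy(4) by (intro mult_right_mono) auto
      then have "((q z - lam) * v z - e) * t\<^sup>2 \<le> ((q x + q y - 2 * lam) / 2 * v z - e) * t\<^sup>2"
        by (intro mult_right_mono) auto
      also have "\<dots> \<le> (\<Sum>b\<in>Basis. sd b t)" by (rule elim)
      also have "\<dots> \<le> disc_lap v z t" unfolding disc_lap_def using elim by (intro sum_mono) auto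
      finally show ?case .
    qed
  qed
  have z0: "z0 \<in> \<Omega>" using midpoint_mem zh by blast
  have "v z0 > u z0"
  proof -
    have "(u z0)\<^sup>2 < u (z0 + h0) * u (z0 - h0)" using contra by simp
    then have "sqrt ((u z0)\<^sup>2) < sqrt (u (z0 + h0) * u (z0 - h0))" by (simp only: real_sqrt_less_iff)
    moreover have "sqrt ((u z0)\<^sup>2) = u z0" using u_pos[OF z0] by simp
    moreover have "sqrt (u (z0 + h0) * u (z0 - h0)) \<le> v z0"
      using v_ge[where z = z0 and k = h0] zh by (simp add: w_def real_sqrt_mult)
    ultimately show ?thesis by linarith
  qed
  obtain s core where core: "compact core" "core \<subseteq> \<Omega>" and s: "continuous_on UNIV s"
    "\<forall>z\<in>closure \<Omega>. 1 \<le> s z"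
    "\<forall>z\<in>\<Omega> - core. \<exists>L. L < - C * s z \<and> ((\<lambda>t. disc_lap s z t / t\<^sup>2) \<longlongrightarrow> L) (at_right 0)"
  proof -
    show thesis by (rule boundary_supersolution[OF dom C_nonneg]) (rule that)
  qed
  \<comment> \<open>Both \<open>v\<close> and \<open>u\<close> vanish on the frontier, so the
    maximum of \<open>v / u\<close> is taken over a compact subset of the domain. Including
    \<open>z0\<close> guarantees \<open>A > 1\<close>; outside the core, the strip principle gives
    \<open>v \<le> A * u\<close>.\<close>
  have sub_core: "insert z0 core \<subseteq> \<Omega>" using core(2) z0 by simp
  have "continuous_on (insert z0 core) (\<lambda>z. v z / u z)"
    using sub_core u_pos by (intro continuous_intros v_cont continuous_on_subset[OF continuous_on_u]) force+
  from compact_max_obtains[OF _ _ this] core(1)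
  obtain z1 where z1: "z1 \<in> insert z0 core" "\<And>y. y \<in> insert z0 core \<Longrightarrow> v y / u y \<le> v z1 / u z1"
    by (metis compact_insert insert_not_empty)
  define A where "A = v z1 / u z1"
  have z1O: "z1 \<in> \<Omega>" using z1(1) sub_core by blast
  have A1: "A > 1"
  proof -
    have "1 < v z0 / u z0" using \<open>v z0 > u z0\<close> u_pos[OF z0] by simp
    also have "\<dots> \<le> A" using z1(2)[of z0] by (simp add: A_def)
    finally show ?thesis .
  qed
  define W where "W z = v z - A * u z" for z
  have W_eq: "W = (\<lambda>z. v z + (- A) * u z)" by (simp add: W_def fun_eq_iff)
  have W_sub: "subsolution_on C \<Omega> W"
    unfolding subsolution_on_def
  proof (intro ballI allI impI)
    fix z and e :: real assume z: "z \<in> \<Omega>" and e: "e > 0"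
    have "((\<lambda>t. ((- A) * disc_lap u z t) / t\<^sup>2) \<longlongrightarrow> (- A) * ((q z - lam) * u z)) (at_right 0)"
      using tendsto_mult_left[OF disc_lap_laplacian[OF open_domain u_twice z], of "- A"] u_eq[OF z] by simp
    from eventually_ge_if_quotient_tendsto(1)[OF this, of "e / 2"] e
    have "\<forall>\<^sub>F t in at_right 0. (- A) * disc_lap u z t \<ge> ((- A) * ((q z - lam) * u z) - e / 2) * t\<^sup>2" by simp
    moreover have "\<forall>\<^sub>F t in at_right 0. disc_lap v z t \<ge> ((q z - lam) * v z - e / 2) * t\<^sup>2"
      using e by (intro v_sub z) simp
    ultimately show "\<forall>\<^sub>F t in at_right 0. disc_lap W z t \<ge> (- C * \<bar>W z\<bar> - e) * t\<^sup>2"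
    proof eventually_elim
      case (elim t)
      have "- ((q z - lam) * W z) \<le> \<bar>q z - lam\<bar> * \<bar>W z\<bar>"
        by (metis abs_ge_minus_self abs_mult)
      also have "\<dots> \<le> C * \<bar>W z\<bar>" using q_bound[OF z] by (intro mult_right_mono) auto
      finally have "(- C * \<bar>W z\<bar> - e) * t\<^sup>2 \<le> ((q z - lam) * W z - e) * t\<^sup>2"
        by (intro mult_right_mono) auto
      also have "\<dots> = ((q z - lam) * v z - e / 2) * t\<^sup>2 + ((- A) * ((q z - lam) * u z) - e / 2) * t\<^sup>2"
        by (simp add: W_def algebra_simps)
      also have "\<dots> \<le> disc_lap v z t + (- A) * disc_lap u z t" using elim by (intro add_mono)
      also have "\<dots> = disc_lap W z t" unfolding W_eq by (rule disc_lap_add_scaled[symmetric])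
      finally show ?case .
    qed
  qed
  have W_nonpos: "W z \<le> 0" if z: "z \<in> \<Omega>" for z
  proof (rule subsolution_nonpos_if_nonpos_on_core[OF open_domain bounded_domain core(2) _ s(1) bspec[OF s(2)] bspec[OF s(3)] _ _ W_sub z])
    show "W y \<le> 0" if "y \<in> core" for y
    proof -
      have "u y > 0" using that core(2) u_pos by blast
      moreover have "v y / u y \<le> A" using z1(2)[of y] that by (simp add: A_def)
      ultimately show ?thesis by (simp add: W_def pos_divide_le_eq)
    qed
    show "continuous_on (closure \<Omega>) W" unfolding W_def by (intro continuous_intros v_cont u_cont)
    show "W y = 0" if "y \<in> frontier \<Omega>" for y
    proof -
      have "y \<notin> \<Omega>" using that open_domain by (simp add: frontier_def interior_open)
      then show ?thesis using v_zero u_frontier[OF that] by (simp add: W_def)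
    qed
  qed
  have W_semi: "\<exists>K. \<forall>\<^sub>F t in at_right 0. W (z + t *\<^sub>R n) + W (z - t *\<^sub>R n) - 2 * W z \<ge> - K * t\<^sup>2"
    if z: "z \<in> \<Omega>" for z n
  proof -
    obtain sd L where sd: "\<forall>\<^sub>F t in at_right 0. v (z + t *\<^sub>R n) + v (z - t *\<^sub>R n) - 2 * v z \<ge> sd t"
      "((\<lambda>t. sd t / t\<^sup>2) \<longlongrightarrow> L) (at_right 0)"
    proof -
      from touch[OF z] show thesis by (elim exE conjE allE[of _ n]) (rule that)
    qed
    let ?du = "\<lambda>t. u (z + t *\<^sub>R n) + u (z - t *\<^sub>R n) - 2 * u z"
    have "((\<lambda>t. sd t / t\<^sup>2 + (- A) * (?du t / t\<^sup>2)) \<longlongrightarrow> L + (- A) * hess u z n n) (at_right 0)"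
      by (intro tendsto_intros sd second_difference_hess[OF open_domain u_twice z])
    then have "((\<lambda>t. (sd t + (- A) * ?du t) / t\<^sup>2) \<longlongrightarrow> L + (- A) * hess u z n n) (at_right 0)"
      by (simp only: add_divide_distrib times_divide_eq_right)
    from semiconvex_at_if_quotient_tendsto[OF this]
    obtain K where "\<forall>\<^sub>F t in at_right 0. sd t + (- A) * ?du t \<ge> - K * t\<^sup>2" by blast
    then have "\<forall>\<^sub>F t in at_right 0. W (z + t *\<^sub>R n) + W (z - t *\<^sub>R n) - 2 * W z \<ge> - K * t\<^sup>2"
      using sd(1)
    proof eventually_elim
      case (elim t)
      have "W (z + t *\<^sub>R n) + W (z - t *\<^sub>R n) - 2 * W z =
        (v (z + t *\<^sub>R n) + v (z - t *\<^sub>R n) - 2 * v z) + (- A) * ?du t" by (simp add: W_def algebra_simps)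
      then show ?case using elim by linarith
    qed
    then show ?thesis by blast
  qed
  have W_zero: "W z = 0" if "z \<in> \<Omega>" for z
  proof (rule strong_maximum_principle[where \<Omega> = \<Omega> and C = C and ?z0.0 = z1 and W = W])
    show "W z1 = 0" using u_pos[OF z1O] by (simp add: W_def A_def)
    show "continuous_on \<Omega> W" unfolding W_def by (intro continuous_intros v_cont continuous_on_u)
  qed (use open_domain connected_domain C_nonneg W_nonpos W_sub W_semi z1O that in auto)
  have "closure \<Omega> \<noteq> {}" "compact (closure \<Omega>)" using domain_nonempty bounded_domain by auto
  from compact_max_obtains[OF this(2,1) u_cont]
  obtain zs where zs: "zs \<in> closure \<Omega>" "\<And>y. y \<in> closure \<Omega> \<Longrightarrow> u y \<le> u zs" by blast
  have u_le: "u y \<le> u zs" if "y \<in> \<Omega>" for y using zs(2) that closure_subset by blast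
  have "u zs > 0" using u_le[OF z0] u_pos[OF z0] by simp
  then have zsO: "zs \<in> \<Omega>" using u_frontier not_frontier[OF zs(1)] by force
  have "v zs \<le> u zs"
  proof -
    have w_le: "w y \<le> sqrt (u zs)" for y
      using u_le[of y] \<open>u zs > 0\<close> by (simp add: w_def)
    have "v zs \<le> sqrt (u zs) * sqrt (u zs)"
      unfolding v_def by (intro mult_mono w_le w_nonneg) (use \<open>u zs > 0\<close> in simp)
    then show ?thesis using \<open>u zs > 0\<close> by simp
  qed
  moreover have "v zs = A * u zs" using W_zero[OF zsO] by (simp add: W_def)
  moreover have "1 * u zs < A * u zs" using A1 \<open>u zs > 0\<close> by (rule mult_strict_right_mono)
  ultimately show False by simp
qed

end

section \<open>The equation for the negative logarithm\<close>

definition grad :: "('a::euclidean_space \<Rightarrow> real) \<Rightarrow> 'a \<Rightarrow> 'a" where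
  "grad g x = (\<Sum>b\<in>Basis. dd g [b] x *\<^sub>R b)"

lemma dd_eq_inner_grad:
  assumes "g differentiable (at x)"
  shows "dd g [v] x = v \<bullet> grad g x"
proof -
  interpret linear "frechet_derivative g (at x)" by (rule linear_frechet_derivative[OF assms])
  have "frechet_derivative g (at x) v = frechet_derivative g (at x) (\<Sum>b\<in>Basis. (v \<bullet> b) *\<^sub>R b)"
    by (simp add: euclidean_representation)
  also have "\<dots> = (\<Sum>b\<in>Basis. (v \<bullet> b) * frechet_derivative g (at x) b)" by (simp add: sum scale)
  also have "\<dots> = v \<bullet> grad g x" by (simp add: grad_def inner_sum_right mult.commute)
  finally show ?thesis by simp
qed

lemma power2_norm_grad: "(norm (grad g x))\<^sup>2 = (\<Sum>b\<in>Basis. (dd g [b] x)\<^sup>2)"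
proof -
  have "grad g x \<bullet> b = dd g [b] x" if "b \<in> Basis" for b
    using that by (simp add: grad_def inner_sum_left inner_Basis if_distrib cong: if_cong)
  then show ?thesis
    unfolding power2_norm_eq_inner by (subst euclidean_inner) (simp add: power2_eq_square)
qed

lemma linear_hess_left:
  assumes "twice_differentiable_on S g" "z \<in> S"
  shows "linear (\<lambda>v. hess g z v w)"
proof -
  have "linear (frechet_derivative (dd g [w]) (at z))"
    using assms by (intro linear_frechet_derivative) (auto simp: twice_differentiable_on_def)
  then show ?thesis by (simp add: hess_def)
qed

text \<open>Linearity in the inner direction is not a statement at \<open>z\<close> alone:
  \<open>dd g [w]\<close> depends linearly on \<open>w\<close> throughout the open set, and
  uniqueness of derivatives carries this over to the derivative at \<open>z\<close>.\<close>

lemma linear_hess_right: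
  assumes "open S" "twice_differentiable_on S g" "z \<in> S"
  shows "linear (hess g z v)"
proof (rule linearI)
  have der: "(dd g [w] has_derivative (\<lambda>v. hess g z v w)) (at z)" for w
  proof -
    have "dd g [w] differentiable (at z)" using assms(2,3) by (auto simp: twice_differentiable_on_def)
    then show ?thesis by (simp add: frechet_derivative_works hess_def)
  qed
  have eqI: "hess g z v w = F v" if "(G has_derivative F) (at z)" "\<And>x. x \<in> S \<Longrightarrow> G x = dd g [w] x" for w F G
  proof -
    have "(dd g [w] has_derivative F) (at z)"
      using that(1) assms(1,3) that(2) by (rule has_derivative_transform_within_open)
    then show ?thesis using has_derivative_unique[OF der] by (simp add: fun_eq_iff)
  qed
  have lin: "linear (\<lambda>w. dd g [w] x)" if "x \<in> S" for x
    using linear_frechet_derivative[of g "at x"] assms(2) that by (auto simp: twice_differentiable_on_def)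
  show "hess g z v (w1 + w2) = hess g z v w1 + hess g z v w2" for w1 w2
    by (rule eqI[OF has_derivative_add[OF der der]]) (simp only: linear_add[OF lin])
  show "hess g z v (c *\<^sub>R w) = c *\<^sub>R hess g z v w" for c w
    by (rule eqI[OF has_derivative_scaleR_right[OF der]]) (simp only: linear_cmul[OF lin])
qed

text \<open>Invariance of the trace under the reflection in the hyperplane orthogonal to
  \<open>n\<close>. Both mixed sums equal the value at \<open>n\<close>, \<open>n\<close>, and the
  coefficients \<open>- 2 - 2 + 4\<close> cancel without symmetry of the Hessian.\<close>

lemma laplacian_reflection:
  fixes g :: "'a::euclidean_space \<Rightarrow> real"
  assumes "open S" "twice_differentiable_on S g" "z \<in> S" "norm n = 1"
  shows "(\<Sum>b\<in>Basis. hess g z (b - (2 * (b \<bullet> n)) *\<^sub>R n) (b - (2 * (b \<bullet> n)) *\<^sub>R n)) = laplacian g z"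
proof -
  let ?H = "hess g z"
  note L = linear_hess_left[OF assms(2,3)] and R = linear_hess_right[OF assms(1-3)]
  have expand: "?H (b - (2 * (b \<bullet> n)) *\<^sub>R n) (b - (2 * (b \<bullet> n)) *\<^sub>R n) =
      ?H b b - 2 * ((b \<bullet> n) * ?H n b) - 2 * ((b \<bullet> n) * ?H b n) + 4 * ((b \<bullet> n)\<^sup>2 * ?H n n)" for b
    by (simp add: linear_diff[OF L] linear_diff[OF R] linear_cmul[OF L] linear_cmul[OF R] algebra_simps power2_eq_square)
  have n: "(\<Sum>b\<in>Basis. (b \<bullet> n) *\<^sub>R b) = n"
    by (simp add: inner_commute[of _ n] euclidean_representation)
  have 1: "(\<Sum>b\<in>Basis. (b \<bullet> n) * ?H n b) = ?H n n"
    using linear_sum[OF R[of n], of "\<lambda>b. (b \<bullet> n) *\<^sub>R b" Basis] by (simp add: n linear_cmul[OF R])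
  have 2: "(\<Sum>b\<in>Basis. (b \<bullet> n) * ?H b n) = ?H n n"
    using linear_sum[OF L[of n], of "\<lambda>b. (b \<bullet> n) *\<^sub>R b" Basis] by (simp add: n linear_cmul[OF L])
  have "n \<bullet> n = 1" using assms(4) by (simp add: norm_eq_1)
  then have 3: "(\<Sum>b\<in>Basis. (b \<bullet> n)\<^sup>2) = 1"
    using euclidean_inner[of n n] by (simp add: power2_eq_square inner_commute)
  have "(\<Sum>b\<in>Basis. ?H (b - (2 * (b \<bullet> n)) *\<^sub>R n) (b - (2 * (b \<bullet> n)) *\<^sub>R n)) =
      laplacian g z - 2 * (\<Sum>b\<in>Basis. (b \<bullet> n) * ?H n b) - 2 * (\<Sum>b\<in>Basis. (b \<bullet> n) * ?H b n)
      + 4 * ((\<Sum>b\<in>Basis. (b \<bullet> n)\<^sup>2) * ?H n n)"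
    unfolding expand laplacian_def sum.distrib sum_subtractf sum_distrib_left sum_distrib_right by simp
  then show ?thesis unfolding 1 2 3 by simp
qed

lemma has_derivative_norm_along_line:
  fixes a v :: "'a::euclidean_space"
  assumes "a \<noteq> 0"
  shows "((\<lambda>t. norm (a + t *\<^sub>R v)) has_real_derivative (a \<bullet> v) / norm a) (at 0)"
proof -
  have eq: "norm (a + t *\<^sub>R v) = sqrt (a \<bullet> a + 2 * t * (a \<bullet> v) + t\<^sup>2 * (v \<bullet> v))" for t
    unfolding norm_eq_sqrt_inner inner_add_left inner_add_right
    by (simp add: inner_commute[of v a] power2_eq_square algebra_simps)
  have "((\<lambda>t. a \<bullet> a + 2 * t * (a \<bullet> v) + t\<^sup>2 * (v \<bullet> v)) has_real_derivative 2 * (a \<bullet> v)) (at 0)"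
    by (auto intro!: derivative_eq_intros)
  moreover have "0 < a \<bullet> a + 2 * 0 * (a \<bullet> v) + 0\<^sup>2 * (v \<bullet> v)" using assms by simp
  ultimately have "((\<lambda>t. sqrt (a \<bullet> a + 2 * t * (a \<bullet> v) + t\<^sup>2 * (v \<bullet> v))) has_real_derivative
      inverse (sqrt (a \<bullet> a + 2 * 0 * (a \<bullet> v) + 0\<^sup>2 * (v \<bullet> v))) / 2 * (2 * (a \<bullet> v))) (at 0)"
    by (intro DERIV_chain2[OF DERIV_real_sqrt])
  moreover have "sqrt (a \<bullet> a + 2 * 0 * (a \<bullet> v) + 0\<^sup>2 * (v \<bullet> v)) = norm a"
    by (subst norm_eq_sqrt_inner) simp
  moreover have "inverse (norm a) / 2 * (2 * (a \<bullet> v)) = (a \<bullet> v) / norm a"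
    using assms by (simp add: field_simps)
  ultimately show ?thesis unfolding eq by (simp only:)
qed

lemma convex_symmetric_segment_mem:
  fixes c n :: "'a::real_vector"
  assumes S: "convex S" and "c + s *\<^sub>R n \<in> S" "c - s *\<^sub>R n \<in> S" "\<bar>\<tau>\<bar> \<le> s"
  shows "c + \<tau> *\<^sub>R n \<in> S"
proof (cases "s = 0")
  case False
  then have s: "s > 0" using assms(4) by linarith
  have "c + \<tau> *\<^sub>R n = ((s + \<tau>) / (2 * s)) *\<^sub>R (c + s *\<^sub>R n) + ((s - \<tau>) / (2 * s)) *\<^sub>R (c - s *\<^sub>R n)"
  proof -
    have "((s + \<tau>) / (2 * s)) *\<^sub>R (c + s *\<^sub>R n) + ((s - \<tau>) / (2 * s)) *\<^sub>R (c - s *\<^sub>R n) =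
      ((s + \<tau>) / (2 * s) + (s - \<tau>) / (2 * s)) *\<^sub>R c + ((s + \<tau>) / (2 * s) * s - (s - \<tau>) / (2 * s) * s) *\<^sub>R n"
      by (simp add: algebra_simps)
    moreover have "(s + \<tau>) / (2 * s) + (s - \<tau>) / (2 * s) = 1" "(s + \<tau>) / (2 * s) * s - (s - \<tau>) / (2 * s) * s = \<tau>"
      using s by (simp_all add: field_simps)
    ultimately show ?thesis by simp
  qed
  also have "\<dots> \<in> S"
    using assms s by (intro convexD[OF S]) (auto simp: field_simps)
  finally show ?thesis .
qed (use assms in auto)

lemma symmetric_sum_deriv:
  fixes g :: "'a::euclidean_space \<Rightarrow> real"
  assumes "\<And>x. x \<in> S \<Longrightarrow> g differentiable (at x)"
    and "c + \<tau> *\<^sub>R n \<in> S" "c - \<tau> *\<^sub>R n \<in> S"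
  shows "((\<lambda>\<tau>. g (c + \<tau> *\<^sub>R n) + g (c - \<tau> *\<^sub>R n)) has_real_derivative
      dd g [n] (c + \<tau> *\<^sub>R n) - dd g [n] (c - \<tau> *\<^sub>R n)) (at \<tau>)"
proof -
  have "((\<lambda>\<tau>. g (c + \<tau> *\<^sub>R n)) has_real_derivative dd g [n] (c + \<tau> *\<^sub>R n)) (at \<tau>)"
    by (intro has_derivative_along_line assms)
  moreover have "((\<lambda>\<tau>. g (c + \<tau> *\<^sub>R (- n))) has_real_derivative dd g [- n] (c + \<tau> *\<^sub>R (- n))) (at \<tau>)"
    by (intro has_derivative_along_line assms(1)) (use assms(3) in simp)
  ultimately have "((\<lambda>\<tau>. g (c + \<tau> *\<^sub>R n) + g (c + \<tau> *\<^sub>R (- n))) has_real_derivative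
      dd g [n] (c + \<tau> *\<^sub>R n) + dd g [- n] (c + \<tau> *\<^sub>R (- n))) (at \<tau>)"
    by (rule DERIV_add)
  then show ?thesis
    using dd_minus_direction[of g "c - \<tau> *\<^sub>R n" n] assms(1)[OF assms(3)] by simp
qed

context positive_eigenfunction
begin

definition f :: "'a \<Rightarrow> real" where "f = (\<lambda>z. - ln (u z))"

lemma f_has_derivative:
  assumes "z \<in> \<Omega>"
  shows "(f has_derivative (\<lambda>v. - (dd u [v] z / u z))) (at z)"
proof -
  have "(u has_derivative frechet_derivative u (at z)) (at z)"
    using u_differentiable[OF assms] by (simp add: frechet_derivative_works)
  from has_derivative_minus[OF has_derivative_ln[OF u_pos[OF assms] this]]
  show ?thesis unfolding f_def by (simp add: divide_inverse mult.commute)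
qed

lemma f_differentiable: "z \<in> \<Omega> \<Longrightarrow> f differentiable (at z)"
  using f_has_derivative unfolding differentiable_def by blast

lemma dd_f: "z \<in> \<Omega> \<Longrightarrow> dd f [v] z = - (dd u [v] z / u z)"
  using fun_cong[OF frechet_derivative_at[OF f_has_derivative], of z v] by simp

lemma f_twice: "twice_differentiable_on \<Omega> f"
  unfolding twice_differentiable_on_def
proof (intro ballI conjI allI)
  fix z v assume z: "z \<in> \<Omega>"
  show "f differentiable (at z)" by (rule f_differentiable[OF z])
  have "dd u [v] differentiable (at z)" using u_twice z by (auto simp: twice_differentiable_on_def)
  then have "(\<lambda>z. - (dd u [v] z / u z)) differentiable (at z)"
    using u_differentiable[OF z] u_pos[OF z] by (intro differentiable_minus differentiable_divide) auto
  then show "dd f [v] differentiable (at z)"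
    unfolding differentiable_def
    using has_derivative_transform_within_open[OF _ open_domain z, of "\<lambda>z. - (dd u [v] z / u z)" _ _ "dd f [v]"] dd_f
    by metis
qed

lemma hess_f:
  assumes z: "z \<in> \<Omega>"
  shows "hess f z v v = - (hess u z v v / u z) + (dd f [v] z)\<^sup>2"
proof -
  note lu = twice_differentiable_along_line[OF open_domain u_twice z, where v = v]
  have u0: "((\<lambda>t. u (z + t *\<^sub>R v)) has_real_derivative dd u [v] z) (at 0)"
    using eventually_nhds_x_imp_x[OF lu(1)] by simp
  have "((\<lambda>t. dd u [v] (z + t *\<^sub>R v) / u (z + t *\<^sub>R v)) has_real_derivative
      (hess u z v v * u (z + 0 *\<^sub>R v) - dd u [v] (z + 0 *\<^sub>R v) * dd u [v] z) / (u (z + 0 *\<^sub>R v) * u (z + 0 *\<^sub>R v))) (at 0)"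
    using u_pos[OF z] by (intro DERIV_divide[OF lu(2) u0]) simp
  then have "((\<lambda>t. - (dd u [v] (z + t *\<^sub>R v) / u (z + t *\<^sub>R v))) has_real_derivative
      - ((hess u z v v * u z - dd u [v] z * dd u [v] z) / (u z * u z))) (at 0)"
    by (intro DERIV_minus) (simp del: dd.simps)
  moreover have ev: "eventually (\<lambda>t. dd f [v] (z + t *\<^sub>R v) = - (dd u [v] (z + t *\<^sub>R v) / u (z + t *\<^sub>R v))) (nhds 0)"
    by (rule eventually_mono[OF eventually_line_in_open[OF open_domain z]]) (rule dd_f)
  ultimately have "((\<lambda>t. dd f [v] (z + t *\<^sub>R v)) has_real_derivative
      - ((hess u z v v * u z - dd u [v] z * dd u [v] z) / (u z * u z))) (at 0)"
    unfolding DERIV_cong_ev[OF refl ev refl] by blast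
  from DERIV_unique[OF twice_differentiable_along_line(2)[OF open_domain f_twice z, where v = v] this]
  have "hess f z v v = - ((hess u z v v * u z - dd u [v] z * dd u [v] z) / (u z * u z))" .
  then show ?thesis using u_pos[OF z] unfolding dd_f[OF z] by (simp add: field_simps power2_eq_square del: dd.simps)
qed

lemma laplacian_f:
  assumes z: "z \<in> \<Omega>"
  shows "laplacian f z = lam - q z + (norm (grad f z))\<^sup>2"
proof -
  have "laplacian f z = - (laplacian u z / u z) + (norm (grad f z))\<^sup>2"
    unfolding laplacian_def hess_f[OF z] power2_norm_grad sum.distrib sum_negf sum_divide_distrib ..
  then show ?thesis using u_eq[OF z] u_pos[OF z] by simp
qed

lemma hess_f_nonneg:
  assumes z: "z \<in> \<Omega>"
  shows "hess f z n n \<ge> 0"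
proof (rule tendsto_lowerbound[OF second_difference_hess[OF open_domain f_twice z]])
  have "eventually (\<lambda>t. z + t *\<^sub>R n \<in> \<Omega> \<and> z + t *\<^sub>R (- n) \<in> \<Omega>) (at_right 0)"
    by (intro eventually_at_right_if_nhds eventually_conj eventually_line_in_open open_domain z)
  then show "\<forall>\<^sub>F t in at_right 0. 0 \<le> (f (z + t *\<^sub>R n) + f (z - t *\<^sub>R n) - 2 * f z) / t\<^sup>2"
  proof eventually_elim
    case (elim t)
    then have mem: "z + t *\<^sub>R n \<in> \<Omega>" "z - t *\<^sub>R n \<in> \<Omega>" by auto
    note pos = u_pos[OF mem(1)] u_pos[OF mem(2)] u_pos[OF z]
    have "ln (u (z + t *\<^sub>R n) * u (z - t *\<^sub>R n)) \<le> ln ((u z)\<^sup>2)"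
      using midpoint_log_concave[OF mem] pos by (subst ln_le_cancel_iff) auto
    then have "ln (u (z + t *\<^sub>R n)) + ln (u (z - t *\<^sub>R n)) \<le> 2 * ln (u z)"
      using pos by (simp add: ln_mult ln_realpow)
    then show ?case by (simp add: f_def)
  qed
qed simp

text \<open>By convexity the directional derivative increases along the line, so the derivative of
  the symmetric sum is nonnegative. This is the half of the bound on the four-point function that
  concerns \<open>f\<close>.\<close>

lemma symmetric_sum_mono:
  assumes "c + s *\<^sub>R n \<in> \<Omega>" "c - s *\<^sub>R n \<in> \<Omega>" "0 \<le> t" "t \<le> s"
  shows "f (c + t *\<^sub>R n) + f (c - t *\<^sub>R n) \<le> f (c + s *\<^sub>R n) + f (c - s *\<^sub>R n)"
proof (rule DERIV_nonneg_imp_nondecreasing[OF assms(4)])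
  fix \<tau> assume \<tau>: "t \<le> \<tau>" "\<tau> \<le> s"
  have mem: "c + \<sigma> *\<^sub>R n \<in> \<Omega>" if "\<bar>\<sigma>\<bar> \<le> s" for \<sigma>
    using convex_symmetric_segment_mem[OF convex_domain assms(1,2) that] .
  have "dd f [n] (c + (- \<tau>) *\<^sub>R n) \<le> dd f [n] (c + \<tau> *\<^sub>R n)"
  proof (rule DERIV_nonneg_imp_nondecreasing[where f = "\<lambda>\<sigma>. dd f [n] (c + \<sigma> *\<^sub>R n)"])
    fix \<sigma> assume "- \<tau> \<le> \<sigma>" "\<sigma> \<le> \<tau>"
    then have m: "c + \<sigma> *\<^sub>R n \<in> \<Omega>" using mem \<tau> by simp
    then have "dd f [n] differentiable (at (c + \<sigma> *\<^sub>R n))" using f_twice by (auto simp: twice_differentiable_on_def)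
    from has_derivative_along_line[OF this] hess_f_nonneg[OF m, of n]
    show "\<exists>y. ((\<lambda>\<sigma>. dd f [n] (c + \<sigma> *\<^sub>R n)) has_real_derivative y) (at \<sigma>) \<and> 0 \<le> y"
      by (auto simp: hess_def)
  qed (use \<tau> assms(3) in simp)
  moreover have "((\<lambda>\<tau>. f (c + \<tau> *\<^sub>R n) + f (c - \<tau> *\<^sub>R n)) has_real_derivative
      dd f [n] (c + \<tau> *\<^sub>R n) - dd f [n] (c - \<tau> *\<^sub>R n)) (at \<tau>)"
    using mem[of \<tau>] mem[of "- \<tau>"] \<tau> assms(3) by (intro symmetric_sum_deriv[OF f_differentiable]) auto
  ultimately show "\<exists>y. ((\<lambda>\<tau>. f (c + \<tau> *\<^sub>R n) + f (c - \<tau> *\<^sub>R n)) has_real_derivative y) (at \<tau>) \<and> 0 \<le> y"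
    by (auto simp del: dd.simps)
qed

end

section \<open>The four-point maximum principle\<close>

text \<open>\<open>strict\<close> is the integrated form, between the levels \<open>t\<close> and
  \<open>s\<close>, of \<open>\<xi> * \<xi>' - \<xi>'' < \<phi>\<close> together with the lower
  bound on \<open>E q\<close>. \<open>R\<close> stands for half the diameter; its bound on the
  closure is needed for limiting configurations, and the strict one keeps the levels below
  \<open>R\<close>, where \<xi> has two-sided derivatives.\<close>

locale four_point = positive_eigenfunction +
  fixes X \<xi> \<xi>' :: "real \<Rightarrow> real" and R \<Lambda> :: real
  assumes R_closure: "\<And>x y. x \<in> closure \<Omega> \<Longrightarrow> y \<in> closure \<Omega> \<Longrightarrow> norm (x - y) \<le> 2 * R"
    and R_domain: "\<And>x y. x \<in> \<Omega> \<Longrightarrow> y \<in> \<Omega> \<Longrightarrow> norm (x - y) < 2 * R"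
    and X_deriv: "\<And>\<sigma>. \<sigma> \<in> {0..R} \<Longrightarrow> (X has_real_derivative \<xi> \<sigma>) (at \<sigma> within {0..R})"
    and \<xi>_deriv: "\<And>\<sigma>. 0 < \<sigma> \<Longrightarrow> \<sigma> < R \<Longrightarrow> (\<xi> has_real_derivative \<xi>' \<sigma>) (at \<sigma>)"
    and \<xi>_0: "\<xi> 0 < 0"
    and \<xi>_le: "\<And>\<sigma>. \<sigma> \<in> {0..R} \<Longrightarrow> \<xi> \<sigma> \<le> \<Lambda>"
    and \<Lambda>_pos: "\<Lambda> > 0"
    and strict: "\<And>c n s t. norm n = 1 \<Longrightarrow> 0 < t \<Longrightarrow> t < s \<Longrightarrow> c + s *\<^sub>R n \<in> \<Omega> \<Longrightarrow> c - s *\<^sub>R n \<in> \<Omega> \<Longrightarrow>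
      ((\<xi> s)\<^sup>2 - (\<xi> t)\<^sup>2) / 2 - (\<xi>' s - \<xi>' t) <
        q (c + s *\<^sub>R n) + q (c - s *\<^sub>R n) - q (c + t *\<^sub>R n) - q (c - t *\<^sub>R n)"
begin

text \<open>The coordinates are \<open>a = s n\<close> and \<open>\<kappa> = t / s\<close>. They
  replace the unit vector and the two levels by a free vector and a number in a fixed interval, so
  that \<open>a\<close> can be varied linearly.\<close>

definition \<Phi> :: "'a \<Rightarrow> 'a \<Rightarrow> real \<Rightarrow> real" where
  "\<Phi> c a \<kappa> = X (norm a) - X (\<kappa> * norm a)
     - f (c + a) - f (c - a) + f (c + \<kappa> *\<^sub>R a) + f (c - \<kappa> *\<^sub>R a)"

lemma X_deriv_at: "0 < \<sigma> \<Longrightarrow> \<sigma> < R \<Longrightarrow> (X has_real_derivative \<xi> \<sigma>) (at \<sigma>)"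
  using X_deriv[of \<sigma>] by (simp add: at_within_Icc_at)

lemma inner_mem:
  assumes "c + a \<in> \<Omega>" "c - a \<in> \<Omega>" "0 \<le> \<kappa>" "\<kappa> \<le> 1"
  shows "c + \<kappa> *\<^sub>R a \<in> \<Omega>" "c - \<kappa> *\<^sub>R a \<in> \<Omega>"
  using convex_symmetric_segment_mem[OF convex_domain, of c 1 a \<kappa>] convex_symmetric_segment_mem[OF convex_domain, of c 1 a "- \<kappa>"] assms by auto

lemma norm_lt_R:
  assumes "c + a \<in> \<Omega>" "c - a \<in> \<Omega>"
  shows "norm a < R"
proof -
  have "c + a - (c - a) = 2 *\<^sub>R a" by (simp add: scaleR_2)
  then have "norm (c + a - (c - a)) = 2 * norm a" by simp
  then show ?thesis using R_domain[OF assms] by simp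
qed

lemma no_interior_maximum:
  assumes mem: "c + a \<in> \<Omega>" "c - a \<in> \<Omega>" and a: "a \<noteq> 0" and \<kappa>: "0 \<le> \<kappa>" "\<kappa> < 1"
    and max: "\<And>c' a' \<kappa>'. c' + a' \<in> \<Omega> \<Longrightarrow> c' - a' \<in> \<Omega> \<Longrightarrow> 0 \<le> \<kappa>' \<Longrightarrow> \<kappa>' \<le> 1 \<Longrightarrow> \<Phi> c' a' \<kappa>' \<le> \<Phi> c a \<kappa>"
  shows False
proof -
  define s where "s = norm a"
  define n where "n = a /\<^sub>R s"
  have s: "s > 0" "s < R" using a norm_lt_R[OF mem] by (simp_all add: s_def)
  have n1: "norm n = 1" using s by (simp add: n_def s_def)
  have an: "a = s *\<^sub>R n" using s by (simp add: n_def)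
  \<comment> \<open>At \<kappa> \<open>= 0\<close> the symmetric sum of \<open>f\<close> has
    derivative zero, so the one-sided derivative of \<Phi> in \<kappa> is
    \<open>- \<xi> 0 * s > 0\<close> and a small positive \<kappa> does better.\<close>
  have \<kappa>pos: "\<kappa> > 0"
  proof (rule ccontr)
    assume "\<not> \<kappa> > 0"
    then have \<kappa>0: "\<kappa> = 0" using \<kappa> by simp
    have c: "c \<in> \<Omega>" using inner_mem(1)[OF mem, of 0] by simp
    have img: "(\<lambda>\<tau>. \<tau> * s) ` {0..1} \<subseteq> {0..R}"
    proof (rule image_subsetI)
      fix \<tau> :: real assume "\<tau> \<in> {0..1}"
      then have "0 \<le> \<tau> * s" "\<tau> * s \<le> 1 * s" using s by (auto intro!: mult_right_mono)
      then show "\<tau> * s \<in> {0..R}" using s(2) unfolding atLeastAtMost_iff by linarith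
    qed
    have "((\<lambda>\<tau>. \<tau> * s) has_real_derivative s) (at 0 within {0..1})"
      by (auto intro!: derivative_eq_intros)
    moreover have "(X has_real_derivative \<xi> 0) (at (0 * s) within (\<lambda>\<tau>. \<tau> * s) ` {0..1})"
      using X_deriv[of 0] s by (auto intro: DERIV_subset[OF _ img])
    ultimately have dX: "((\<lambda>\<tau>. X (\<tau> * s)) has_real_derivative \<xi> 0 * s) (at 0 within {0..1})"
      using DERIV_image_chain[of X "\<xi> 0" "\<lambda>\<tau>. \<tau> * s" 0 "{0..1}" s] by (simp add: o_def)
    have dF: "((\<lambda>\<tau>. f (c + \<tau> *\<^sub>R a) + f (c - \<tau> *\<^sub>R a)) has_real_derivative 0) (at 0 within {0..1})"
      using symmetric_sum_deriv[where S = \<Omega> and g = f and c = c and \<tau> = 0 and n = a, OF f_differentiable] c by (simp add: has_field_derivative_at_within)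
    have "((\<lambda>\<tau>. \<Phi> c a \<tau>) has_real_derivative 0 - \<xi> 0 * s - 0 - 0 + 0) (at 0 within {0..1})"
      unfolding \<Phi>_def s_def[symmetric] add.assoc
      by (intro DERIV_add DERIV_diff DERIV_const dX dF)
    moreover have "0 < 0 - \<xi> 0 * s - 0 - 0 + 0" using \<xi>_0 s by (simp add: mult_neg_pos)
    ultimately obtain d where d: "d > 0" "\<forall>h>0. 0 + h \<in> {0..1} \<longrightarrow> h < d \<longrightarrow> \<Phi> c a 0 < \<Phi> c a (0 + h)"
      using has_real_derivative_pos_inc_right by blast
    define h where "h = min 1 (d / 2)"
    have h: "0 < h" "h \<le> 1" "h < d" using d(1) by (auto simp: h_def)
    then have "\<Phi> c a 0 < \<Phi> c a h" using d(2)[rule_format, of h] by simp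
    moreover have "\<Phi> c a h \<le> \<Phi> c a 0" using max[OF mem, of h] h \<kappa>0 by simp
    ultimately show False by simp
  qed
  define t where "t = \<kappa> * s"
  have "\<kappa> * s < 1 * s" using \<kappa>(2) s by (intro mult_strict_right_mono) auto
  moreover have "0 < \<kappa> * s" using \<kappa>pos s by simp
  ultimately have t: "0 < t" "t < s" "t < R" unfolding t_def using s(2) by linarith+
  define y x z w where "y = c + a" and "x = c - a" and "z = c + \<kappa> *\<^sub>R a" and "w = c - \<kappa> *\<^sub>R a"
  have pts: "y \<in> \<Omega>" "x \<in> \<Omega>" "z \<in> \<Omega>" "w \<in> \<Omega>"
    using mem inner_mem[OF mem \<kappa>(1)] \<kappa>(2) by (simp_all add: y_def x_def z_def w_def)
  define py px pz pw where "py = grad f y" and "px = grad f x" and "pz = grad f z" and "pw = grad f w"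
  have f_line: "((\<lambda>\<tau>. f (p + \<tau> *\<^sub>R v)) has_real_derivative v \<bullet> grad f p) (at 0)" if "p \<in> \<Omega>" for p v
    using has_derivative_along_line[of f p 0 v] f_differentiable[OF that] dd_eq_inner_grad[of f p v] by simp
  note fy = f_line[OF pts(1), folded py_def] and fx = f_line[OF pts(2), folded px_def]
    and fz = f_line[OF pts(3), folded pz_def] and fw = f_line[OF pts(4), folded pw_def]
  have local_max: "l = 0"
    if der: "(g has_real_derivative l) (at 0)" and loc: "eventually (\<lambda>\<tau>. g \<tau> \<le> g 0) (nhds 0)" for g :: "real \<Rightarrow> real" and l
  proof -
    obtain d where "d > 0" "\<And>\<tau>. \<bar>\<tau>\<bar> < d \<Longrightarrow> g \<tau> \<le> g 0"
      using loc unfolding eventually_nhds_metric by (auto simp: dist_real_def)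
    then show ?thesis by (intro DERIV_local_max[OF der]) auto
  qed
  have ev_line: "eventually (\<lambda>\<tau>. p + \<tau> *\<^sub>R v \<in> \<Omega>) (nhds 0)" if "p \<in> \<Omega>" for p v
    by (rule eventually_line_in_open[OF open_domain that])
  have \<Phi>0: "\<Phi> c a \<kappa> = X s - X t - f y - f x + f z + f w"
    by (simp add: \<Phi>_def s_def t_def y_def x_def z_def w_def)
  \<comment> \<open>Translation of all four points by the same vector.\<close>
  have eq1: "py + px = pz + pw"
  proof (rule vector_eq_ldot[THEN iffD1], rule allI)
    fix v
    have "((\<lambda>\<tau>. X s - X t - f (y + \<tau> *\<^sub>R v) - f (x + \<tau> *\<^sub>R v) + f (z + \<tau> *\<^sub>R v) + f (w + \<tau> *\<^sub>R v))
       has_real_derivative 0 - v \<bullet> py - v \<bullet> px + v \<bullet> pz + v \<bullet> pw) (at 0)"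
      by (intro DERIV_add DERIV_diff DERIV_const fy fx fz fw)
    moreover have "eventually (\<lambda>\<tau>. X s - X t - f (y + \<tau> *\<^sub>R v) - f (x + \<tau> *\<^sub>R v) + f (z + \<tau> *\<^sub>R v) + f (w + \<tau> *\<^sub>R v)
        \<le> X s - X t - f (y + 0 *\<^sub>R v) - f (x + 0 *\<^sub>R v) + f (z + 0 *\<^sub>R v) + f (w + 0 *\<^sub>R v)) (nhds 0)"
      using ev_line[OF pts(1), of v] ev_line[OF pts(2), of v]
    proof eventually_elim
      case (elim \<tau>)
      have "\<Phi> (c + \<tau> *\<^sub>R v) a \<kappa> \<le> \<Phi> c a \<kappa>"
        using elim \<kappa> by (intro max) (auto simp: y_def x_def algebra_simps)
      then show ?case unfolding \<Phi>0
        by (simp add: \<Phi>_def s_def t_def y_def x_def z_def w_def algebra_simps)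
    qed
    ultimately have "0 - v \<bullet> py - v \<bullet> px + v \<bullet> pz + v \<bullet> pw = 0" by (rule local_max)
    then show "v \<bullet> (py + px) = v \<bullet> (pz + pw)" by (simp add: inner_add_right)
  qed
  \<comment> \<open>Variation of \<open>a\<close> alone: the outer points move by \<open>v\<close>
    and \<open>- v\<close>, the inner ones by \<kappa> times these.\<close>
  have eq2: "py - px = \<kappa> *\<^sub>R (pz - pw) + (\<xi> s - \<kappa> * \<xi> t) *\<^sub>R n"
  proof (rule vector_eq_ldot[THEN iffD1], rule allI)
    fix v
    have dn: "((\<lambda>\<tau>. norm (a + \<tau> *\<^sub>R v)) has_real_derivative n \<bullet> v) (at 0)"
      using has_derivative_norm_along_line[OF a, of v] by (simp add: n_def s_def divide_inverse mult.commute)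
    have dX1: "((\<lambda>\<tau>. X (norm (a + \<tau> *\<^sub>R v))) has_real_derivative \<xi> s * (n \<bullet> v)) (at 0)"
      by (rule DERIV_chain2[OF _ dn]) (use X_deriv_at[OF s] in \<open>simp add: s_def\<close>)
    have dX2: "((\<lambda>\<tau>. X (\<kappa> * norm (a + \<tau> *\<^sub>R v))) has_real_derivative \<xi> t * (\<kappa> * (n \<bullet> v))) (at 0)"
      by (rule DERIV_chain2[OF _ DERIV_cmult[OF dn]]) (use X_deriv_at[OF t(1,3)] in \<open>simp add: s_def t_def\<close>)
    have "((\<lambda>\<tau>. X (norm (a + \<tau> *\<^sub>R v)) - X (\<kappa> * norm (a + \<tau> *\<^sub>R v))
        - f (y + \<tau> *\<^sub>R v) - f (x + \<tau> *\<^sub>R (- v)) + f (z + \<tau> *\<^sub>R (\<kappa> *\<^sub>R v)) + f (w + \<tau> *\<^sub>R (- (\<kappa> *\<^sub>R v))))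
       has_real_derivative \<xi> s * (n \<bullet> v) - \<xi> t * (\<kappa> * (n \<bullet> v)) - v \<bullet> py - (- v) \<bullet> px + (\<kappa> *\<^sub>R v) \<bullet> pz + (- (\<kappa> *\<^sub>R v)) \<bullet> pw) (at 0)"
      by (intro DERIV_add DERIV_diff dX1 dX2 fy fx fz fw)
    moreover have "eventually (\<lambda>\<tau>. X (norm (a + \<tau> *\<^sub>R v)) - X (\<kappa> * norm (a + \<tau> *\<^sub>R v))
        - f (y + \<tau> *\<^sub>R v) - f (x + \<tau> *\<^sub>R (- v)) + f (z + \<tau> *\<^sub>R (\<kappa> *\<^sub>R v)) + f (w + \<tau> *\<^sub>R (- (\<kappa> *\<^sub>R v)))
        \<le> X (norm (a + 0 *\<^sub>R v)) - X (\<kappa> * norm (a + 0 *\<^sub>R v))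
        - f (y + 0 *\<^sub>R v) - f (x + 0 *\<^sub>R (- v)) + f (z + 0 *\<^sub>R (\<kappa> *\<^sub>R v)) + f (w + 0 *\<^sub>R (- (\<kappa> *\<^sub>R v)))) (nhds 0)"
      using ev_line[OF pts(1), of v] ev_line[OF pts(2), of "- v"]
    proof eventually_elim
      case (elim \<tau>)
      have "\<Phi> c (a + \<tau> *\<^sub>R v) \<kappa> \<le> \<Phi> c a \<kappa>"
        using elim \<kappa> by (intro max) (auto simp: y_def x_def algebra_simps)
      then show ?case
        by (simp add: \<Phi>_def y_def x_def z_def w_def algebra_simps)
    qed
    ultimately have "\<xi> s * (n \<bullet> v) - \<xi> t * (\<kappa> * (n \<bullet> v)) - v \<bullet> py - (- v) \<bullet> px + (\<kappa> *\<^sub>R v) \<bullet> pz + (- (\<kappa> *\<^sub>R v)) \<bullet> pw = 0"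
      by (rule local_max)
    then show "v \<bullet> (py - px) = v \<bullet> (\<kappa> *\<^sub>R (pz - pw) + (\<xi> s - \<kappa> * \<xi> t) *\<^sub>R n)"
      by (simp add: inner_add_right inner_diff_right inner_commute[of n v] algebra_simps)
  qed
  \<comment> \<open>Variation of \<kappa> alone: only the inner pair moves, along the line.\<close>
  have eq3: "n \<bullet> (pz - pw) = \<xi> t"
  proof -
    have dX: "((\<lambda>\<tau>. X ((\<kappa> + \<tau>) * s)) has_real_derivative \<xi> t * s) (at 0)"
    proof (rule DERIV_chain2[where f = X and g = "\<lambda>\<tau>. (\<kappa> + \<tau>) * s"])
      show "(X has_real_derivative \<xi> t) (at ((\<kappa> + 0) * s))" using X_deriv_at[OF t(1,3)] by (simp add: t_def)
      show "((\<lambda>\<tau>. (\<kappa> + \<tau>) * s) has_real_derivative s) (at 0)" by (auto intro!: derivative_eq_intros)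
    qed
    have "((\<lambda>\<tau>. X s - X ((\<kappa> + \<tau>) * s) - f y - f x + f (z + \<tau> *\<^sub>R a) + f (w + \<tau> *\<^sub>R (- a)))
       has_real_derivative 0 - \<xi> t * s - 0 - 0 + a \<bullet> pz + (- a) \<bullet> pw) (at 0)"
      by (intro DERIV_add DERIV_diff DERIV_const dX fz fw)
    moreover have "eventually (\<lambda>\<tau>. X s - X ((\<kappa> + \<tau>) * s) - f y - f x + f (z + \<tau> *\<^sub>R a) + f (w + \<tau> *\<^sub>R (- a))
        \<le> X s - X ((\<kappa> + 0) * s) - f y - f x + f (z + 0 *\<^sub>R a) + f (w + 0 *\<^sub>R (- a))) (nhds 0)"
    proof -
      have "eventually (\<lambda>\<tau>. \<tau> \<in> {- \<kappa><..<1 - \<kappa>}) (nhds 0)"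
        using \<kappa>pos \<kappa>(2) by (intro eventually_nhds_in_open) auto
      then show ?thesis
      proof eventually_elim
        case (elim \<tau>)
        have "\<Phi> c a (\<kappa> + \<tau>) \<le> \<Phi> c a \<kappa>"
          using elim mem by (intro max) auto
        then show ?case
          by (simp add: \<Phi>_def s_def y_def x_def z_def w_def algebra_simps)
      qed
    qed
    ultimately have "0 - \<xi> t * s - 0 - 0 + a \<bullet> pz + (- a) \<bullet> pw = 0" by (rule local_max)
    then have "a \<bullet> (pz - pw) = s * \<xi> t" by (simp add: inner_diff_right mult.commute)
    then have "s * (n \<bullet> (pz - pw)) = s * \<xi> t" unfolding an by simp
    then show ?thesis using s by simp
  qed
  \<comment> \<open>The sums of gradients agree by \<open>eq1\<close>, so by the parallelogram law
    only the differences matter. Along \<open>n\<close> these are \<open>\<xi> s\<close> and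
    \<open>\<xi> t\<close>; orthogonally to \<open>n\<close> the outer difference is \<kappa> times
    the inner one, which has the favourable sign since \<kappa> \<open>< 1\<close>.\<close>
  have sq: "(norm py)\<^sup>2 + (norm px)\<^sup>2 - (norm pz)\<^sup>2 - (norm pw)\<^sup>2 \<le> ((\<xi> s)\<^sup>2 - (\<xi> t)\<^sup>2) / 2"
  proof -
    define e where "e = (pz - pw) - \<xi> t *\<^sub>R n"
    have nn: "n \<bullet> n = 1" using n1 by (simp add: norm_eq_1)
    have "n \<bullet> e = n \<bullet> (pz - pw) - \<xi> t * (n \<bullet> n)" by (simp add: e_def inner_diff_right)
    then have ne: "n \<bullet> e = 0" unfolding eq3 nn by simp
    have dt: "pz - pw = e + \<xi> t *\<^sub>R n" by (simp add: e_def)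
    have ds: "py - px = \<kappa> *\<^sub>R e + \<xi> s *\<^sub>R n" unfolding eq2 dt by (simp add: algebra_simps)
    have pyth: "(norm (k *\<^sub>R e + l *\<^sub>R n))\<^sup>2 = k\<^sup>2 * (norm e)\<^sup>2 + l\<^sup>2" for k l
      unfolding power2_norm_eq_inner inner_add_left inner_add_right
      using ne nn by (simp add: inner_commute[of e n] power2_eq_square)
    have para: "(norm p)\<^sup>2 + (norm p')\<^sup>2 = ((norm (p + p'))\<^sup>2 + (norm (p - p'))\<^sup>2) / 2" for p p' :: 'a
      by (simp add: power2_norm_eq_inner inner_add_left inner_add_right inner_diff_left inner_diff_right inner_commute)
    have "(norm py)\<^sup>2 + (norm px)\<^sup>2 - ((norm pz)\<^sup>2 + (norm pw)\<^sup>2) = ((norm (py - px))\<^sup>2 - (norm (pz - pw))\<^sup>2) / 2"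
      unfolding para[of py px] para[of pz pw] eq1 by (simp add: diff_divide_distrib add_divide_distrib)
    also have "\<dots> = ((\<kappa>\<^sup>2 * (norm e)\<^sup>2 + (\<xi> s)\<^sup>2) - ((norm e)\<^sup>2 + (\<xi> t)\<^sup>2)) / 2"
      unfolding ds dt using pyth[of \<kappa> "\<xi> s"] pyth[of 1 "\<xi> t"] by simp
    also have "\<dots> \<le> ((\<xi> s)\<^sup>2 - (\<xi> t)\<^sup>2) / 2"
    proof -
      have "\<kappa>\<^sup>2 \<le> 1" using \<kappa> by (simp add: power_le_one)
      then have "\<kappa>\<^sup>2 * (norm e)\<^sup>2 \<le> 1 * (norm e)\<^sup>2" by (intro mult_right_mono) auto
      then show ?thesis by simp
    qed
    finally show ?thesis by simp
  qed
  let ?R = "\<lambda>b. b - (2 * (b \<bullet> n)) *\<^sub>R n"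
  \<comment> \<open>Moving \<open>y\<close>, \<open>z\<close> by \<open>b\<close> and
    \<open>x\<close>, \<open>w\<close> by its reflection keeps all four points on a line of
    direction \<open>n\<close>: the centre moves orthogonally to \<open>n\<close>, and both levels
    change by the same linear term. The norm inside \<open>X\<close> therefore contributes no
    curvature of its own.\<close>
  have second: "(b \<bullet> n)\<^sup>2 * (\<xi>' s - \<xi>' t) - hess f y b b - hess f x (?R b) (?R b) + hess f z b b + hess f w (?R b) (?R b) \<le> 0" for b
  proof -
    define \<beta> where "\<beta> = b \<bullet> n"
    let ?g = "\<lambda>\<tau>. X (s + \<tau> * \<beta>) - X (t + \<tau> * \<beta>) - f (y + \<tau> *\<^sub>R b) - f (x + \<tau> *\<^sub>R ?R b) + f (z + \<tau> *\<^sub>R b) + f (w + \<tau> *\<^sub>R ?R b)"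
    let ?g' = "\<lambda>\<tau>. \<xi> (s + \<tau> * \<beta>) * \<beta> - \<xi> (t + \<tau> * \<beta>) * \<beta> - dd f [b] (y + \<tau> *\<^sub>R b) - dd f [?R b] (x + \<tau> *\<^sub>R ?R b)
        + dd f [b] (z + \<tau> *\<^sub>R b) + dd f [?R b] (w + \<tau> *\<^sub>R ?R b)"
    note line = twice_differentiable_along_line[OF open_domain f_twice]
    have lin: "((\<lambda>\<tau>. k + \<tau> * \<beta>) has_real_derivative \<beta>) (at \<tau>)" for k \<tau>
      by (auto intro!: derivative_eq_intros)
    have near: "eventually (\<lambda>\<tau>. 0 < k + \<tau> * \<beta> \<and> k + \<tau> * \<beta> < R) (nhds 0)" if "0 < k" "k < R" for k
      using eventually_line_in_open[of "{0<..<R}" k \<beta>] that by simp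
    have X_ev: "eventually (\<lambda>\<tau>. ((\<lambda>\<tau>. X (k + \<tau> * \<beta>)) has_real_derivative \<xi> (k + \<tau> * \<beta>) * \<beta>) (at \<tau>)) (nhds 0)"
      if "0 < k" "k < R" for k
      by (rule eventually_mono[OF near[OF that]]) (intro DERIV_chain2[OF X_deriv_at lin]; simp)
    have \<xi>0: "((\<lambda>\<tau>. \<xi> (k + \<tau> * \<beta>) * \<beta>) has_real_derivative \<xi>' k * \<beta> * \<beta>) (at 0)" if "0 < k" "k < R" for k
      by (intro DERIV_cmult_right DERIV_chain2[OF _ lin]) (use \<xi>_deriv[OF that] in simp)
    have "\<xi>' s * \<beta> * \<beta> - \<xi>' t * \<beta> * \<beta> - hess f y b b - hess f x (?R b) (?R b) + hess f z b b + hess f w (?R b) (?R b) \<le> 0"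
    proof (rule second_derivative_nonpos_at_max[where g = ?g and g' = ?g'])
      show "eventually (\<lambda>\<tau>. (?g has_real_derivative ?g' \<tau>) (at \<tau>)) (nhds 0)"
        using X_ev[OF s] X_ev[OF t(1,3)] line(1)[OF pts(1), where v = b] line(1)[OF pts(2), where v = "?R b"]
          line(1)[OF pts(3), where v = b] line(1)[OF pts(4), where v = "?R b"]
        by eventually_elim (intro DERIV_add DERIV_diff)
      show "(?g' has_real_derivative \<xi>' s * \<beta> * \<beta> - \<xi>' t * \<beta> * \<beta> - hess f y b b - hess f x (?R b) (?R b) + hess f z b b + hess f w (?R b) (?R b)) (at 0)"
        by (intro DERIV_add DERIV_diff \<xi>0 s t line(2) pts)
      have st: "eventually (\<lambda>\<tau>. 0 < t + \<tau> * \<beta>) (nhds 0)"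
        by (rule eventually_mono[OF near[OF t(1,3)]]) simp
      show "eventually (\<lambda>\<tau>. ?g \<tau> \<le> ?g 0) (nhds 0)"
        using st ev_line[OF pts(1), of b] ev_line[OF pts(2), of "?R b"]
      proof eventually_elim
        case (elim \<tau>)
        let ?c = "c + \<tau> *\<^sub>R (b - \<beta> *\<^sub>R n)" and ?s = "s + \<tau> * \<beta>" and ?t = "t + \<tau> * \<beta>"
        let ?a = "?s *\<^sub>R n" and ?\<kappa> = "?t / ?s"
        have pos: "?s > 0" "?t > 0" "?t \<le> ?s" using elim(1) t by linarith+
        have na: "norm ?a = ?s" using n1 pos by simp
        have \<kappa>a: "?\<kappa> *\<^sub>R ?a = ?t *\<^sub>R n" "?\<kappa> * ?s = ?t" using pos by simp_all
        define m where "m = (\<tau> * \<beta>) *\<^sub>R n"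
        have m: "\<tau> *\<^sub>R (b - \<beta> *\<^sub>R n) = \<tau> *\<^sub>R b - m" "(k + \<tau> * \<beta>) *\<^sub>R n = k *\<^sub>R n + m"
          "\<tau> *\<^sub>R ?R b = \<tau> *\<^sub>R b - (m + m)" for k
          by (simp_all add: m_def \<beta>_def scaleR_diff_right scaleR_left_distrib[symmetric] mult.left_commute)
        have p1: "?c + ?a = y + \<tau> *\<^sub>R b" "?c - ?a = x + \<tau> *\<^sub>R ?R b"
          unfolding m y_def x_def an by simp_all
        have p2: "?c + ?t *\<^sub>R n = z + \<tau> *\<^sub>R b" "?c - ?t *\<^sub>R n = w + \<tau> *\<^sub>R ?R b"
          unfolding m z_def w_def an t_def by simp_all
        have "\<Phi> ?c ?a ?\<kappa> \<le> \<Phi> c a \<kappa>"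
          using elim pos by (intro max) (simp_all only: p1, simp_all add: divide_le_eq_1)
        then have "X ?s - X ?t - f (y + \<tau> *\<^sub>R b) - f (x + \<tau> *\<^sub>R ?R b) + f (z + \<tau> *\<^sub>R b) + f (w + \<tau> *\<^sub>R ?R b)
            \<le> X s - X t - f y - f x + f z + f w"
          unfolding \<Phi>0 unfolding \<Phi>_def na \<kappa>a p1 p2 .
        then show ?case by simp
      qed
    qed
    then show ?thesis by (simp add: \<beta>_def power2_eq_square algebra_simps)
  qed
  have "(\<Sum>b\<in>Basis. (b \<bullet> n)\<^sup>2 * (\<xi>' s - \<xi>' t) - hess f y b b - hess f x (?R b) (?R b) + hess f z b b + hess f w (?R b) (?R b)) \<le> 0"
    by (intro sum_nonpos second)
  then have "(\<Sum>b\<in>Basis. (b \<bullet> n)\<^sup>2) * (\<xi>' s - \<xi>' t) - laplacian f y - laplacian f x + laplacian f z + laplacian f w \<le> 0"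
    unfolding sum.distrib sum_subtractf sum_distrib_right[symmetric]
      laplacian_reflection[OF open_domain f_twice pts(2) n1] laplacian_reflection[OF open_domain f_twice pts(4) n1]
    by (simp add: laplacian_def)
  moreover have "(\<Sum>b\<in>Basis. (b \<bullet> n)\<^sup>2) = 1"
  proof -
    have "n \<bullet> n = 1" using n1 by (simp add: norm_eq_1)
    then show ?thesis using euclidean_inner[of n n] by (simp add: power2_eq_square inner_commute)
  qed
  ultimately have "(\<xi>' s - \<xi>' t) - laplacian f y - laplacian f x + laplacian f z + laplacian f w \<le> 0" by simp
  then have "(\<xi>' s - \<xi>' t) + (q y + q x - q z - q w) - ((norm py)\<^sup>2 + (norm px)\<^sup>2 - (norm pz)\<^sup>2 - (norm pw)\<^sup>2) \<le> 0"
    unfolding laplacian_f[OF pts(1)] laplacian_f[OF pts(2)] laplacian_f[OF pts(3)] laplacian_f[OF pts(4)]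
      py_def px_def pz_def pw_def by simp
  moreover have "((\<xi> s)\<^sup>2 - (\<xi> t)\<^sup>2) / 2 - (\<xi>' s - \<xi>' t) < q y + q x - q z - q w"
  proof -
    have *: "y = c + s *\<^sub>R n" "x = c - s *\<^sub>R n" "z = c + t *\<^sub>R n" "w = c - t *\<^sub>R n"
      by (simp_all add: y_def x_def z_def w_def t_def an)
    show ?thesis using strict[OF n1 t(1,2), of c] pts(1,2) unfolding * by blast
  qed
  ultimately show False using sq by linarith
qed

lemma X_cont: "continuous_on {0..R} X"
  by (rule DERIV_continuous_on[OF X_deriv])

lemma X_lipschitz:
  assumes "0 \<le> t" "t \<le> s" "s \<le> R"
  shows "X s - X t \<le> \<Lambda> * (s - t)"
proof (cases "t = s")
  case False
  then have ts: "t < s" using assms by simp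
  have "\<exists>l z. t < z \<and> z < s \<and> (X has_real_derivative l) (at z) \<and> X s - X t = (s - t) * l"
  proof (rule MVT[OF ts])
    show "continuous_on {t..s} X" using assms by (intro continuous_on_subset[OF X_cont]) auto
    show "X differentiable (at z)" if "t < z" "z < s" for z
      using X_deriv_at[of z] that assms unfolding real_differentiable_def by force
  qed
  then obtain l z where z: "t < z" "z < s" "(X has_real_derivative l) (at z)" "X s - X t = (s - t) * l" by blast
  have "(X has_real_derivative \<xi> z) (at z)" using z assms by (intro X_deriv_at) auto
  then have "l = \<xi> z" using z(3) DERIV_unique by blast
  then have "l \<le> \<Lambda>" using \<xi>_le[of z] z assms by simp
  then have "(s - t) * l \<le> (s - t) * \<Lambda>" using ts by (intro mult_left_mono) auto
  then show ?thesis using z(4) by (simp add: mult.commute)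
qed simp

text \<open>Consequently a positive lower bound for \<Phi> keeps
  \<open>(1 - \<kappa>) * norm a\<close> away from zero, which excludes both coinciding levels and
  coinciding points.\<close>

lemma \<Phi>_le:
  assumes "c + a \<in> \<Omega>" "c - a \<in> \<Omega>" "0 \<le> \<kappa>" "\<kappa> \<le> 1"
  shows "\<Phi> c a \<kappa> \<le> \<Lambda> * ((1 - \<kappa>) * norm a)"
proof -
  have "\<kappa> * norm a \<le> 1 * norm a" using assms by (intro mult_right_mono) auto
  then have "X (norm a) - X (\<kappa> * norm a) \<le> \<Lambda> * (norm a - \<kappa> * norm a)"
    using assms norm_lt_R[OF assms(1,2)] by (intro X_lipschitz) auto
  moreover have "f (c + \<kappa> *\<^sub>R a) + f (c - \<kappa> *\<^sub>R a) \<le> f (c + 1 *\<^sub>R a) + f (c - 1 *\<^sub>R a)"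
    using assms by (intro symmetric_sum_mono) auto
  ultimately show ?thesis by (simp add: \<Phi>_def algebra_simps)
qed

text \<open>A maximum must be produced although \<open>f\<close> is infinite on the boundary. The
  exponential of \<Phi> extends continuously to limiting configurations: the inner points stay in
  the domain by strict convexity, so the denominators are positive, and the outer points enter
  through factors \<open>u\<close> that vanish on the frontier. A positive maximal value then forces
  the outer points inside.\<close>

lemma \<Phi>_nonpos:
  assumes mem: "c0 + a0 \<in> \<Omega>" "c0 - a0 \<in> \<Omega>" and \<kappa>0: "0 \<le> \<kappa>0" "\<kappa>0 \<le> 1"
  shows "\<Phi> c0 a0 \<kappa>0 \<le> 0"
proof (rule ccontr)
  define \<eta> where "\<eta> = \<Phi> c0 a0 \<kappa>0"
  assume "\<not> ?thesis"
  then have \<eta>: "\<eta> > 0" by (simp add: \<eta>_def)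
  \<comment> \<open>Chosen so that \<open>\<Phi>_le\<close> puts every configuration with \<Phi>
    \<open>> \<eta> / 2\<close> into the compact set \<open>T\<close>; a maximum over
    \<open>T\<close> is then one over all configurations.\<close>
  define \<delta> where "\<delta> = \<eta> / (2 * \<Lambda>)"
  have \<delta>: "\<delta> > 0" "\<Lambda> * \<delta> = \<eta> / 2" using \<eta> \<Lambda>_pos by (simp_all add: \<delta>_def)
  obtain B where B: "\<And>z. z \<in> closure \<Omega> \<Longrightarrow> norm z \<le> B"
    using bounded_closure[OF bounded_domain] unfolding bounded_iff by blast
  define T :: "('a \<times> 'a \<times> real) set" where "T = (cball 0 B \<times> cball 0 B \<times> {0..1}) \<inter>
     ((\<lambda>p. fst p + fst (snd p)) -` closure \<Omega> \<inter> (\<lambda>p. fst p - fst (snd p)) -` closure \<Omega> \<inter>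
      {p. \<delta> \<le> (1 - snd (snd p)) * norm (fst (snd p))})"
  have "compact T" unfolding T_def
    by (intro compact_Int_closed compact_Times compact_cball compact_Icc closed_Int closed_vimage
        closed_closure closed_Collect_le continuous_intros)
  have T_iff: "(c, a, \<kappa>) \<in> T \<longleftrightarrow> c + a \<in> closure \<Omega> \<and> c - a \<in> closure \<Omega> \<and> 0 \<le> \<kappa> \<and> \<kappa> \<le> 1 \<and> \<delta> \<le> (1 - \<kappa>) * norm a"
    for c a \<kappa>
  proof -
    have "norm c \<le> B" "norm a \<le> B" if "c + a \<in> closure \<Omega>" "c - a \<in> closure \<Omega>"
    proof -
      have "2 *\<^sub>R c = (c + a) + (c - a)" "2 *\<^sub>R a = (c + a) - (c - a)" by (simp_all add: scaleR_2)
      then have "2 * norm c \<le> norm (c + a) + norm (c - a)" "2 * norm a \<le> norm (c + a) + norm (c - a)"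
        using norm_triangle_ineq[of "c + a" "c - a"] norm_triangle_ineq4[of "c + a" "c - a"]
        by (metis abs_numeral norm_scaleR)+
      then show "norm c \<le> B" "norm a \<le> B" using B[OF that(1)] B[OF that(2)] by linarith+
    qed
    then show ?thesis by (auto simp: T_def)
  qed
  have inner: "a \<noteq> 0" "\<kappa> < 1" "c + \<kappa> *\<^sub>R a \<in> \<Omega>" "c - \<kappa> *\<^sub>R a \<in> \<Omega>" "norm a \<le> R" if "(c, a, \<kappa>) \<in> T" for c a \<kappa>
  proof -
    have T: "c + a \<in> closure \<Omega>" "c - a \<in> closure \<Omega>" "0 \<le> \<kappa>" "\<kappa> \<le> 1" "\<delta> \<le> (1 - \<kappa>) * norm a"
      using that unfolding T_iff by blast+
    show a: "a \<noteq> 0" using T(5) \<delta>(1) by auto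
    have "\<kappa> \<noteq> 1" using T(5) \<delta>(1) by auto
    then show \<kappa>: "\<kappa> < 1" using T(4) by simp
    have ne: "c - a \<noteq> c + a"
    proof
      assume "c - a = c + a"
      then have "2 *\<^sub>R a = 0" by (simp add: scaleR_2 algebra_simps)
      then show False using a by simp
    qed
    have seg: "c + k *\<^sub>R a \<in> open_segment (c - a) (c + a)" if "- 1 < k" "k < 1" for k
    proof -
      have "c + k *\<^sub>R a = (1 - (1 + k) / 2) *\<^sub>R (c - a) + ((1 + k) / 2) *\<^sub>R (c + a)"
      proof -
        have "(1 - (1 + k) / 2) *\<^sub>R (c - a) + ((1 + k) / 2) *\<^sub>R (c + a) =
          ((1 - (1 + k) / 2) + (1 + k) / 2) *\<^sub>R c + ((1 + k) / 2 - (1 - (1 + k) / 2)) *\<^sub>R a"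
          by (simp only: scaleR_diff_right scaleR_add_right scaleR_diff_left scaleR_add_left) simp
        also have "(1 - (1 + k) / 2) + (1 + k) / 2 = 1" by simp
        also have "(1 + k) / 2 - (1 - (1 + k) / 2) = k" by (simp add: field_simps)
        finally show ?thesis by simp
      qed
      then show ?thesis using ne that unfolding in_segment
        by (intro conjI exI[of _ "(1 + k) / 2"]) auto
    qed
    show "c + \<kappa> *\<^sub>R a \<in> \<Omega>" "c - \<kappa> *\<^sub>R a \<in> \<Omega>"
      using open_segment_subset[OF T(2,1) ne] seg[of \<kappa>] seg[of "- \<kappa>"] T(3) \<kappa> by auto
    have "c + a - (c - a) = 2 *\<^sub>R a" by (simp add: scaleR_2)
    then have "norm (c + a - (c - a)) = 2 * norm a" by simp
    then show "norm a \<le> R" using R_closure[OF T(1,2)] by simp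
  qed
  define P where "P p = u (fst p + fst (snd p)) * u (fst p - fst (snd p)) /
      (u (fst p + snd (snd p) *\<^sub>R fst (snd p)) * u (fst p - snd (snd p) *\<^sub>R fst (snd p))) *
      exp (X (norm (fst (snd p))) - X (snd (snd p) * norm (fst (snd p))))" for p :: "'a \<times> 'a \<times> real"
  have "continuous_on T P"
    unfolding P_def
  proof (intro continuous_intros continuous_on_compose2[OF u_cont] continuous_on_compose2[OF X_cont])
    show "(\<lambda>p. fst p + fst (snd p)) ` T \<subseteq> closure \<Omega>" "(\<lambda>p. fst p - fst (snd p)) ` T \<subseteq> closure \<Omega>"
      by (auto simp: T_iff)
    show "(\<lambda>p. fst p + snd (snd p) *\<^sub>R fst (snd p)) ` T \<subseteq> closure \<Omega>"
      "(\<lambda>p. fst p - snd (snd p) *\<^sub>R fst (snd p)) ` T \<subseteq> closure \<Omega>"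
      using inner(3,4) closure_subset by fastforce+
    show "\<forall>p\<in>T. u (fst p + snd (snd p) *\<^sub>R fst (snd p)) * u (fst p - snd (snd p) *\<^sub>R fst (snd p)) \<noteq> 0"
      using inner(3,4) u_pos by fastforce
    show "(\<lambda>p. norm (fst (snd p))) ` T \<subseteq> {0..R}" using inner(5) by fastforce
    show "(\<lambda>p. snd (snd p) * norm (fst (snd p))) ` T \<subseteq> {0..R}"
    proof (rule image_subsetI)
      fix p assume "p \<in> T"
      then obtain c a \<kappa> where p: "p = (c, a, \<kappa>)" "(c, a, \<kappa>) \<in> T" by (metis prod.collapse)
      then have "0 \<le> \<kappa>" "\<kappa> \<le> 1" "norm a \<le> R" using inner(5) by (auto simp: T_iff)
      then have "0 \<le> \<kappa> * norm a" "\<kappa> * norm a \<le> 1 * norm a"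
        by (simp, intro mult_right_mono norm_ge_zero)
      then show "snd (snd p) * norm (fst (snd p)) \<in> {0..R}"
        using \<open>norm a \<le> R\<close> unfolding p(1) atLeastAtMost_iff fst_conv snd_conv by linarith
    qed
  qed
  have P_exp: "P (c, a, \<kappa>) = exp (\<Phi> c a \<kappa>)" if "c + a \<in> \<Omega>" "c - a \<in> \<Omega>" "0 \<le> \<kappa>" "\<kappa> \<le> 1" for c a \<kappa>
  proof -
    have uf: "u z = exp (- f z)" if "z \<in> \<Omega>" for z using u_pos[OF that] by (simp add: f_def)
    note i = inner_mem[OF that]
    show ?thesis unfolding P_def fst_conv snd_conv uf[OF that(1)] uf[OF that(2)] uf[OF i(1)] uf[OF i(2)]
      by (simp add: \<Phi>_def exp_add[symmetric] exp_diff[symmetric] algebra_simps)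
  qed
  have in_T: "(c, a, \<kappa>) \<in> T" if "c + a \<in> \<Omega>" "c - a \<in> \<Omega>" "0 \<le> \<kappa>" "\<kappa> \<le> 1" "\<Phi> c a \<kappa> > \<eta> / 2" for c a \<kappa>
  proof -
    have "\<Lambda> * \<delta> < \<Lambda> * ((1 - \<kappa>) * norm a)" using \<Phi>_le[OF that(1-4)] that(5) \<delta>(2) by linarith
    then have "\<delta> < (1 - \<kappa>) * norm a" using \<Lambda>_pos by (simp only: mult_less_cancel_left_pos)
    then show ?thesis using that closure_subset unfolding T_iff by (auto simp: subset_iff)
  qed
  have T0: "(c0, a0, \<kappa>0) \<in> T" using mem \<kappa>0 \<eta> by (intro in_T) (auto simp: \<eta>_def)
  then have "T \<noteq> {}" by blast
  from compact_max_obtains[OF \<open>compact T\<close> this \<open>continuous_on T P\<close>]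
  obtain p where p: "p \<in> T" "\<And>p'. p' \<in> T \<Longrightarrow> P p' \<le> P p" by blast
  obtain c a \<kappa> where p_eq: "p = (c, a, \<kappa>)" by (metis prod.collapse)
  note pT = p(1)[unfolded p_eq]
  have cl: "c + a \<in> closure \<Omega>" "c - a \<in> closure \<Omega>" "0 \<le> \<kappa>" "\<kappa> \<le> 1" using pT unfolding T_iff by blast+
  have "P (c, a, \<kappa>) \<ge> exp \<eta>" using p(2)[OF T0] P_exp[OF mem \<kappa>0] by (simp add: p_eq \<eta>_def)
  then have Ppos: "P (c, a, \<kappa>) > 0" using exp_gt_zero[of \<eta>] by linarith
  then have "u (c + a) \<noteq> 0" "u (c - a) \<noteq> 0" by (auto simp: P_def)
  then have memc: "c + a \<in> \<Omega>" "c - a \<in> \<Omega>"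
    using not_frontier[OF cl(1)] not_frontier[OF cl(2)] u_frontier by blast+
  have \<Phi>_ge: "\<eta> \<le> \<Phi> c a \<kappa>" using \<open>P (c, a, \<kappa>) \<ge> exp \<eta>\<close> unfolding P_exp[OF memc cl(3,4)] by simp
  show False
  proof (rule no_interior_maximum[OF memc inner(1)[OF pT] cl(3) inner(2)[OF pT]])
    fix c' a' \<kappa>' assume *: "c' + a' \<in> \<Omega>" "c' - a' \<in> \<Omega>" "0 \<le> \<kappa>'" "\<kappa>' \<le> (1::real)"
    show "\<Phi> c' a' \<kappa>' \<le> \<Phi> c a \<kappa>"
    proof (cases "\<Phi> c' a' \<kappa>' > \<eta> / 2")
      case True
      from p(2)[OF in_T[OF * this]] show ?thesis
        unfolding p_eq P_exp[OF *] P_exp[OF memc cl(3,4)] by simp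
    next
      case False
      then show ?thesis using \<Phi>_ge \<eta> by linarith
    qed
  qed
qed

end

section \<open>From endpoints to midpoint and direction; the diameter; the root formula\<close>

lemma E_symmetric:
  fixes g :: "'a::euclidean_space \<Rightarrow> real"
  assumes "twice_differentiable_on S g" "convex S" "norm n = 1" "\<sigma> > 0"
    and "c + \<sigma> *\<^sub>R n \<in> S" "c - \<sigma> *\<^sub>R n \<in> S"
  shows "E g (c - \<sigma> *\<^sub>R n) (c + \<sigma> *\<^sub>R n) = dd g [n] (c + \<sigma> *\<^sub>R n) - dd g [n] (c - \<sigma> *\<^sub>R n)"
    and "r (c - \<sigma> *\<^sub>R n) (c + \<sigma> *\<^sub>R n) / 2 = \<sigma>"
proof -
  have d: "c + \<sigma> *\<^sub>R n - (c - \<sigma> *\<^sub>R n) = (2 * \<sigma>) *\<^sub>R n"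
    by (simp only: mult_2 scaleR_left_distrib) simp
  have nd: "norm (c + \<sigma> *\<^sub>R n - (c - \<sigma> *\<^sub>R n)) = 2 * \<sigma>" unfolding d using assms(3,4) by simp
  then show "r (c - \<sigma> *\<^sub>R n) (c + \<sigma> *\<^sub>R n) / 2 = \<sigma>" by (simp add: r_def norm_minus_commute)
  have "N (c - \<sigma> *\<^sub>R n) (c + \<sigma> *\<^sub>R n) = n"
    unfolding N_def nd unfolding d using assms(4) by simp
  moreover have "c - \<sigma> *\<^sub>R n \<noteq> c + \<sigma> *\<^sub>R n" using nd assms(4) by force
  ultimately show "E g (c - \<sigma> *\<^sub>R n) (c + \<sigma> *\<^sub>R n) = dd g [n] (c + \<sigma> *\<^sub>R n) - dd g [n] (c - \<sigma> *\<^sub>R n)"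
    using E_eq_diff_directional[OF assms(1,2,6,5)] by simp
qed

text \<open>In an open set the segment can be prolonged beyond \<open>y\<close>; for
  \<open>x = y\<close> any unit vector serves as its direction. Strictness places half distances in
  the open interval on which \<psi> has two-sided derivatives.\<close>

lemma norm_diff_less_diameter:
  fixes S :: "'a::euclidean_space set"
  assumes "open S" "bounded S" "x \<in> S" "y \<in> S"
  shows "norm (x - y) < diameter S"
proof -
  obtain b :: 'a where b: "b \<in> Basis" using nonempty_Basis by blast
  define v where "v = (if x = y then b else (y - x) /\<^sub>R norm (y - x))"
  have v: "norm v = 1" "y - x = norm (y - x) *\<^sub>R v" using b by (auto simp: v_def)
  obtain e where e: "e > 0" "cball y e \<subseteq> S" using assms(1,4) open_contains_cball by blast
  have "y + e *\<^sub>R v \<in> S" using e v(1) by (auto simp: dist_norm subset_iff)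
  then have "dist (y + e *\<^sub>R v) x \<le> diameter S" using diameter_bounded_bound[OF assms(2) _ assms(3)] by blast
  moreover have "y + e *\<^sub>R v - x = (norm (y - x) + e) *\<^sub>R v"
  proof -
    have "y + e *\<^sub>R v - x = (y - x) + e *\<^sub>R v" by simp
    also have "\<dots> = norm (y - x) *\<^sub>R v + e *\<^sub>R v" using v(2) by simp
    finally show ?thesis by (simp only: scaleR_left_distrib)
  qed
  then have "dist (y + e *\<^sub>R v) x = norm (y - x) + e" using v(1) e(1) by (simp add: dist_norm)
  ultimately show ?thesis using e(1) by (simp add: norm_minus_commute)
qed

text \<open>A quadratic with positive leading coefficient is nonpositive between its roots;
  \<open>m\<close> is at most the larger root, and \<open>m \<ge> 0\<close> is at least the smaller
  one. It is applied with \<open>A = \<psi> * \<psi>'\<close> and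
  \<open>B = \<psi>''\<close>.\<close>

lemma quadratic_root_bound:
  fixes A B m \<phi> :: real
  assumes "A > 0" "m \<ge> 0" "\<phi> \<ge> 0" "m \<le> (B + sqrt (B\<^sup>2 + 4 * \<phi> * A)) / (2 * A)"
  shows "m\<^sup>2 * A - m * B \<le> \<phi>"
proof -
  define S where "S = sqrt (B\<^sup>2 + 4 * \<phi> * A)"
  have S2: "S\<^sup>2 = B\<^sup>2 + 4 * \<phi> * A" using assms by (simp add: S_def)
  have "sqrt (B\<^sup>2) \<le> S" unfolding S_def using assms by (intro real_sqrt_le_mono) simp
  then have SB: "\<bar>B\<bar> \<le> S" by simp
  have "2 * A * m \<le> B + S" using assms(1,4) by (simp add: S_def pos_le_divide_eq mult.commute)
  then have "2 * A * m - B \<le> S" "- (2 * A * m - B) \<le> S"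
    using SB mult_nonneg_nonneg[of "2 * A" m] assms(1,2) by linarith+
  then have "\<bar>2 * A * m - B\<bar> \<le> \<bar>S\<bar>" by linarith
  then have "(2 * A * m - B)\<^sup>2 \<le> S\<^sup>2" by (rule abs_le_square_iff[THEN iffD1])
  then have "4 * A * (m\<^sup>2 * A - m * B) \<le> 4 * A * \<phi>" unfolding S2 by (simp add: power2_eq_square algebra_simps)
  then show ?thesis using assms(1) by simp
qed

section \<open>The modulus of convexity\<close>

lemma smooth_on_real_derivs:
  fixes \<psi> :: "real \<Rightarrow> real"
  assumes "open I" "smooth_on I \<psi>" "\<sigma> \<in> I"
  shows "(\<psi> has_real_derivative deriv \<psi> \<sigma>) (at \<sigma>)"
    and "(deriv \<psi> has_real_derivative deriv (deriv \<psi>) \<sigma>) (at \<sigma>)"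
proof -
  have diff: "dd \<psi> vs differentiable (at \<tau>)" if "\<tau> \<in> I" for vs \<tau>
    using assms(2) that by (simp add: smooth_on_def)
  have psi: "(\<psi> has_real_derivative deriv \<psi> \<tau>) (at \<tau>)" if "\<tau> \<in> I" for \<tau>
    using diff[OF that, of "[]"] by (auto simp: real_differentiable_def DERIV_imp_deriv)
  then show "(\<psi> has_real_derivative deriv \<psi> \<sigma>) (at \<sigma>)" using assms(3) .
  have dd_eq: "dd \<psi> [1] \<tau> = deriv \<psi> \<tau>" if "\<tau> \<in> I" for \<tau>
    using frechet_derivative_at[OF psi[OF that, unfolded has_field_derivative_def]]
    by (metis dd.simps mult.right_neutral)
  obtain D where "(dd \<psi> [1] has_real_derivative D) (at \<sigma>)"
    using diff[OF assms(3), of "[1]"] by (auto simp only: real_differentiable_def)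
  then have "(deriv \<psi> has_real_derivative D) (at \<sigma>)"
    unfolding has_field_derivative_def using assms(1,3) dd_eq by (rule has_derivative_transform_within_open)
  then show "(deriv \<psi> has_real_derivative deriv (deriv \<psi>) \<sigma>) (at \<sigma>)"
    by (simp add: DERIV_imp_deriv)
qed

theorem theorem3p5:
  fixes \<Omega> :: "'a::euclidean_space set"
    and q u :: "'a \<Rightarrow> real"
    and \<psi> \<phi> :: "real \<Rightarrow> real"
    and D m :: real
  assumes dom: "smooth_bounded_domain \<Omega>"
    and sconv: "strictly_convex \<Omega>"
    and D_def: "D = diameter \<Omega>"
    and q_smooth: "smooth_upto (closure \<Omega>) q"
    and u_eig: "first_dirichlet_eigenfunction \<Omega> q u"
    and u_nonneg: "\<forall>x\<in>closure \<Omega>. u x \<ge> 0"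
    and psi_smooth: "smooth_upto {0..D/2} \<psi>"
    and psi0: "\<psi> 0 = 0"
    and psiss0: "deriv (deriv \<psi>) 0 = 0"
    and psis_pos: "\<forall>s\<in>{0..D/2}. deriv \<psi> s > 0"
    and phi_nonneg: "\<forall>s\<in>{0..D/2}. \<phi> s \<ge> 0"
    and Eq: "\<forall>x\<in>\<Omega>. \<forall>y\<in>\<Omega>. E q x y \<ge> \<phi> (r x y / 2)"
    and m_def: "m = Inf ((\<lambda>s. (deriv (deriv \<psi>) s
                  + sqrt ((deriv (deriv \<psi>) s)\<^sup>2 + 4 * \<phi> s * \<psi> s * deriv \<psi> s))
                  / (2 * deriv \<psi> s * \<psi> s)) ` {0<..D/2})"
  shows "\<forall>x\<in>\<Omega>. \<forall>y\<in>\<Omega>. E (\<lambda>z. - ln (u z)) x y \<ge> m * \<psi> (r x y / 2)"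
proof -
  define R where "R = D / 2"
  obtain \<rho> where "\<Omega> = {x. \<rho> x < (0::real)}" and bounded: "bounded \<Omega>" and connected: "connected \<Omega>"
    and nonempty: "\<Omega> \<noteq> {}" and opn: "open \<Omega>"
    using smooth_bounded_domainE[OF dom] by metis
  have sub: "\<Omega> \<subseteq> closure \<Omega>" by (rule closure_subset)
  have R_closure: "norm (x - y) \<le> 2 * R" if "x \<in> closure \<Omega>" "y \<in> closure \<Omega>" for x y
    using diameter_bounded_bound[OF bounded_closure[OF bounded] that] diameter_closure[OF bounded]
    by (simp add: R_def D_def dist_norm)
  have R_domain: "norm (x - y) < 2 * R" if "x \<in> \<Omega>" "y \<in> \<Omega>" for x y
    using norm_diff_less_diameter[OF opn bounded that] by (simp add: R_def D_def)
  have R: "R > 0" using R_domain nonempty by force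
  have convex: "convex \<Omega>"
    unfolding convex_contains_open_segment using sconv sub unfolding strictly_convex_def
    by (metis empty_subsetI open_segment_idem subsetD)

  \<comment> \<open>Regularity, boundedness and convexity of the potential\<close>
  obtain U G where G: "open U" "closure \<Omega> \<subseteq> U" "smooth_on U G" "\<And>x. x \<in> closure \<Omega> \<Longrightarrow> G x = q x"
    using q_smooth unfolding smooth_upto_def by blast
  have "smooth_on \<Omega> q"
    using smooth_on_cong_open[OF opn smooth_on_subset[OF G(3)], of q] G(2,4) sub by blast
  then have q_twice: "twice_differentiable_on \<Omega> q" by (rule smooth_on_imp_twice_differentiable_on)
  then have q_diff: "q differentiable (at z)" if "z \<in> \<Omega>" for z
    using that by (simp add: twice_differentiable_on_def)
  have "continuous_on (closure \<Omega>) G"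
  proof (rule continuous_at_imp_continuous_on, rule ballI)
    fix z assume "z \<in> closure \<Omega>"
    then have "dd G [] differentiable (at z)" using G(2,3) unfolding smooth_on_def by blast
    then show "isCont G z" by (simp add: differentiable_imp_continuous_within)
  qed
  then have "bounded (G ` closure \<Omega>)"
    using bounded by (intro compact_imp_bounded compact_continuous_image) auto
  then obtain B where B: "\<And>z. z \<in> closure \<Omega> \<Longrightarrow> \<bar>q z\<bar> \<le> B"
    using G(4) unfolding bounded_iff by force

  have Q_deriv: "((\<lambda>\<tau>. q (c + \<tau> *\<^sub>R n) + q (c - \<tau> *\<^sub>R n)) has_real_derivative
      dd q [n] (c + \<sigma> *\<^sub>R n) - dd q [n] (c - \<sigma> *\<^sub>R n)) (at \<sigma>)"
    if "c + \<sigma> *\<^sub>R n \<in> \<Omega>" "c - \<sigma> *\<^sub>R n \<in> \<Omega>" for c n \<sigma>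
    using symmetric_sum_deriv[where S = \<Omega> and g = q, OF q_diff that] .
  have Q_ge: "dd q [n] (c + \<sigma> *\<^sub>R n) - dd q [n] (c - \<sigma> *\<^sub>R n) \<ge> \<phi> \<sigma>" "\<sigma> < R"
    if n: "norm n = 1" and \<sigma>: "\<sigma> > 0" and mem: "c + \<sigma> *\<^sub>R n \<in> \<Omega>" "c - \<sigma> *\<^sub>R n \<in> \<Omega>" for c n \<sigma>
  proof -
    note Es = E_symmetric[OF q_twice convex n \<sigma> mem]
    show "dd q [n] (c + \<sigma> *\<^sub>R n) - dd q [n] (c - \<sigma> *\<^sub>R n) \<ge> \<phi> \<sigma>"
      using Eq mem Es by (metis (no_types))
    show "\<sigma> < R" using R_domain[OF mem(2,1)] Es(2) by (simp add: r_def)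
  qed
  have phi_ge: "\<phi> \<sigma> \<ge> 0" if "0 < \<sigma>" "\<sigma> < R" for \<sigma>
    using phi_nonneg that by (simp add: R_def)
  have q_midconvex: "2 * q z \<le> q (z + h) + q (z - h)" if mem: "z + h \<in> \<Omega>" "z - h \<in> \<Omega>" for z h
  proof (cases "h = 0")
    case False
    define s where "s = norm h"
    define n where "n = h /\<^sub>R s"
    have s: "s > 0" "norm n = 1" "h = s *\<^sub>R n" using False by (auto simp: s_def n_def)
    have seg: "z + \<tau> *\<^sub>R n \<in> \<Omega>" if "\<bar>\<tau>\<bar> \<le> s" for \<tau>
      using convex_symmetric_segment_mem[OF convex mem[unfolded s(3)] that] .
    have segs: "z + \<tau> *\<^sub>R n \<in> \<Omega>" "z - \<tau> *\<^sub>R n \<in> \<Omega>" if "0 \<le> \<tau>" "\<tau> \<le> s" for \<tau>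
      using seg[of \<tau>] seg[of "- \<tau>"] that by auto
    have "q (z + 0 *\<^sub>R n) + q (z - 0 *\<^sub>R n) \<le> q (z + s *\<^sub>R n) + q (z - s *\<^sub>R n)"
    proof (rule DERIV_nonneg_imp_nondecreasing[where f = "\<lambda>\<tau>. q (z + \<tau> *\<^sub>R n) + q (z - \<tau> *\<^sub>R n)"])
      fix \<tau> assume \<tau>: "0 \<le> \<tau>" "\<tau> \<le> s"
      have "dd q [n] (z + \<tau> *\<^sub>R n) - dd q [n] (z - \<tau> *\<^sub>R n) \<ge> 0"
      proof (cases "\<tau> = 0")
        case False
        then have "\<tau> > 0" using \<tau> by simp
        from Q_ge[OF s(2) this segs[OF \<tau>]] phi_ge[OF this] show ?thesis by linarith
      qed simp
      then show "\<exists>y. ((\<lambda>\<tau>. q (z + \<tau> *\<^sub>R n) + q (z - \<tau> *\<^sub>R n)) has_real_derivative y) (at \<tau>) \<and> 0 \<le> y"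
        using Q_deriv[OF segs[OF \<tau>]] by blast
    qed (use s in simp)
    then show ?thesis by (simp add: s(3))
  qed simp

  \<comment> \<open>Positivity of the eigenfunction\<close>
  obtain lam where eig: "dirichlet_eigenpair \<Omega> q lam u"
    using u_eig unfolding first_dirichlet_eigenfunction_def by blast
  have u_twice: "twice_differentiable_on \<Omega> u" and u_cont: "continuous_on (closure \<Omega>) u"
    and u_frontier: "\<And>z. z \<in> frontier \<Omega> \<Longrightarrow> u z = 0"
    and u_eq: "\<And>z. z \<in> \<Omega> \<Longrightarrow> laplacian u z = (q z - lam) * u z"
    using eig unfolding dirichlet_eigenpair_def
    by (auto simp: C2_on_imp_twice_differentiable_on algebra_simps)
  obtain z1 where z1: "z1 \<in> \<Omega>" "u z1 \<noteq> 0" using eig unfolding dirichlet_eigenpair_def by blast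
  define C where "C = B + \<bar>lam\<bar>"
  have q_bound: "\<bar>q z - lam\<bar> \<le> C" if "z \<in> \<Omega>" for z
    using B[of z] that sub unfolding C_def by (auto simp: subset_iff)
  have "C \<ge> 0" using q_bound[OF z1(1)] by linarith
  have u_pos: "u z > 0" if "z \<in> \<Omega>" for z
    using nonneg_eigenfunction_pos[OF opn connected \<open>C \<ge> 0\<close> u_twice continuous_on_subset[OF u_cont sub] u_eq q_bound _ z1 that]
      u_nonneg sub by blast
  interpret positive_eigenfunction \<Omega> q u lam C
    by unfold_locales (fact dom sconv u_twice u_cont u_frontier u_pos u_eq q_bound q_midconvex)+

  \<comment> \<open>The modulus \<psi> and the number \<open>m\<close>\<close>
  obtain V g where g: "open V" "{0..R} \<subseteq> V" "smooth_on V g" "\<And>x. x \<in> {0..R} \<Longrightarrow> g x = \<psi> x"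
    using psi_smooth unfolding smooth_upto_def R_def by blast
  have psi_smooth_in: "smooth_on {0<..<R} \<psi>"
    by (rule smooth_on_cong_open[OF _ smooth_on_subset[OF g(3)]]) (use g(2,4) in auto)
  have psi_deriv: "(\<psi> has_real_derivative deriv \<psi> \<sigma>) (at \<sigma>)"
    "(deriv \<psi> has_real_derivative deriv (deriv \<psi>) \<sigma>) (at \<sigma>)" if "0 < \<sigma>" "\<sigma> < R" for \<sigma>
    using smooth_on_real_derivs[OF open_greaterThanLessThan psi_smooth_in] that by auto
  have "continuous_on {0..R} g"
  proof (rule continuous_at_imp_continuous_on, rule ballI)
    fix z assume "z \<in> {0..R}"
    then have "dd g [] differentiable (at z)" using g(2,3) unfolding smooth_on_def by blast
    then show "isCont g z" by (simp add: differentiable_imp_continuous_within)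
  qed
  then have psi_cont: "continuous_on {0..R} \<psi>" using g(4) by (rule continuous_on_eq)
  have psi_pos': "deriv \<psi> \<sigma> > 0" if "0 < \<sigma>" "\<sigma> \<le> R" for \<sigma>
    using psis_pos that by (simp add: R_def)
  have psi_incr: "\<psi> s < \<psi> t" if "0 \<le> s" "s < t" "t \<le> R" for s t
  proof (rule DERIV_pos_imp_increasing_open[OF that(2)])
    show "\<exists>y. (\<psi> has_real_derivative y) (at x) \<and> 0 < y" if "s < x" "x < t" for x
      using psi_deriv(1)[of x] psi_pos'[of x] that \<open>0 \<le> s\<close> \<open>t \<le> R\<close> by force
    show "continuous_on {s..t} \<psi>" using that by (intro continuous_on_subset[OF psi_cont]) auto
  qed
  have psi_pos: "\<psi> \<sigma> > 0" if "0 < \<sigma>" "\<sigma> \<le> R" for \<sigma> using psi_incr[of 0 \<sigma>] that psi0 by simp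

  define F where "F s = (deriv (deriv \<psi>) s + sqrt ((deriv (deriv \<psi>) s)\<^sup>2 + 4 * \<phi> s * \<psi> s * deriv \<psi> s))
      / (2 * deriv \<psi> s * \<psi> s)" for s
  have F_nonneg: "F s \<ge> 0" if "s \<in> {0<..R}" for s
  proof -
    have pos: "deriv \<psi> s > 0" "\<psi> s > 0" "\<phi> s \<ge> 0"
      using that psi_pos psi_pos' phi_nonneg by (auto simp: R_def)
    then have "4 * \<phi> s * \<psi> s * deriv \<psi> s \<ge> 0" by simp
    then have "\<bar>deriv (deriv \<psi>) s\<bar> \<le> sqrt ((deriv (deriv \<psi>) s)\<^sup>2 + 4 * \<phi> s * \<psi> s * deriv \<psi> s)"
      by (intro real_le_rsqrt) simp
    then show ?thesis unfolding F_def using pos by (intro divide_nonneg_nonneg) auto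
  qed
  \<comment> \<open>The point \<open>0\<close> is left out because the denominator vanishes there.
    Nonnegativity of \<open>F\<close> bounds the set below, so the infimum is a genuine lower bound
    of every \<open>F s\<close>.\<close>
  have m_eq: "m = Inf (F ` {0<..R})" unfolding m_def F_def R_def ..
  have m_nonneg: "m \<ge> 0" unfolding m_eq using F_nonneg R by (intro cInf_greatest) auto
  have m_le: "m \<le> F s" if "s \<in> {0<..R}" for s
    unfolding m_eq using F_nonneg that by (intro cInf_lower bdd_belowI[of _ 0]) auto
  have m_quad: "m\<^sup>2 * \<psi> \<sigma> * deriv \<psi> \<sigma> - m * deriv (deriv \<psi>) \<sigma> \<le> \<phi> \<sigma>" if \<sigma>: "0 < \<sigma>" "\<sigma> < R" for \<sigma>
  proof -
    have "m\<^sup>2 * (\<psi> \<sigma> * deriv \<psi> \<sigma>) - m * deriv (deriv \<psi>) \<sigma> \<le> \<phi> \<sigma>"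
      by (rule quadratic_root_bound)
         (use \<sigma> psi_pos[of \<sigma>] psi_pos'[of \<sigma>] m_nonneg phi_ge[of \<sigma>] m_le[of \<sigma>] in \<open>auto simp: F_def mult_ac\<close>)
    then show ?thesis by (simp add: mult.assoc)
  qed

  \<comment> \<open>The perturbed modulus and the four-point inequality\<close>
  define \<Lambda> where "\<Lambda> = m * \<psi> R + 1"
  have mpsi: "m * \<psi> \<sigma> \<le> \<Lambda> - 1" "m * \<psi> \<sigma> \<ge> 0" if "0 \<le> \<sigma>" "\<sigma> \<le> R" for \<sigma>
  proof -
    have "\<psi> \<sigma> \<le> \<psi> R" using psi_incr[of \<sigma> R] that by (cases "\<sigma> = R") auto
    then show "m * \<psi> \<sigma> \<le> \<Lambda> - 1" using m_nonneg by (simp add: \<Lambda>_def mult_left_mono)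
    show "m * \<psi> \<sigma> \<ge> 0" using psi_pos[of \<sigma>] psi0 that m_nonneg by (cases "\<sigma> = 0") auto
  qed
  have \<Lambda>: "\<Lambda> \<ge> 1" using mpsi[of R] R by linarith
  \<comment> \<open>The perturbation of \<open>m * \<psi>\<close> is
    \<open>- \<epsilon> * (K - exp (\<Lambda> * \<sigma>))\<close>. This \<open>K\<close> keeps the
    bracket at least \<open>1\<close>, hence \<open>\<xi> 0 < 0\<close> and \<xi> below
    \<open>m * \<psi>\<close>. The exponential yields strictness: its first-order effect on
    \<open>\<xi> * \<xi>' - \<xi>''\<close> is a negative multiple of
    \<open>\<Lambda> - m * \<psi>\<close>, which the summand \<open>1\<close> in \<Lambda> keeps
    positive.\<close>
  define K where "K = exp (\<Lambda> * R) + 1"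
  define X0 where "X0 \<sigma> = integral {0..\<sigma>} (\<lambda>s. m * \<psi> s)" for \<sigma>
  define X1 where "X1 \<sigma> = K * \<sigma> - exp (\<Lambda> * \<sigma>) / \<Lambda>" for \<sigma>
  have X0_deriv: "(X0 has_real_derivative m * \<psi> \<sigma>) (at \<sigma> within {0..R})" if "\<sigma> \<in> {0..R}" for \<sigma>
    unfolding X0_def
    by (rule integral_has_real_derivative[OF _ that]) (intro continuous_intros psi_cont)
  have X1_deriv: "(X1 has_real_derivative K - exp (\<Lambda> * \<sigma>)) (at \<sigma>)" for \<sigma>
    unfolding X1_def using \<Lambda> by (auto intro!: derivative_eq_intros)

  have main: "X0 (norm a) - X0 (\<kappa> * norm a) - \<epsilon> * (X1 (norm a) - X1 (\<kappa> * norm a))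
      \<le> f (c + a) + f (c - a) - f (c + \<kappa> *\<^sub>R a) - f (c - \<kappa> *\<^sub>R a)"
    if \<epsilon>: "\<epsilon> > 0" and a: "c + a \<in> \<Omega>" "c - a \<in> \<Omega>" "0 \<le> \<kappa>" "\<kappa> \<le> 1" for \<epsilon> c a \<kappa>
  proof -
    define X where "X \<sigma> = X0 \<sigma> - \<epsilon> * X1 \<sigma>" for \<sigma>
    define \<xi> where "\<xi> \<sigma> = m * \<psi> \<sigma> - \<epsilon> * (K - exp (\<Lambda> * \<sigma>))" for \<sigma>
    define \<xi>' where "\<xi>' \<sigma> = m * deriv \<psi> \<sigma> + \<epsilon> * (\<Lambda> * exp (\<Lambda> * \<sigma>))" for \<sigma>
    define \<xi>'' where "\<xi>'' \<sigma> = m * deriv (deriv \<psi>) \<sigma> + \<epsilon> * (\<Lambda> * (\<Lambda> * exp (\<Lambda> * \<sigma>)))" for \<sigma>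
    have \<xi>_deriv: "(\<xi> has_real_derivative \<xi>' \<sigma>) (at \<sigma>)" if "0 < \<sigma>" "\<sigma> < R" for \<sigma>
      unfolding \<xi>_def \<xi>'_def using psi_deriv(1)[OF that]
      by (auto intro!: derivative_eq_intros)
    have \<xi>'_deriv: "(\<xi>' has_real_derivative \<xi>'' \<sigma>) (at \<sigma>)" if "0 < \<sigma>" "\<sigma> < R" for \<sigma>
      unfolding \<xi>'_def \<xi>''_def using psi_deriv(2)[OF that]
      by (auto intro!: derivative_eq_intros)
    have K_ge: "K - exp (\<Lambda> * \<sigma>) \<ge> 1" if "\<sigma> \<le> R" for \<sigma>
      using that \<Lambda> by (simp add: K_def mult_left_mono)
    have key: "\<xi> \<sigma> * \<xi>' \<sigma> - \<xi>'' \<sigma> < \<phi> \<sigma>" if \<sigma>: "0 < \<sigma>" "\<sigma> < R" for \<sigma>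
    proof -
      let ?e = "exp (\<Lambda> * \<sigma>)" and ?k = "K - exp (\<Lambda> * \<sigma>)"
      have "\<xi> \<sigma> * \<xi>' \<sigma> - \<xi>'' \<sigma> = (m\<^sup>2 * \<psi> \<sigma> * deriv \<psi> \<sigma> - m * deriv (deriv \<psi>) \<sigma>)
          - \<epsilon> * (\<Lambda> * ?e) * (\<Lambda> - m * \<psi> \<sigma>) - \<epsilon> * ?k * (m * deriv \<psi> \<sigma>) - \<epsilon> * ?k * (\<epsilon> * (\<Lambda> * ?e))"
        unfolding \<xi>_def \<xi>'_def \<xi>''_def by (simp add: algebra_simps power2_eq_square)
      moreover have "\<epsilon> * (\<Lambda> * ?e) * (\<Lambda> - m * \<psi> \<sigma>) > 0"
        using \<epsilon> \<Lambda> mpsi(1)[of \<sigma>] \<sigma> by (intro mult_pos_pos) auto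
      moreover have "\<epsilon> * ?k * (m * deriv \<psi> \<sigma>) \<ge> 0"
        using \<epsilon> K_ge[of \<sigma>] m_nonneg psi_pos'[of \<sigma>] \<sigma> by (intro mult_nonneg_nonneg) auto
      moreover have "\<epsilon> * ?k * (\<epsilon> * (\<Lambda> * ?e)) \<ge> 0"
        using \<epsilon> K_ge[of \<sigma>] \<Lambda> \<sigma> by (intro mult_nonneg_nonneg) auto
      ultimately show ?thesis using m_quad[OF \<sigma>] by linarith
    qed
    interpret four_point \<Omega> q u lam C X \<xi> \<xi>' R \<Lambda>
    proof unfold_locales
      show "(X has_real_derivative \<xi> \<sigma>) (at \<sigma> within {0..R})" if "\<sigma> \<in> {0..R}" for \<sigma>
        unfolding X_def \<xi>_def
        by (intro DERIV_diff DERIV_cmult X0_deriv[OF that] has_field_derivative_at_within[OF X1_deriv])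
      show "\<xi> 0 < 0" using \<epsilon> psi0 by (simp add: \<xi>_def K_def)
      show "\<xi> \<sigma> \<le> \<Lambda>" if "\<sigma> \<in> {0..R}" for \<sigma>
      proof -
        have "\<epsilon> * (K - exp (\<Lambda> * \<sigma>)) \<ge> 0" using \<epsilon> K_ge[of \<sigma>] that by simp
        then show ?thesis using mpsi(1)[of \<sigma>] that by (simp add: \<xi>_def)
      qed
      show "\<Lambda> > 0" using \<Lambda> by simp
      fix c n :: 'a and s t :: real
      assume n: "norm n = 1" and ts: "0 < t" "t < s" and mem: "c + s *\<^sub>R n \<in> \<Omega>" "c - s *\<^sub>R n \<in> \<Omega>"
      have seg: "c + \<tau> *\<^sub>R n \<in> \<Omega>" if "\<bar>\<tau>\<bar> \<le> s" for \<tau>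
        using convex_symmetric_segment_mem[OF convex mem that] .
      have segs: "c + \<tau> *\<^sub>R n \<in> \<Omega>" "c - \<tau> *\<^sub>R n \<in> \<Omega>" if "t \<le> \<tau>" "\<tau> \<le> s" for \<tau>
        using seg[of \<tau>] seg[of "- \<tau>"] that ts by auto
      let ?Q = "\<lambda>\<tau>. q (c + \<tau> *\<^sub>R n) + q (c - \<tau> *\<^sub>R n)"
      \<comment> \<open>\<open>\<xi> * \<xi>' - \<xi>''\<close> is the derivative of
        \<open>\<xi>\<^sup>2 / 2 - \<xi>'\<close>, so the pointwise inequality says that this
        difference is increasing.\<close>
      have "?Q t - ((\<xi> t)\<^sup>2 / 2 - \<xi>' t) < ?Q s - ((\<xi> s)\<^sup>2 / 2 - \<xi>' s)"
      proof (rule DERIV_pos_imp_increasing[OF ts(2), where f = "\<lambda>\<tau>. ?Q \<tau> - ((\<xi> \<tau>)\<^sup>2 / 2 - \<xi>' \<tau>)"])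
        fix \<tau> assume \<tau>: "t \<le> \<tau>" "\<tau> \<le> s"
        have \<tau>0: "\<tau> > 0" using \<tau> ts by simp
        note Q = Q_ge[OF n \<tau>0 segs[OF \<tau>]]
        let ?d = "dd q [n] (c + \<tau> *\<^sub>R n) - dd q [n] (c - \<tau> *\<^sub>R n)"
        have "((\<lambda>\<tau>. (\<xi> \<tau>)\<^sup>2 / 2 - \<xi>' \<tau>) has_real_derivative \<xi> \<tau> * \<xi>' \<tau> - \<xi>'' \<tau>) (at \<tau>)"
          using \<xi>_deriv[OF \<tau>0 Q(2)] \<xi>'_deriv[OF \<tau>0 Q(2)] by (auto intro!: derivative_eq_intros)
        then have "((\<lambda>\<tau>. ?Q \<tau> - ((\<xi> \<tau>)\<^sup>2 / 2 - \<xi>' \<tau>)) has_real_derivative ?d - (\<xi> \<tau> * \<xi>' \<tau> - \<xi>'' \<tau>)) (at \<tau>)"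
          by (rule DERIV_diff[OF Q_deriv[OF segs[OF \<tau>]]])
        moreover have "?d - (\<xi> \<tau> * \<xi>' \<tau> - \<xi>'' \<tau>) > 0" using Q(1) key[OF \<tau>0 Q(2)] by linarith
        ultimately show "\<exists>y. ((\<lambda>\<tau>. ?Q \<tau> - ((\<xi> \<tau>)\<^sup>2 / 2 - \<xi>' \<tau>)) has_real_derivative y) (at \<tau>) \<and> 0 < y" by blast
      qed
      then show "((\<xi> s)\<^sup>2 - (\<xi> t)\<^sup>2) / 2 - (\<xi>' s - \<xi>' t) <
          q (c + s *\<^sub>R n) + q (c - s *\<^sub>R n) - q (c + t *\<^sub>R n) - q (c - t *\<^sub>R n)"
        by (simp add: diff_divide_distrib)
    qed (fact R_closure R_domain \<xi>_deriv)+
    have "\<Phi> c a \<kappa> \<le> 0" using a by (rule \<Phi>_nonpos)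
    then show ?thesis unfolding \<Phi>_def by (simp add: X_def algebra_simps)
  qed

  \<comment> \<open>Removal of the perturbation and return to the derivative\<close>
  show ?thesis
  proof (intro ballI)
    fix x y assume xy: "x \<in> \<Omega>" "y \<in> \<Omega>"
    show "E (\<lambda>z. - ln (u z)) x y \<ge> m * \<psi> (r x y / 2)"
    proof (cases "x = y")
      case True
      then show ?thesis by (simp add: E_def r_def psi0)
    next
      case False
      define s where "s = r x y / 2"
      define n where "n = N x y"
      define c where "c = x + s *\<^sub>R n"
      have rpos: "norm (y - x) > 0" using False by simp
      have s: "s > 0" "s < R" using R_domain[OF xy] False by (simp_all add: s_def r_def)
      have n: "norm n = 1" using rpos by (simp add: n_def N_def)
      have yx: "y - x = (2 * s) *\<^sub>R n" using rpos by (simp add: s_def n_def r_def N_def norm_minus_commute)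
      have cx: "c - s *\<^sub>R n = x" by (simp add: c_def)
      have cy: "c + s *\<^sub>R n = y"
      proof -
        have "c + s *\<^sub>R n = x + (2 * s) *\<^sub>R n" by (simp only: c_def mult_2 scaleR_left_distrib add.assoc)
        then show ?thesis using yx by (simp add: algebra_simps)
      qed
      \<comment> \<open>Its derivative at \<open>s\<close> is \<open>E f x y - m * \<psi> s\<close>.
        On \<open>{0..s}\<close> the largest value is taken at the right end, so this derivative
        cannot be negative.\<close>
      let ?J = "\<lambda>\<tau>. f (c + \<tau> *\<^sub>R n) + f (c - \<tau> *\<^sub>R n) - X0 \<tau>"
      have mono: "?J t \<le> ?J s" if t: "0 \<le> t" "t \<le> s" for t
      proof -
        have "X0 s - X0 t \<le> (f y + f x - f (c + t *\<^sub>R n) - f (c - t *\<^sub>R n)) + \<epsilon>" if \<epsilon>: "\<epsilon> > 0" for \<epsilon>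
        proof -
          \<comment> \<open>Normalises the perturbation parameter so that the total error is at most
            \<epsilon>; the summand \<open>1\<close> keeps \<open>M\<close> positive when the two
            values of \<open>X1\<close> agree.\<close>
          define M where "M = \<bar>X1 s - X1 t\<bar> + 1"
          have "M > 0" by (simp add: M_def)
          have ns: "norm (s *\<^sub>R n) = s" using s n by simp
          have kt: "t / s * s = t" "(t / s) *\<^sub>R s *\<^sub>R n = t *\<^sub>R n" using s by simp_all
          have "X0 s - X0 t - \<epsilon> / M * (X1 s - X1 t) \<le> f y + f x - f (c + t *\<^sub>R n) - f (c - t *\<^sub>R n)"
            using main[of "\<epsilon> / M" c "s *\<^sub>R n" "t / s"] \<epsilon> \<open>M > 0\<close> xy t s
            unfolding ns kt cx cy by (simp add: divide_le_eq_1)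
          moreover have "\<epsilon> / M * (X1 s - X1 t) \<le> \<epsilon> / M * M"
            using \<epsilon> \<open>M > 0\<close> by (intro mult_left_mono) (auto simp: M_def)
          ultimately show ?thesis using \<open>M > 0\<close> by simp
        qed
        then have "X0 s - X0 t \<le> f y + f x - f (c + t *\<^sub>R n) - f (c - t *\<^sub>R n)" by (rule field_le_epsilon)
        then show ?thesis by (simp add: cx cy)
      qed
      have memc: "c + s *\<^sub>R n \<in> \<Omega>" "c - s *\<^sub>R n \<in> \<Omega>" using xy by (simp_all add: cx cy)
      have "(X0 has_real_derivative m * \<psi> s) (at s)"
        using X0_deriv[of s] s by (simp add: at_within_Icc_at)
      then have J_deriv: "(?J has_real_derivative (dd f [n] (c + s *\<^sub>R n) - dd f [n] (c - s *\<^sub>R n)) - m * \<psi> s) (at s)"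
        by (intro DERIV_diff symmetric_sum_deriv[where S = \<Omega>, OF f_differentiable memc])
      have "E f x y = dd f [n] (c + s *\<^sub>R n) - dd f [n] (c - s *\<^sub>R n)"
        using E_symmetric(1)[OF f_twice convex n s(1) memc] by (simp only: cx cy)
      moreover have "\<not> dd f [n] (c + s *\<^sub>R n) - dd f [n] (c - s *\<^sub>R n) - m * \<psi> s < 0"
      proof
        assume "dd f [n] (c + s *\<^sub>R n) - dd f [n] (c - s *\<^sub>R n) - m * \<psi> s < 0"
        from DERIV_neg_dec_left[OF J_deriv this]
        obtain d where d: "d > 0" "\<forall>h>0. h < d \<longrightarrow> ?J s < ?J (s - h)" by blast
        define h where "h = min (d / 2) s"
        have h: "h > 0" "h < d" "h \<le> s" using d(1) s by (auto simp: h_def)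
        have "?J s < ?J (s - h)" using d(2) h by blast
        moreover have "?J (s - h) \<le> ?J s" using h by (intro mono) auto
        ultimately show False by linarith
      qed
      ultimately have "E f x y \<ge> m * \<psi> s" by linarith
      then show ?thesis unfolding f_def s_def .
    qed
  qed
qed

end
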